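(* Let $n\ge 2$. Every connected complete projective special real manifold $\mathcal{H}\subset\{h=1\}\subset\mathbb{R}^{n+1}$ of dimension $n$ whose defining homogeneous cubic polynomial $h$ is reducible is linearly equivalent to exactly one of the following complete projective special real manifolds: a) $\{x\in\mathbb{R}^{n+1}\mid x_{n+1}(\sum_{i=1}^{n-1}x_i^2-x_n^2)=1,\ x_{n+1}<0,\ x_n>0\}$, b) $\{x\in\mathbb{R}^{n+1}\mid (x_1+x_{n+1})(\sum_{i=1}^{n}x_i^2-x_{n+1}^2)=1,\ x_1+x_{n+1}<0\}$, c) $\{x\in\mathbb{R}^{n+1}\mid x_1(\sum_{i=1}^{n}x_i^2-x_{n+1}^2)=1,\ x_1<0,\ x_{n+1}>0\}$, d) $\{x\in\mathbb{R}^{n+1}\mid x_1(x_1^2-\sum_{i=2}^{n+1}x_i^2)=1,\ x_1>0\}$.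
   Context: A hypersurface $\mathcal{H}\subset\mathbb{R}^{n+1}$ is a projective special real manifold if there is a homogeneous cubic polynomial $h:\mathbb{R}^{n+1}\to\mathbb{R}$ such that $\mathcal{H}\subset\{h=1\}$ and the symmetric tensor $g_{\mathcal{H}}:=-\frac13\partial^2h|_{T\mathcal{H}\times T\mathcal{H}}$ is positive definite, where $\partial^2h$ is the Hessian of $h$. It is called complete if the Riemannian manifold $(\mathcal{H},g_{\mathcal{H}})$ is complete. The polynomial $h$ is reducible if it is a product of real polynomials of lower (positive) degree. Two projective special real manifolds in $\mathbb{R}^{n+1}$ are linearly equivalent (isomorphic) if there is a linear transformation of $\mathbb{R}^{n+1}$ inducing a bijection between them. *)

theory Defs
  imports "HOL-Analysis.Analysis"
begin

section \<open>Polynomial functions on Euclidean space\<close>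

text \<open>
  Over the reals a polynomial is determined by its values, so polynomials in the coordinates are
  represented as functions.  A multi-index is a function \<open>\<alpha> :: 'm \<Rightarrow> nat\<close>; as the index type is
  finite, only finitely many multi-indices have a given total degree, and the sums below are
  genuine finite sums.
\<close>

lemma finite_multi_indices: "finite {\<alpha> :: 'm::finite \<Rightarrow> nat. sum \<alpha> UNIV \<le> d}"
proof (rule finite_subset)
  show "{\<alpha> :: 'm \<Rightarrow> nat. sum \<alpha> UNIV \<le> d} \<subseteq> PiE UNIV (\<lambda>_. {..d})"
    using member_le_sum[of _ "UNIV :: 'm set"] by (auto intro: order_trans)
  show "finite (PiE (UNIV :: 'm set) (\<lambda>_. {..d}))"
    by (rule finite_PiE) auto
qed

definition monomial_fun :: "('m \<Rightarrow> nat) \<Rightarrow> real ^ 'm::finite \<Rightarrow> real" where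
  "monomial_fun \<alpha> x = (\<Prod>i\<in>UNIV. (x $ i) ^ \<alpha> i)"

definition poly_degree_le :: "nat \<Rightarrow> (real ^ 'm::finite \<Rightarrow> real) \<Rightarrow> bool" where
  "poly_degree_le d f \<longleftrightarrow>
     (\<exists>c. \<forall>x. f x = (\<Sum>\<alpha> | sum \<alpha> UNIV \<le> d. c \<alpha> * monomial_fun \<alpha> x))"

definition poly_map :: "(real ^ 'm::finite \<Rightarrow> real) \<Rightarrow> bool" where
  "poly_map f \<longleftrightarrow> (\<exists>d. poly_degree_le d f)"

definition total_degree :: "(real ^ 'm::finite \<Rightarrow> real) \<Rightarrow> nat" where
  "total_degree f = (LEAST d. poly_degree_le d f)"

definition homogeneous_poly :: "nat \<Rightarrow> (real ^ 'm::finite \<Rightarrow> real) \<Rightarrow> bool" where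
  "homogeneous_poly d f \<longleftrightarrow>
     (\<exists>c. \<forall>x. f x = (\<Sum>\<alpha> | sum \<alpha> UNIV = d. c \<alpha> * monomial_fun \<alpha> x))"

definition reducible_poly :: "(real ^ 'm::finite \<Rightarrow> real) \<Rightarrow> bool" where
  "reducible_poly h \<longleftrightarrow>
     (\<exists>p q. poly_map p \<and> poly_map q \<and>
            0 < total_degree p \<and> total_degree p < total_degree h \<and>
            0 < total_degree q \<and> total_degree q < total_degree h \<and>
            (\<forall>x. h x = p x * q x))"


section \<open>Hypersurfaces and their tangent spaces\<close>

text \<open>\<open>k\<close>-fold continuous differentiability; intended for open sets.\<close>

primrec cont_diff_on ::
  "nat \<Rightarrow> ('a::real_normed_vector \<Rightarrow> 'b::real_normed_vector) \<Rightarrow> 'a set \<Rightarrow> bool" where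
  "cont_diff_on 0 f U \<longleftrightarrow> continuous_on U f"
| "cont_diff_on (Suc k) f U \<longleftrightarrow>
     (\<forall>x\<in>U. f differentiable (at x)) \<and>
     (\<forall>v. cont_diff_on k (\<lambda>x. frechet_derivative f (at x) v) U)"

definition smooth_fun_on ::
  "('a::real_normed_vector \<Rightarrow> 'b::real_normed_vector) \<Rightarrow> 'a set \<Rightarrow> bool" where
  "smooth_fun_on f U \<longleftrightarrow> (\<forall>k. cont_diff_on k f U)"

text \<open>A nonempty smooth embedded submanifold of codimension one.\<close>

definition hypersurface :: "(real ^ 'm::finite) set \<Rightarrow> bool" where
  "hypersurface H \<longleftrightarrow> H \<noteq> {} \<and>
     (\<forall>p\<in>H. \<exists>U (\<phi> :: real ^ 'm \<Rightarrow> real).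
        open U \<and> p \<in> U \<and> smooth_fun_on \<phi> U \<and>
        H \<inter> U = {x \<in> U. \<phi> x = 0} \<and>
        (\<forall>x\<in>H \<inter> U. frechet_derivative \<phi> (at x) \<noteq> (\<lambda>v. 0)))"

definition tangent_vectors :: "(real ^ 'm::finite) set \<Rightarrow> real ^ 'm \<Rightarrow> (real ^ 'm) set" where
  "tangent_vectors H p =
     {vector_derivative \<gamma> (at 0) | \<gamma>.
        \<gamma> 0 = p \<and> (\<exists>\<epsilon>>0. \<gamma> C1_differentiable_on {-\<epsilon><..<\<epsilon>} \<and> \<gamma> ` {-\<epsilon><..<\<epsilon>} \<subseteq> H)}"


section \<open>Projective special real manifolds\<close>

definition hessian :: "(real ^ 'm::finite \<Rightarrow> real) \<Rightarrow> real ^ 'm \<Rightarrow> real ^ 'm \<Rightarrow> real ^ 'm \<Rightarrow> real" where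
  "hessian h p v w =
     frechet_derivative (\<lambda>x. frechet_derivative h (at x) w) (at p) v"

definition psr_metric ::
  "(real ^ 'm::finite \<Rightarrow> real) \<Rightarrow> real ^ 'm \<Rightarrow> real ^ 'm \<Rightarrow> real ^ 'm \<Rightarrow> real" where
  "psr_metric h p v w = - (1 / 3) * hessian h p v w"

definition psr_manifold :: "(real ^ 'm::finite \<Rightarrow> real) \<Rightarrow> (real ^ 'm) set \<Rightarrow> bool" where
  "psr_manifold h H \<longleftrightarrow>
     homogeneous_poly 3 h \<and> hypersurface H \<and> H \<subseteq> {x. h x = 1} \<and>
     (\<forall>p\<in>H. \<forall>v\<in>tangent_vectors H p. v \<noteq> 0 \<longrightarrow> psr_metric h p v v > 0)"

text \<open>
  The length takes values in \<open>[0, \<infinity>]\<close>: \<^const>\<open>valid_path\<close> allows the velocity to be unbounded near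
  the finitely many exceptional parameters, and such a path may have infinite length (which a
  Henstock--Kurzweil integral would report as \<open>0\<close>).  Admitting these paths does not change the
  distance, and points in different components have distance \<open>\<infinity>\<close>.
\<close>

definition psr_length :: "(real ^ 'm::finite \<Rightarrow> real) \<Rightarrow> (real \<Rightarrow> real ^ 'm) \<Rightarrow> ennreal" where
  "psr_length h \<gamma> =
     (\<integral>\<^sup>+ t\<in>{0..1}.
        ennreal (sqrt (psr_metric h (\<gamma> t)
                         (vector_derivative \<gamma> (at t within {0..1}))
                         (vector_derivative \<gamma> (at t within {0..1})))) \<partial>lborel)"

definition psr_dist ::
  "(real ^ 'm::finite \<Rightarrow> real) \<Rightarrow> (real ^ 'm) set \<Rightarrow> real ^ 'm \<Rightarrow> real ^ 'm \<Rightarrow> ennreal" where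
  "psr_dist h H p q =
     (INF \<gamma>\<in>{\<gamma>. valid_path \<gamma> \<and> path_image \<gamma> \<subseteq> H \<and> pathstart \<gamma> = p \<and> pathfinish \<gamma> = q}.
        psr_length h \<gamma>)"

text \<open>Metric completeness with respect to the Riemannian distance.\<close>

definition complete_psr_manifold :: "(real ^ 'm::finite \<Rightarrow> real) \<Rightarrow> (real ^ 'm) set \<Rightarrow> bool" where
  "complete_psr_manifold h H \<longleftrightarrow>
     psr_manifold h H \<and>
     (\<forall>s. (\<forall>k. s k \<in> H) \<and>
          (\<forall>\<epsilon>>0. \<exists>N. \<forall>j\<ge>N. \<forall>k\<ge>N. psr_dist h H (s j) (s k) < ennreal \<epsilon>) \<longrightarrow>
          (\<exists>l\<in>H. (\<lambda>k. psr_dist h H (s k) l) \<longlonglongrightarrow> 0))"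

text \<open>
  Invertibility of \<open>L\<close> is not required separately: the cone over a projective special real
  manifold is open, so a linear map taking one such manifold onto another is surjective.
\<close>

definition linearly_equivalent :: "(real ^ 'm::finite) set \<Rightarrow> (real ^ 'm) set \<Rightarrow> bool" where
  "linearly_equivalent H K \<longleftrightarrow> (\<exists>L :: real ^ 'm \<Rightarrow> real ^ 'm. linear L \<and> bij_betw L H K)"


section \<open>The four model hypersurfaces\<close>

text \<open>
  The function \<open>e\<close> numbers the coordinates, \<open>x $ e i\<close> being the \<open>i\<close>-th one; it is meant to be a
  bijection from \<open>{1..n+1}\<close> onto the index type.
\<close>

datatype model = Model_a | Model_b | Model_c | Model_d

fun model_poly :: "(nat \<Rightarrow> 'm) \<Rightarrow> nat \<Rightarrow> model \<Rightarrow> real ^ 'm::finite \<Rightarrow> real" where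
  "model_poly e n Model_a x =
     x $ e (n+1) * ((\<Sum>i=1..n-1. (x $ e i)\<^sup>2) - (x $ e n)\<^sup>2)"
| "model_poly e n Model_b x =
     (x $ e 1 + x $ e (n+1)) * ((\<Sum>i=1..n. (x $ e i)\<^sup>2) - (x $ e (n+1))\<^sup>2)"
| "model_poly e n Model_c x =
     x $ e 1 * ((\<Sum>i=1..n. (x $ e i)\<^sup>2) - (x $ e (n+1))\<^sup>2)"
| "model_poly e n Model_d x =
     x $ e 1 * ((x $ e 1)\<^sup>2 - (\<Sum>i=2..n+1. (x $ e i)\<^sup>2))"

fun model_set :: "(nat \<Rightarrow> 'm) \<Rightarrow> nat \<Rightarrow> model \<Rightarrow> (real ^ 'm::finite) set" where
  "model_set e n Model_a =
     {x. model_poly e n Model_a x = 1 \<and> x $ e (n+1) < 0 \<and> x $ e n > 0}"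
| "model_set e n Model_b =
     {x. model_poly e n Model_b x = 1 \<and> x $ e 1 + x $ e (n+1) < 0}"
| "model_set e n Model_c =
     {x. model_poly e n Model_c x = 1 \<and> x $ e 1 < 0 \<and> x $ e (n+1) > 0}"
| "model_set e n Model_d =
     {x. model_poly e n Model_d x = 1 \<and> x $ e 1 > 0}"

end

theory Submission imports Defs begin

text \<open>
  If a product of two polynomials of degree at most two is homogeneous of degree three, it is also
  the product of a linear form \<open>l\<close> and a quadratic form \<open>B x x\<close>, because the product of the
  quadratic parts of the factors vanishes identically and the ring of polynomials has no zero divisors
  (\<open>reducible_cubic_factors\<close>).  So one works throughout with
  \<open>h x = l x * B x x\<close>, whose derivatives are explicit (locale \<open>factored_cubic\<close>).

  Euler's relation makes every level set point transversal to the rays through the origin.  Hence a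
  hypersurface \<open>H\<close> inside \<open>{h = 1}\<close> is open in it and its tangent spaces are the kernels of the
  differential of \<open>h\<close> (\<open>hypersurface_openin\<close>, \<open>tangent_vectors_eq\<close>).  If \<open>H\<close> is complete, it is
  also closed: otherwise a radially projected segment would leave \<open>H\<close> after finite length, giving a
  Cauchy sequence without a limit (\<open>complete_psr_manifold_closed\<close>).  A connected complete \<open>H\<close> is
  therefore a whole connected component of \<open>{h = 1}\<close>.

  The normal forms come from the restriction of the quadratic form to the kernel of \<open>l\<close>.  Let
  \<open>p \<in> H\<close> with \<open>l p > 0\<close>.  Positivity of the metric at \<open>p\<close> implies that the form is negative definite
  on the subspace on which both \<open>l\<close> and \<open>B p\<close> vanish, and this has codimension at most two.  If
  the form is negative definite on the kernel of \<open>l\<close>, one gets model d.  If it is only semidefinite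
  there, one gets model b.  If it is Lorentzian there, the kernel of \<open>l\<close> has an orthogonal
  complement, spanned by a vector \<open>u\<close>; model a arises for \<open>B u u = 0\<close> and model c for \<open>B u u < 0\<close>.
  The case \<open>B u u > 0\<close> cannot occur: the multiple of \<open>u\<close> on the level set would lie in the same
  component as \<open>p\<close>, but there the tangent space is the kernel of \<open>l\<close> and the metric would be
  indefinite (\<open>normal_form_cases\<close>).

  The models are complete because the Hessian of \<open>- ln h\<close> restricts to three times the metric and
  dominates the squares of enough logarithmic derivatives.  For suitable linear forms \<open>f\<close> that are
  positive on the model, \<open>\<bar>f v / f x\<bar>\<close> is at most \<open>sqrt 3\<close> times the length of \<open>v\<close> (\<open>log_derivative_bounds\<close>), so \<open>ln f\<close> is
  Lipschitz for the Riemannian distance.  Along a Cauchy sequence all these forms converge to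
  positive limits, and as they separate points the sequence converges inside the model
  (\<open>complete_psr_manifoldI\<close>, \<open>chamber_complete\<close>).

  Finally a linear equivalence transports \<open>h\<close> to the model polynomial, since the two agree on the
  open cone over \<open>H\<close>.  It thus preserves the dimension of the span of the critical points of \<open>h\<close>.
  This number is \<open>n + 1\<close>, \<open>1\<close>, \<open>n\<close>, \<open>0\<close> for the models a, b, c, d
  (\<open>dim_critical_set_model\<close>), so no two of them are equivalent.
\<close>


section \<open>Factoring a reducible cubic form\<close>

lemma monomial_fun_scaleR: "monomial_fun \<alpha> (t *\<^sub>R x) = t ^ sum \<alpha> UNIV * monomial_fun \<alpha> x"
  by (simp add: monomial_fun_def power_mult_distrib prod.distrib power_sum)

lemma homogeneous_poly_scaleR:
  assumes "homogeneous_poly d f"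
  shows "f (t *\<^sub>R x) = t ^ d * f x"
proof -
  obtain c where c: "\<And>x. f x = (\<Sum>\<alpha> | sum \<alpha> UNIV = d. c \<alpha> * monomial_fun \<alpha> x)"
    using assms unfolding homogeneous_poly_def by blast
  show ?thesis
    unfolding c sum_distrib_left by (intro sum.cong) (auto simp: monomial_fun_scaleR)
qed

lemma monomial_fun_increment:
  "x $ i * monomial_fun \<alpha> x = monomial_fun (\<alpha>(i := Suc (\<alpha> i))) x"
  unfolding monomial_fun_def by (simp add: prod.remove[of UNIV i] mult_ac)

lemma sum_increment:
  fixes \<alpha> :: "'m::finite \<Rightarrow> nat"
  shows "sum (\<alpha>(i := Suc (\<alpha> i))) UNIV = Suc (sum \<alpha> UNIV)"
  by (simp add: sum.remove[of UNIV i])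

text \<open>
  Lowering one positive exponent peels a coordinate off a monomial; this is what turns sums over
  multi-indices into linear and bilinear expressions.
\<close>

lemma multi_index_SucE:
  fixes \<alpha> :: "'m::finite \<Rightarrow> nat"
  assumes "sum \<alpha> UNIV = Suc k"
  obtains i \<beta> where "sum \<beta> UNIV = k" "\<alpha> = \<beta>(i := Suc (\<beta> i))"
proof -
  obtain i where i: "\<alpha> i \<noteq> 0"
    using assms by (metis nat.distinct(1) sum.neutral)
  define \<beta> where "\<beta> = \<alpha>(i := \<alpha> i - 1)"
  have eq: "\<alpha> = \<beta>(i := Suc (\<beta> i))"
    using i by (auto simp: \<beta>_def)
  moreover have "sum \<beta> UNIV = k"
    using assms sum_increment[of \<beta> i] eq by simp
  ultimately show ?thesis using that by blast
qed

lemma monomial_fun_degree_0: "sum \<alpha> UNIV = 0 \<Longrightarrow> monomial_fun \<alpha> x = 1"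
  by (simp add: monomial_fun_def)

lemma homogeneous_poly_linear:
  assumes "homogeneous_poly 1 f"
  shows "linear f"
proof -
  obtain c where c: "\<And>x. f x = (\<Sum>\<alpha> | sum \<alpha> UNIV = 1. c \<alpha> * monomial_fun \<alpha> x)"
    using assms unfolding homogeneous_poly_def by blast
  have "\<exists>i. \<forall>x. monomial_fun \<alpha> x = x $ i" if "sum \<alpha> UNIV = 1" for \<alpha> :: "'a \<Rightarrow> nat"
    using that multi_index_SucE[of \<alpha> 0] monomial_fun_increment monomial_fun_degree_0
    by (metis One_nat_def mult.right_neutral)
  then obtain i where i: "\<And>\<alpha> :: 'a \<Rightarrow> nat. \<And>x. sum \<alpha> UNIV = 1 \<Longrightarrow> monomial_fun \<alpha> x = x $ i \<alpha>"
    by metis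
  have "f = (\<lambda>x. \<Sum>\<alpha> | sum \<alpha> UNIV = 1. c \<alpha> * x $ i \<alpha>)"
    by (simp add: fun_eq_iff c i)
  then show ?thesis
    by (simp add: linear_iff sum.distrib sum_distrib_left algebra_simps)
qed

lemma homogeneous_poly_quadratic_form:
  assumes "homogeneous_poly 2 f"
  obtains B where "bilinear B" "\<And>x y. B x y = B y x" "\<And>x. f x = B x x"
proof -
  obtain c where c: "\<And>x. f x = (\<Sum>\<alpha> | sum \<alpha> UNIV = 2. c \<alpha> * monomial_fun \<alpha> x)"
    using assms unfolding homogeneous_poly_def by blast
  have "\<exists>i j. \<forall>x. monomial_fun \<alpha> x = x $ i * x $ j" if "sum \<alpha> UNIV = 2" for \<alpha> :: "'a \<Rightarrow> nat"
  proof -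
    from that obtain i \<beta> where 1: "sum \<beta> UNIV = 1" "\<alpha> = \<beta>(i := Suc (\<beta> i))"
      using multi_index_SucE[of \<alpha> 1] by (metis Suc_1)
    from 1(1) obtain j \<gamma> where 2: "sum \<gamma> UNIV = 0" "\<beta> = \<gamma>(j := Suc (\<gamma> j))"
      using multi_index_SucE[of \<beta> 0] by (metis One_nat_def)
    show ?thesis
      by (metis 1(2) 2 monomial_fun_increment monomial_fun_degree_0 mult.right_neutral)
  qed
  then obtain i j where ij:
    "\<And>\<alpha> :: 'a \<Rightarrow> nat. \<And>x. sum \<alpha> UNIV = 2 \<Longrightarrow> monomial_fun \<alpha> x = x $ i \<alpha> * x $ j \<alpha>"
    by metis
  define B where "B = (\<lambda>x y :: real^'a. \<Sum>\<alpha> | sum \<alpha> UNIV = 2.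
    c \<alpha> * (x $ i \<alpha> * y $ j \<alpha> + y $ i \<alpha> * x $ j \<alpha>) / 2)"
  show ?thesis
  proof
    show "bilinear B"
      unfolding bilinear_def linear_iff B_def
      by (auto simp: sum.distrib[symmetric] sum_distrib_left algebra_simps add_divide_distrib
               intro!: sum.cong)
    show "B x y = B y x" for x y
      by (simp add: B_def algebra_simps)
    show "f x = B x x" for x
      by (simp add: c B_def ij)
  qed
qed

lemma homogeneous_poly_add:
  assumes "homogeneous_poly d f" "homogeneous_poly d g"
  shows "homogeneous_poly d (\<lambda>x. f x + g x)"
proof -
  obtain c c' where c: "\<And>x. f x = (\<Sum>\<alpha> | sum \<alpha> UNIV = d. c \<alpha> * monomial_fun \<alpha> x)"
    "\<And>x. g x = (\<Sum>\<alpha> | sum \<alpha> UNIV = d. c' \<alpha> * monomial_fun \<alpha> x)"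
    using assms unfolding homogeneous_poly_def by blast
  show ?thesis
    unfolding homogeneous_poly_def
    by (rule exI[of _ "\<lambda>\<alpha>. c \<alpha> + c' \<alpha>"]) (simp add: c sum.distrib algebra_simps)
qed

lemma homogeneous_poly_cmult:
  assumes "homogeneous_poly d f"
  shows "homogeneous_poly d (\<lambda>x. a * f x)"
proof -
  obtain c where c: "\<And>x. f x = (\<Sum>\<alpha> | sum \<alpha> UNIV = d. c \<alpha> * monomial_fun \<alpha> x)"
    using assms unfolding homogeneous_poly_def by blast
  show ?thesis
    unfolding homogeneous_poly_def
    by (rule exI[of _ "\<lambda>\<alpha>. a * c \<alpha>"]) (simp add: c sum_distrib_left mult_ac)
qed

lemma homogeneous_poly_sum:
  assumes "\<And>i. i \<in> I \<Longrightarrow> homogeneous_poly d (f i)"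
  shows "homogeneous_poly d (\<lambda>x. \<Sum>i\<in>I. f i x)"
proof -
  have zero: "homogeneous_poly d (\<lambda>x. 0)"
    unfolding homogeneous_poly_def by (rule exI[of _ "\<lambda>_. 0"]) simp
  show ?thesis using assms
    by (induction I rule: infinite_finite_induct) (auto simp: zero intro: homogeneous_poly_add)
qed

lemma homogeneous_poly_monomial: "homogeneous_poly (sum \<alpha> UNIV) (monomial_fun \<alpha>)"
proof -
  have "finite {\<beta> :: 'a \<Rightarrow> nat. sum \<beta> UNIV = sum \<alpha> UNIV}"
    by (rule finite_subset[OF _ finite_multi_indices[of "sum \<alpha> UNIV"]]) auto
  then show ?thesis
    unfolding homogeneous_poly_def
    by (intro exI[of _ "\<lambda>\<beta>. if \<beta> = \<alpha> then 1 else 0"])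
       (simp add: if_distrib[of "\<lambda>c. c * _"] sum.delta cong: if_cong)
qed

lemma homogeneous_poly_const: "homogeneous_poly 0 (\<lambda>x. a)"
  using homogeneous_poly_cmult[OF homogeneous_poly_monomial[of "\<lambda>_. 0"], of a]
  by (simp add: monomial_fun_def)

text \<open>
  Together with closure under sums and multiples this shows that an explicit cubic expression in
  the coordinates is a homogeneous polynomial.
\<close>

lemma homogeneous_poly_coordinate_mult:
  assumes "homogeneous_poly d f"
  shows "homogeneous_poly (Suc d) (\<lambda>x. x $ i * f x)"
proof -
  obtain c where c: "\<And>x. f x = (\<Sum>\<alpha> | sum \<alpha> UNIV = d. c \<alpha> * monomial_fun \<alpha> x)"
    using assms unfolding homogeneous_poly_def by blast
  have "(\<lambda>x. x $ i * f x) =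
      (\<lambda>x. \<Sum>\<alpha> | sum \<alpha> UNIV = d. c \<alpha> * monomial_fun (\<alpha>(i := Suc (\<alpha> i))) x)"
    by (simp add: fun_eq_iff c sum_distrib_left flip: monomial_fun_increment)
       (simp add: mult_ac)
  moreover have "homogeneous_poly (Suc d) (monomial_fun (\<alpha>(i := Suc (\<alpha> i))))"
    if "sum \<alpha> UNIV = d" for \<alpha>
    using homogeneous_poly_monomial[of "\<alpha>(i := Suc (\<alpha> i))"] that by (simp only: sum_increment)
  ultimately show ?thesis
    by (auto intro!: homogeneous_poly_sum homogeneous_poly_cmult simp del: fun_upd_apply)
qed

lemma quartic_coeffs_zero:
  fixes a b c d e :: real
  assumes "\<And>t. a + b * t + c * t^2 + d * t^3 + e * t^4 = 0"
  shows "a = 0" "b = 0" "c = 0" "d = 0" "e = 0"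
  using assms[of 0] assms[of 1] assms[of "-1"] assms[of 2] assms[of "-2"] by simp_all

lemma poly_degree_leI:
  assumes "\<And>x. f x = (\<Sum>\<alpha>\<in>A. c \<alpha> * monomial_fun \<alpha> x)" "A \<subseteq> {\<alpha>. sum \<alpha> UNIV \<le> d}"
  shows "poly_degree_le d f"
  unfolding poly_degree_le_def
proof (intro exI allI)
  show "f x = (\<Sum>\<alpha> | sum \<alpha> UNIV \<le> d. (if \<alpha> \<in> A then c \<alpha> else 0) * monomial_fun \<alpha> x)" for x
    unfolding assms(1) using assms(2)
    by (intro sum.mono_neutral_cong_left) (auto simp: finite_multi_indices)
qed

lemma poly_degree_le_mono: "poly_degree_le d f \<Longrightarrow> d \<le> d' \<Longrightarrow> poly_degree_le d' f"
  unfolding poly_degree_le_def[of d] by (auto intro!: poly_degree_leI)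

lemma homogeneous_poly_degree_le: "homogeneous_poly d f \<Longrightarrow> poly_degree_le d f"
  unfolding homogeneous_poly_def by (auto intro!: poly_degree_leI)

lemma poly_degree_le_2_decompose:
  fixes f :: "real^'m::finite \<Rightarrow> real"
  assumes "poly_degree_le 2 f"
  obtains a m B where "linear m" "bilinear B" "\<And>x y. B x y = B y x"
    "\<And>x. f x = a + m x + B x x"
proof -
  obtain c where c: "\<And>x. f x = (\<Sum>\<alpha> | sum \<alpha> UNIV \<le> 2. c \<alpha> * monomial_fun \<alpha> x)"
    using assms unfolding poly_degree_le_def by blast
  define part where "part = (\<lambda>d x. \<Sum>\<alpha> | sum \<alpha> UNIV = d. c \<alpha> * monomial_fun \<alpha> (x :: real^'m))"
  have hom: "homogeneous_poly d (part d)" for d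
    unfolding part_def homogeneous_poly_def by blast
  have fin: "finite {\<alpha> :: 'm \<Rightarrow> nat. sum \<alpha> UNIV = d}" for d
    by (rule finite_subset[OF _ finite_multi_indices[of d]]) auto
  have set: "{\<alpha> :: 'm \<Rightarrow> nat. sum \<alpha> UNIV \<le> 2} =
      {\<alpha>. sum \<alpha> UNIV = 0} \<union> ({\<alpha>. sum \<alpha> UNIV = 1} \<union> {\<alpha>. sum \<alpha> UNIV = 2})"
    by (auto simp del: sum_eq_0_iff)
  have f: "f x = part 0 x + (part 1 x + part 2 x)" for x
    unfolding c set part_def
    by (subst sum.union_disjoint, simp_all only: fin finite_Un simp_thms, fastforce)
       (subst sum.union_disjoint, simp_all only: fin finite_Un simp_thms, fastforce)
  have "part 0 x = part 0 0" for x
    using homogeneous_poly_scaleR[OF hom[of 0], of 0 x] by simp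
  moreover obtain B where "bilinear B" "\<And>x y. B x y = B y x" "\<And>x. part 2 x = B x x"
    using homogeneous_poly_quadratic_form[OF hom] by blast
  ultimately show ?thesis
    using that[of "part 1" B "part 0 0"] homogeneous_poly_linear[OF hom] f
    by (metis add.assoc)
qed

text \<open>
  The factors witnessing reducibility need not be homogeneous.  Comparing coefficients of powers of
  \<open>t\<close> in \<open>h (t *\<^sub>R x)\<close> shows that the product of their quadratic parts is zero, hence one of the
  quadratic parts is zero; the coefficient of \<open>t ^ 3\<close> is then a linear form times a quadratic form.
\<close>

lemma reducible_cubic_factors:
  fixes h :: "real^'m::finite \<Rightarrow> real"
  assumes h: "homogeneous_poly 3 h" and red: "reducible_poly h"
  obtains l B where "linear l" "bilinear B" "\<And>x y. B x y = B y x" "\<And>x. h x = l x * B x x"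
proof -
  obtain p q where pq: "poly_map p" "poly_map q" "total_degree p < total_degree h"
    "total_degree q < total_degree h" and hpq: "\<And>x. h x = p x * q x"
    using red unfolding reducible_poly_def by blast
  have "total_degree h \<le> 3"
    unfolding total_degree_def by (rule Least_le) (rule homogeneous_poly_degree_le[OF h])
  moreover have "poly_degree_le (total_degree f) f" if "poly_map f" for f :: "real^'m \<Rightarrow> real"
    using that unfolding poly_map_def total_degree_def by (rule LeastI_ex)
  ultimately have "poly_degree_le 2 p" "poly_degree_le 2 q"
    using pq poly_degree_le_mono[of "total_degree p" p 2] poly_degree_le_mono[of "total_degree q" q 2]
    by simp_all
  then obtain a m B a' m' B' where
    p: "linear m" "bilinear B" "\<And>x y. B x y = B y x" "\<And>x. p x = a + m x + B x x" and
    q: "linear m'" "bilinear B'" "\<And>x y. B' x y = B' y x" "\<And>x. q x = a' + m' x + B' x x"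
    by (auto elim!: poly_degree_le_2_decompose)
  have coeffs: "h x = m x * B' x x + B x x * m' x" "B x x * B' x x = 0" for x
  proof -
    have "a * a' + (a * m' x + m x * a') * t + (a * B' x x + m x * m' x + B x x * a') * t^2
        + (m x * B' x x + B x x * m' x - h x) * t^3 + B x x * B' x x * t^4 = 0" for t
    proof -
      have "t^3 * h x = (a + m (t *\<^sub>R x) + B (t *\<^sub>R x) (t *\<^sub>R x)) * (a' + m' (t *\<^sub>R x) + B' (t *\<^sub>R x) (t *\<^sub>R x))"
        using homogeneous_poly_scaleR[OF h, of t x] hpq p(4) q(4) by metis
      also have "\<dots> = (a + t * m x + t^2 * B x x) * (a' + t * m' x + t^2 * B' x x)"
        using p q by (simp add: linear_scale bilinear_lmul bilinear_rmul power2_eq_square mult.assoc)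
      finally show ?thesis by algebra
    qed
    from quartic_coeffs_zero(4,5)[OF this]
    show "h x = m x * B' x x + B x x * m' x" "B x x * B' x x = 0" by simp_all
  qed
  \<comment> \<open>If neither quadratic form vanished, their product would be nonzero somewhere on the line
    through two points witnessing this.\<close>
  have "(\<forall>x. B x x = 0) \<or> (\<forall>x. B' x x = 0)"
  proof (rule ccontr)
    assume "\<not> ?thesis"
    then obtain x y where xy: "B x x \<noteq> 0" "B' y y \<noteq> 0" by blast
    have "B x x * B' x x + (B x x * (2 * B' x y) + 2 * B x y * B' x x) * t
        + (B x x * B' y y + 2 * B x y * (2 * B' x y) + B y y * B' x x) * t^2
        + (2 * B x y * B' y y + B y y * (2 * B' x y)) * t^3 + B y y * B' y y * t^4 = 0" for t
    proof -
      have "0 = B (x + t *\<^sub>R y) (x + t *\<^sub>R y) * B' (x + t *\<^sub>R y) (x + t *\<^sub>R y)"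
        using coeffs(2) by simp
      also have "\<dots> = (B x x + 2 * t * B x y + t^2 * B y y) * (B' x x + 2 * t * B' x y + t^2 * B' y y)"
        using p(2) q(2) p(3)[of y x] q(3)[of y x]
        by (simp add: bilinear_ladd bilinear_radd bilinear_lmul bilinear_rmul power2_eq_square algebra_simps)
      finally show ?thesis by algebra
    qed
    from quartic_coeffs_zero(1-3)[OF this] xy show False by simp
  qed
  then show ?thesis
  proof
    assume "\<forall>x. B x x = 0"
    with that[OF q(1) p(2), OF p(3)] that[OF p(1) q(2), OF q(3)] coeffs(1) show ?thesis by simp
  next
    assume "\<forall>x. B' x x = 0"
    with that[OF q(1) p(2), OF p(3)] coeffs(1) show ?thesis by simp
  qed
qed

section \<open>Calculus of a linear form times a quadratic form\<close>

lemma real_polynomial_function_directional_derivative: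
  fixes f :: "'a::real_normed_vector \<Rightarrow> real"
  assumes "real_polynomial_function f"
  shows "f differentiable (at x)"
    and "real_polynomial_function (\<lambda>x. frechet_derivative f (at x) v)"
proof -
  have "\<exists>f'. (\<forall>x. (f has_derivative f' x) (at x)) \<and> (\<forall>v. real_polynomial_function (\<lambda>x. f' x v))"
    using assms
  proof induction
    case (linear f)
    then show ?case
      by (intro exI[of _ "\<lambda>_. f"]) (auto intro: bounded_linear_imp_has_derivative)
  next
    case (const c)
    show ?case
      by (intro exI[of _ "\<lambda>_ _. 0"]) auto
  next
    case (add f g)
    then obtain f' g' where "\<forall>x. (f has_derivative f' x) (at x)" "\<forall>x. (g has_derivative g' x) (at x)"
      "\<forall>v. real_polynomial_function (\<lambda>x. f' x v)" "\<forall>v. real_polynomial_function (\<lambda>x. g' x v)"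
      by blast
    then show ?case
      by (intro exI[of _ "\<lambda>x v. f' x v + g' x v"]) (auto intro: has_derivative_add)
  next
    case (mult f g)
    then obtain f' g' where "\<forall>x. (f has_derivative f' x) (at x)" "\<forall>x. (g has_derivative g' x) (at x)"
      "\<forall>v. real_polynomial_function (\<lambda>x. f' x v)" "\<forall>v. real_polynomial_function (\<lambda>x. g' x v)"
      by blast
    with mult.hyps show ?case
      by (intro exI[of _ "\<lambda>x v. f x * g' x v + f' x v * g x"])
         (auto intro!: has_derivative_mult real_polynomial_function.intros(3,4))
  qed
  then obtain f' where f': "\<And>x. (f has_derivative f' x) (at x)"
    "\<And>v. real_polynomial_function (\<lambda>x. f' x v)"
    by blast
  show "f differentiable (at x)"
    using f'(1) unfolding differentiable_def by blast
  show "real_polynomial_function (\<lambda>x. frechet_derivative f (at x) v)"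
    using f'(2) by (simp flip: frechet_derivative_at[OF f'(1)])
qed

text \<open>
  Directional derivatives of polynomials are polynomials, so the recursion in the definition of
  smoothness never leaves this class.
\<close>

lemma real_polynomial_function_smooth:
  assumes "real_polynomial_function f"
  shows "smooth_fun_on f U"
proof -
  have "cont_diff_on k f U" for k
    using assms
  proof (induction k arbitrary: f)
    case 0
    have "isCont f x" for x
      by (rule differentiable_imp_continuous_within)
         (rule real_polynomial_function_directional_derivative(1)[OF 0])
    then show ?case
      by (simp add: continuous_at_imp_continuous_on)
  qed (auto intro: real_polynomial_function_directional_derivative)
  then show ?thesis
    by (simp add: smooth_fun_on_def)
qed

text \<open>
  The reducible cubic forms \<open>x \<mapsto> l x * B x x\<close>.  Keeping the two factors explicit gives closed
  formulas for the derivatives and for the metric.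
\<close>

locale factored_cubic =
  fixes l :: "real^'m::finite \<Rightarrow> real" and B :: "real^'m \<Rightarrow> real^'m \<Rightarrow> real"
  assumes linear_l: "linear l" and bilinear_B: "bilinear B" and B_sym: "B x y = B y x"
begin

definition cub :: "real^'m \<Rightarrow> real" where
  "cub x = l x * B x x"

definition dcub :: "real^'m \<Rightarrow> real^'m \<Rightarrow> real" where
  "dcub x v = l v * B x x + 2 * l x * B x v"

definition ddcub :: "real^'m \<Rightarrow> real^'m \<Rightarrow> real^'m \<Rightarrow> real" where
  "ddcub x v w = 2 * (l v * B x w + l w * B x v + l x * B v w)"

lemmas l_simps = linear_add[OF linear_l] linear_diff[OF linear_l] linear_scale[OF linear_l]
  linear_neg[OF linear_l] linear_0[OF linear_l]

lemmas B_simps = bilinear_ladd[OF bilinear_B] bilinear_radd[OF bilinear_B]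
  bilinear_lsub[OF bilinear_B] bilinear_rsub[OF bilinear_B]
  bilinear_lmul[OF bilinear_B] bilinear_rmul[OF bilinear_B]
  bilinear_lneg[OF bilinear_B] bilinear_rneg[OF bilinear_B]
  bilinear_lzero[OF bilinear_B] bilinear_rzero[OF bilinear_B]

lemma bounded_linear_l: "bounded_linear l"
  using linear_l by (simp add: linear_conv_bounded_linear)

lemma bounded_bilinear_B: "bounded_bilinear B"
  using bilinear_B by (simp add: bilinear_conv_bounded_bilinear)

lemma linear_B: "linear (B x)"
  using bilinear_B by (simp add: bilinear_def)

lemma continuous_on_l [continuous_intros]: "continuous_on S f \<Longrightarrow> continuous_on S (\<lambda>x. l (f x))"
  by (rule bounded_linear.continuous_on[OF bounded_linear_l])

lemma continuous_on_B [continuous_intros]: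
  "continuous_on S f \<Longrightarrow> continuous_on S g \<Longrightarrow> continuous_on S (\<lambda>x. B (f x) (g x))"
  by (rule bounded_bilinear.continuous_on[OF bounded_bilinear_B])

lemma continuous_on_cub [continuous_intros]:
  "continuous_on S f \<Longrightarrow> continuous_on S (\<lambda>x. cub (f x))"
  unfolding cub_def by (intro continuous_intros)

lemma continuous_on_dcub [continuous_intros]:
  "continuous_on S f \<Longrightarrow> continuous_on S g \<Longrightarrow> continuous_on S (\<lambda>x. dcub (f x) (g x))"
  unfolding dcub_def by (intro continuous_intros)

lemma continuous_on_ddcub [continuous_intros]:
  "continuous_on S f \<Longrightarrow> continuous_on S g \<Longrightarrow> continuous_on S k \<Longrightarrow>
    continuous_on S (\<lambda>x. ddcub (f x) (g x) (k x))"
  unfolding ddcub_def by (intro continuous_intros)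

lemma isCont_cub: "isCont cub x"
  using continuous_on_cub[of UNIV "\<lambda>x. x"]
  by (simp add: continuous_on_eq_continuous_at)

lemma B_has_derivative: "((\<lambda>x. B x x) has_derivative (\<lambda>v. 2 * B x v)) (at x)"
  by (rule has_derivative_eq_rhs[OF bounded_bilinear.FDERIV[OF bounded_bilinear_B
        has_derivative_ident has_derivative_ident]]) (auto simp: B_sym)

lemma cub_has_derivative: "(cub has_derivative dcub x) (at x)"
proof -
  have "((\<lambda>x. l x * B x x) has_derivative (\<lambda>v. l x * (2 * B x v) + l v * B x x)) (at x)"
    by (intro has_derivative_mult B_has_derivative bounded_linear_imp_has_derivative bounded_linear_l)
  then show ?thesis
    unfolding cub_def[abs_def] by (rule has_derivative_eq_rhs) (simp add: dcub_def fun_eq_iff)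
qed

lemma frechet_derivative_cub: "frechet_derivative cub (at x) = dcub x"
  using frechet_derivative_at[OF cub_has_derivative] by simp

lemma dcub_has_derivative: "((\<lambda>x. dcub x w) has_derivative (\<lambda>v. ddcub x v w)) (at x)"
proof -
  have "((\<lambda>x. l w * B x x + 2 * l x * B x w) has_derivative
      (\<lambda>v. l w * (2 * B x v) + (2 * l x * B v w + 2 * l v * B x w))) (at x)"
    by (intro has_derivative_add has_derivative_mult_right has_derivative_mult B_has_derivative
        bounded_linear_imp_has_derivative bounded_linear_l
        bounded_bilinear.bounded_linear_left[OF bounded_bilinear_B])
  then show ?thesis
    unfolding dcub_def by (rule has_derivative_eq_rhs) (simp add: ddcub_def fun_eq_iff)
qed

lemma hessian_cub: "hessian cub x v w = ddcub x v w"
  unfolding hessian_def frechet_derivative_cub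
  by (simp flip: frechet_derivative_at[OF dcub_has_derivative])

lemma psr_metric_cub: "psr_metric cub x v w = - ddcub x v w / 3"
  by (simp add: psr_metric_def hessian_cub)

lemma cub_scaleR: "cub (t *\<^sub>R x) = t ^ 3 * cub x"
  by (simp add: cub_def l_simps B_simps power3_eq_cube)

lemma dcub_self: "dcub x x = 3 * cub x"
  by (simp add: dcub_def cub_def)

lemma ddcub_self: "ddcub x x v = 2 * dcub x v"
  by (simp add: ddcub_def dcub_def)

lemma dcub_linear: "linear (dcub x)"
  by (simp add: linear_iff dcub_def l_simps B_simps algebra_simps)

lemma cub_expand:
  "cub (x + t *\<^sub>R v) = cub x + t * dcub x v + t^2 * (ddcub x v v / 2) + t^3 * cub v"
  using B_sym[of v x]
  by (simp add: cub_def dcub_def ddcub_def l_simps B_simps power2_eq_square power3_eq_cube algebra_simps)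

lemma cub_line_has_derivative:
  "((\<lambda>t. cub (a + t *\<^sub>R v)) has_real_derivative dcub (a + t *\<^sub>R v) v) (at t)"
proof -
  have "((\<lambda>t. a + t *\<^sub>R v) has_derivative (\<lambda>s. s *\<^sub>R v)) (at t)"
    by (auto intro!: derivative_eq_intros)
  from has_derivative_compose[OF this cub_has_derivative] show ?thesis
    by (simp add: has_field_derivative_def linear_scale[OF dcub_linear] mult_commute_abs)
qed

lemma real_polynomial_function_cub: "real_polynomial_function cub"
proof -
  have "B x x = (\<Sum>b\<in>Basis. (x \<bullet> b) * B b x)" for x
    using linear_sum[of "\<lambda>x'. B x' x" "\<lambda>b. (x \<bullet> b) *\<^sub>R b" Basis] bilinear_B
    by (simp add: bilinear_def euclidean_representation B_simps)
  then have "cub = (\<lambda>x. l x * (\<Sum>b\<in>Basis. (x \<bullet> b) * B b x))"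
    by (simp add: cub_def fun_eq_iff)
  moreover have "real_polynomial_function (\<lambda>x. l x * (\<Sum>b\<in>Basis. (x \<bullet> b) * B b x))"
    by (intro real_polynomial_function.intros(4) real_polynomial_function_sum
        real_polynomial_function.intros(1) bounded_linear_inner_left finite_Basis
        bounded_linear_l bounded_bilinear.bounded_linear_right[OF bounded_bilinear_B])
  ultimately show ?thesis
    by simp
qed

lemma homogeneous_poly_cub: "homogeneous_poly 3 cub"
proof -
  have expand: "x = (\<Sum>i\<in>UNIV. x $ i *\<^sub>R axis i 1)" for x :: "real^'m"
    by (metis basis_expansion scalar_mult_eq_scaleR)
  have 1: "l x = (\<Sum>i\<in>UNIV. x $ i * l (axis i 1))" for x
    by (subst expand[of x]) (simp only: linear_sum[OF linear_l] linear_scale[OF linear_l] real_scaleR_def)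
  have 2: "B y x = (\<Sum>i\<in>UNIV. x $ i * B y (axis i 1))" for x y
    by (subst expand[of x]) (simp only: linear_sum[OF linear_B] linear_scale[OF linear_B] real_scaleR_def)
  have 3: "B x x = (\<Sum>i\<in>UNIV. \<Sum>j\<in>UNIV. (x $ i * x $ j) * B (axis i 1) (axis j 1))" for x
  proof -
    have "B x x = (\<Sum>i\<in>UNIV. x $ i * B (axis i 1) x)"
      using 2[of x x] by (simp only: B_sym[of x "axis _ 1"])
    then show ?thesis
      by (simp only: 2[of _ x] sum_distrib_left mult.assoc)
  qed
  have "cub = (\<lambda>x. \<Sum>k\<in>UNIV. \<Sum>i\<in>UNIV. \<Sum>j\<in>UNIV.
      (l (axis k 1) * B (axis i 1) (axis j 1)) * (x $ k * (x $ i * (x $ j * 1))))"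
  proof
    fix x
    have "cub x = (\<Sum>k\<in>UNIV. x $ k * l (axis k 1)) *
        (\<Sum>i\<in>UNIV. \<Sum>j\<in>UNIV. (x $ i * x $ j) * B (axis i 1) (axis j 1))"
      unfolding cub_def by (rule arg_cong2[of _ _ _ _ "(*)", OF 1 3])
    also have "\<dots> = (\<Sum>k\<in>UNIV. \<Sum>i\<in>UNIV. \<Sum>j\<in>UNIV.
        (l (axis k 1) * B (axis i 1) (axis j 1)) * (x $ k * (x $ i * (x $ j * 1))))"
      unfolding sum_product unfolding sum_distrib_left by (intro sum.cong refl) (simp add: mult_ac)
    finally show "cub x = \<dots>" .
  qed
  moreover have "homogeneous_poly 3 (\<lambda>x. x $ k * (x $ i * (x $ j * 1)))" for i j k :: 'm
    unfolding numeral_3_eq_3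
    by (intro homogeneous_poly_coordinate_mult homogeneous_poly_const)
  ultimately show ?thesis
    by (simp only:) (intro homogeneous_poly_sum homogeneous_poly_cmult)
qed

text \<open>
  Radial projection onto the level set: on the cone where \<open>cub\<close> is positive, every ray meets
  \<open>{cub = 1}\<close> exactly once.
\<close>

definition rescale :: "real^'m \<Rightarrow> real^'m" where
  "rescale x = inverse (root 3 (cub x)) *\<^sub>R x"

lemma root3_cubed: "(root 3 y) ^ 3 = y"
  by (simp add: odd_real_root_pow)

lemma cub_rescale: "cub x > 0 \<Longrightarrow> cub (rescale x) = 1"
  using root3_cubed[of "cub x"]
  by (simp add: rescale_def cub_scaleR power_inverse)

lemma rescale_id: "cub x = 1 \<Longrightarrow> rescale x = x"
  by (simp add: rescale_def)

lemma continuous_on_rescale [continuous_intros]: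
  assumes "continuous_on S f" "\<And>x. x \<in> S \<Longrightarrow> cub (f x) > 0"
  shows "continuous_on S (\<lambda>x. rescale (f x))"
proof -
  have "cub (f x) \<noteq> 0" if "x \<in> S" for x
    using assms(2)[OF that] by simp
  then show ?thesis
    unfolding rescale_def using assms(1) by (auto intro!: continuous_intros)
qed

text \<open>
  The differential of \<open>rescale\<close> at \<open>c\<close> applied to \<open>v\<close>: the component of \<open>v\<close> tangent to the level
  set through \<open>c\<close>, scaled like \<open>c\<close>.
\<close>

definition rescale_velocity :: "real^'m \<Rightarrow> real^'m \<Rightarrow> real^'m" where
  "rescale_velocity c v = inverse (root 3 (cub c)) *\<^sub>R (v - (dcub c v / (3 * cub c)) *\<^sub>R c)"

lemma rescale_line_has_vector_derivative:
  assumes "cub (a + t *\<^sub>R v) > 0"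
  shows "((\<lambda>t. rescale (a + t *\<^sub>R v)) has_vector_derivative rescale_velocity (a + t *\<^sub>R v) v) (at t)"
proof -
  define c where "c = a + t *\<^sub>R v"
  define r where "r = root 3 (cub c)"
  have pos: "cub c > 0" "r > 0" and r3: "r ^ 3 = cub c"
    using assms root3_cubed by (simp_all add: c_def r_def)
  have dc: "((\<lambda>t. cub (a + t *\<^sub>R v)) has_real_derivative dcub c v) (at t)"
    unfolding c_def by (rule cub_line_has_derivative)
  have "((\<lambda>t. inverse (root 3 (cub (a + t *\<^sub>R v)))) has_real_derivative
      - (inverse r * (inverse (3 * r ^ 2) * dcub c v) * inverse r)) (at t)"
    using assms
    by (auto intro!: derivative_eq_intros DERIV_chain2[OF DERIV_real_root[of 3] dc, THEN DERIV_cong]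
        simp: r_def c_def)
  then have inv: "((\<lambda>t. inverse (root 3 (cub (a + t *\<^sub>R v)))) has_real_derivative
      - (inverse r * (dcub c v / (3 * cub c)))) (at t)"
    by (rule DERIV_cong) (use pos in \<open>simp add: r3[symmetric] power2_eq_square power3_eq_cube field_simps\<close>)
  have vline: "((\<lambda>t. a + t *\<^sub>R v) has_vector_derivative v) (at t)"
    by (auto intro!: derivative_eq_intros)
  have "((\<lambda>t. rescale (a + t *\<^sub>R v)) has_vector_derivative
      (inverse r *\<^sub>R v + (- (inverse r * (dcub c v / (3 * cub c)))) *\<^sub>R c)) (at t)"
    unfolding rescale_def
    using has_vector_derivative_scaleR[OF inv vline] by (simp add: r_def c_def)
  then show ?thesis
    by (simp add: rescale_velocity_def r_def c_def scaleR_diff_right)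
qed

lemma continuous_on_rescale_velocity:
  assumes "continuous_on S f" "\<And>x. x \<in> S \<Longrightarrow> cub (f x) > 0"
  shows "continuous_on S (\<lambda>x. rescale_velocity (f x) v)"
proof -
  have "cub (f x) \<noteq> 0" if "x \<in> S" for x
    using assms(2)[OF that] by simp
  then show ?thesis
    unfolding rescale_velocity_def using assms(1) by (auto intro!: continuous_intros)
qed

lemma rescale_line_C1:
  assumes "\<And>t. t \<in> S \<Longrightarrow> cub (a + t *\<^sub>R v) > 0"
  shows "(\<lambda>t. rescale (a + t *\<^sub>R v)) C1_differentiable_on S"
  unfolding C1_differentiable_on_def
  by (intro exI[of _ "\<lambda>t. rescale_velocity (a + t *\<^sub>R v) v"] conjI ballI
      rescale_line_has_vector_derivative continuous_on_rescale_velocity continuous_intros assms)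

text \<open>
  The Hessian of \<open>- ln cub\<close> is invariant under scaling and restricts to three times the metric on the
  level set.  Projecting \<open>v\<close> only removes its radial part, whose size is \<open>dcub c v / (3 * cub c)\<close>, so
  the speed of a projected segment is a continuous function of \<open>c\<close> and \<open>v\<close>.
\<close>

lemma psr_metric_rescale_velocity:
  assumes "cub c > 0"
  shows "psr_metric cub (rescale c) (rescale_velocity c v) (rescale_velocity c v)
    = 2 * (dcub c v / (3 * cub c))\<^sup>2 - ddcub c v v / (3 * cub c)"
proof -
  define r where "r = root 3 (cub c)"
  define a where "a = dcub c v / (3 * cub c)"
  have pos: "r > 0" and r3: "r ^ 3 = cub c"
    using assms root3_cubed by (simp_all add: r_def)
  have ac: "dcub c v = 3 * a * cub c"
    using assms by (simp add: a_def)
  have "ddcub (rescale c) (rescale_velocity c v) (rescale_velocity c v)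
      = inverse r ^ 3 * ddcub c (v - a *\<^sub>R c) (v - a *\<^sub>R c)"
    unfolding rescale_def rescale_velocity_def r_def[symmetric] a_def[symmetric]
    by (simp add: ddcub_def l_simps B_simps power3_eq_cube algebra_simps)
  also have "ddcub c (v - a *\<^sub>R c) (v - a *\<^sub>R c) = ddcub c v v - 2 * a * ddcub c c v + a^2 * ddcub c c c"
    using B_sym[of v c] by (simp add: ddcub_def l_simps B_simps power2_eq_square algebra_simps)
  also have "\<dots> = ddcub c v v - 6 * a^2 * cub c"
    by (simp add: ddcub_self dcub_self ac power2_eq_square algebra_simps)
  also have "inverse r ^ 3 = 1 / cub c"
    by (simp add: r3[symmetric] power_inverse divide_inverse)
  finally show ?thesis
    using assms by (simp add: psr_metric_cub a_def[symmetric] field_simps)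
qed

end

section \<open>Local structure of the hypersurface\<close>

context factored_cubic
begin

text \<open>
  If the ray through a point of \<open>H\<close> were tangent to \<open>H\<close>, then nearby points of \<open>H\<close> on a
  slightly tilted ray would have \<open>cub > 1\<close>, which is impossible.  So a local defining function changes sign along nearby
  rays, and each such ray meets \<open>H\<close>; as it meets \<open>{cub = 1}\<close> only once, the points of the level set
  near \<open>H\<close> belong to \<open>H\<close>.
\<close>

lemma hypersurface_openin:
  assumes hyp: "hypersurface H" and H: "H \<subseteq> {x. cub x = 1}"
  shows "openin (top_of_set {x. cub x = 1}) H"
  unfolding openin_contains_ball
proof (intro conjI H ballI)
  fix p assume p: "p \<in> H"
  then obtain U and \<phi> :: "real^'m \<Rightarrow> real" where U: "open U" "p \<in> U" and smooth: "smooth_fun_on \<phi> U"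
    and HU: "H \<inter> U = {x \<in> U. \<phi> x = 0}" and nz: "frechet_derivative \<phi> (at p) \<noteq> (\<lambda>v. 0)"
    using hyp unfolding hypersurface_def by blast
  define D where "D = frechet_derivative \<phi> (at p)"
  have diff: "\<phi> differentiable (at x)" if "x \<in> U" for x
  proof -
    have "cont_diff_on (Suc 0) \<phi> U"
      using smooth unfolding smooth_fun_on_def by blast
    then show ?thesis using that by simp
  qed
  have cont: "continuous_on U \<phi>"
    by (intro continuous_at_imp_continuous_on ballI differentiable_imp_continuous_within diff)
  have D: "(\<phi> has_derivative D) (at p)"
    using diff[OF U(2)] unfolding D_def by (simp add: frechet_derivative_works)
  have linD: "linear D"
    using D by (rule has_derivative_linear)
  have \<phi>p: "\<phi> p = 0"
    using HU p U(2) by blast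
  have level: "x \<in> H \<and> cub x = 1" if "x \<in> U" "\<phi> x = 0" for x
    using HU H that by blast
  have cub_p: "cub p = 1"
    using H p by blast
  obtain r where r: "r > 0" "ball p r \<subseteq> U"
    using U openE by blast
  have directional: "((\<lambda>s. \<phi> (p + s *\<^sub>R u)) has_real_derivative D u) (at 0)" for u
  proof -
    have line: "((\<lambda>s. p + s *\<^sub>R u) has_derivative (\<lambda>s. s *\<^sub>R u)) (at 0)"
      by (auto intro!: derivative_eq_intros)
    have "((\<lambda>s. \<phi> (p + s *\<^sub>R u)) has_derivative (\<lambda>s. D (s *\<^sub>R u))) (at 0)"
      using has_derivative_compose[OF line, of \<phi> D] D by simp
    then show ?thesis
      by (simp add: has_field_derivative_def linear_scale[OF linD] mult_commute_abs)
  qed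
  have transversal: "D p \<noteq> 0"
  proof
    assume Dp: "D p = 0"
    obtain w0 where "D w0 \<noteq> 0"
      using nz by (auto simp: D_def)
    define w where "w = (1 / D w0) *\<^sub>R w0"
    have Dw: "D w = 1"
      using \<open>D w0 \<noteq> 0\<close> by (simp add: w_def linear_scale[OF linD])
    \<comment> \<open>Tilt the radial direction by at most \<open>\<epsilon>\<close> times the transversal
      vector \<open>w\<close>; \<open>\<epsilon>\<close> is so small that \<open>cub\<close>
      still increases in all tilted directions \<open>u \<tau>\<close>, while
      \<open>\<phi>\<close> has opposite signs for \<open>\<tau> = 1\<close> and \<open>\<tau> =
      -1\<close>.\<close>
    define \<epsilon> where "\<epsilon> = 1 / (\<bar>dcub p w\<bar> + 1)"
    define u where "u = (\<lambda>\<tau>. p + (\<tau> * \<epsilon>) *\<^sub>R w)"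
    have \<epsilon>: "\<epsilon> > 0" "\<epsilon> * (\<bar>dcub p w\<bar> + 1) = 1"
      by (simp_all add: \<epsilon>_def)
    have Du: "D (u \<tau>) = \<tau> * \<epsilon>" for \<tau>
      by (simp add: u_def linear_add[OF linD] linear_scale[OF linD] Dp Dw)
    have "open {y. 2 < dcub y p}" "open {y. \<bar>dcub y w\<bar> < \<bar>dcub p w\<bar> + 1}"
      by (auto intro!: open_Collect_less continuous_intros)
    moreover have "dcub p p = 3"
      by (simp add: dcub_self cub_p)
    ultimately obtain r' where r': "r' > 0" "ball p r' \<subseteq> ball p r \<inter> {y. 2 < dcub y p} \<inter> {y. \<bar>dcub y w\<bar> < \<bar>dcub p w\<bar> + 1}"
      using openE[of "ball p r \<inter> {y. 2 < dcub y p} \<inter> {y. \<bar>dcub y w\<bar> < \<bar>dcub p w\<bar> + 1}" p] r(1)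
      by (auto simp: open_Int)
    have pos: "dcub y (u \<tau>) > 0" if y: "y \<in> ball p r'" and \<tau>: "\<bar>\<tau>\<bar> \<le> 1" for y \<tau>
    proof -
      have "\<bar>\<tau> * \<epsilon> * dcub y w\<bar> = \<bar>\<tau>\<bar> * (\<epsilon> * \<bar>dcub y w\<bar>)"
        using \<epsilon>(1) by (simp add: abs_mult)
      also have "\<dots> \<le> 1 * (\<epsilon> * (\<bar>dcub p w\<bar> + 1))"
        using y r'(2) \<tau> \<epsilon>(1) by (intro mult_mono) auto
      finally have "\<bar>\<tau> * \<epsilon> * dcub y w\<bar> \<le> 1"
        using \<epsilon>(2) by simp
      moreover have "dcub y p > 2"
        using y r'(2) by blast
      moreover have "dcub y (u \<tau>) = dcub y p + \<tau> * \<epsilon> * dcub y w"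
        by (simp add: u_def linear_add[OF dcub_linear] linear_scale[OF dcub_linear])
      ultimately show ?thesis by linarith
    qed
    define M where "M = norm p + \<epsilon> * norm w + 1"
    have M: "M > 0" "norm (u \<tau>) < M" if "\<bar>\<tau>\<bar> \<le> 1" for \<tau>
    proof -
      have "norm (u \<tau>) \<le> norm p + \<bar>\<tau>\<bar> * (\<epsilon> * norm w)"
        unfolding u_def using norm_triangle_ineq[of p "(\<tau> * \<epsilon>) *\<^sub>R w"] \<epsilon>(1) by (simp add: abs_mult)
      also have "\<dots> \<le> norm p + 1 * (\<epsilon> * norm w)"
        using \<epsilon>(1) that by (intro add_left_mono mult_right_mono) auto
      finally show "norm (u \<tau>) < M" by (simp add: M_def)
      show "M > 0" using \<epsilon>(1) by (simp add: M_def add_nonneg_pos)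
    qed
    obtain d1 where d1: "d1 > 0" "\<And>s. 0 < s \<Longrightarrow> s < d1 \<Longrightarrow> \<phi> (p + s *\<^sub>R u 1) > 0"
      using DERIV_pos_inc_right[OF directional[of "u 1"]] Du[of 1] \<epsilon>(1) \<phi>p by auto
    obtain d2 where d2: "d2 > 0" "\<And>s. 0 < s \<Longrightarrow> s < d2 \<Longrightarrow> \<phi> (p + s *\<^sub>R u (-1)) < 0"
      using DERIV_neg_dec_right[OF directional[of "u (-1)"]] Du[of "-1"] \<epsilon>(1) \<phi>p by auto
    have "Min {d1, d2, r' / M} > 0"
      using d1(1) d2(1) r'(1) M(1)[of 0] by simp
    then obtain s where "0 < s" "s < Min {d1, d2, r' / M}"
      using dense by blast
    then have s: "0 < s" "s < d1" "s < d2" "s < r' / M"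
      by simp_all
    have inball: "p + \<sigma> *\<^sub>R u \<tau> \<in> ball p r'" if "0 \<le> \<sigma>" "\<sigma> \<le> s" "\<bar>\<tau>\<bar> \<le> 1" for \<sigma> \<tau>
    proof -
      have "\<sigma> * norm (u \<tau>) \<le> s * M"
        using that M[of \<tau>] by (intro mult_mono) auto
      also have "\<dots> < r'"
        using s(4) M(1)[of 0] by (simp add: field_simps)
      finally show ?thesis using that by (simp add: dist_norm)
    qed
    have "continuous_on {-1..1} (\<lambda>\<tau>. \<phi> (p + s *\<^sub>R u \<tau>))"
      by (rule continuous_on_compose2[OF cont])
         (use inball[of s] s(1) r'(2) r(2) in \<open>auto simp: u_def subset_iff intro!: continuous_intros\<close>)
    then obtain \<tau> where \<tau>: "-1 \<le> \<tau>" "\<tau> \<le> 1" "\<phi> (p + s *\<^sub>R u \<tau>) = 0"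
      using IVT'[of "\<lambda>\<tau>. \<phi> (p + s *\<^sub>R u \<tau>)" "-1" 0 1] d1(2)[of s] d2(2)[of s] s by force
    have "p + s *\<^sub>R u \<tau> \<in> U"
    proof -
      have "\<bar>\<tau>\<bar> \<le> 1"
        using \<tau>(1,2) by simp
      then show ?thesis
        using inball[of s \<tau>] s(1) r'(2) r(2) by auto
    qed
    then have "cub (p + s *\<^sub>R u \<tau>) = 1"
      using level \<tau>(3) by blast
    moreover have "cub (p + 0 *\<^sub>R u \<tau>) < cub (p + s *\<^sub>R u \<tau>)"
    proof (rule DERIV_pos_imp_increasing[OF s(1)])
      fix \<sigma> assume \<sigma>: "0 \<le> \<sigma>" "\<sigma> \<le> s"
      have "dcub (p + \<sigma> *\<^sub>R u \<tau>) (u \<tau>) > 0"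
        using pos inball \<sigma> \<tau> by simp
      then show "\<exists>y. ((\<lambda>\<sigma>. cub (p + \<sigma> *\<^sub>R u \<tau>)) has_real_derivative y) (at \<sigma>) \<and> 0 < y"
        using cub_line_has_derivative by blast
    qed
    ultimately show False using cub_p by simp
  qed
  \<comment> \<open>Normalise the defining function so that it increases along the ray through
    \<open>p\<close>.\<close>
  define \<psi> where "\<psi> = (\<lambda>x. \<phi> x / D p)"
  have radial: "((\<lambda>s. \<psi> (p + s *\<^sub>R p)) has_real_derivative 1) (at 0)"
    unfolding \<psi>_def using DERIV_cdivide[OF directional[of p], of "D p"] transversal by simp
  have \<psi>p: "\<psi> p = 0"
    by (simp add: \<psi>_def \<phi>p)
  obtain d1 where d1: "d1 > 0" "\<And>s. 0 < s \<Longrightarrow> s < d1 \<Longrightarrow> \<psi> (p + s *\<^sub>R p) > 0"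
    using DERIV_pos_inc_right[OF radial] \<psi>p by auto
  obtain d2 where d2: "d2 > 0" "\<And>s. 0 < s \<Longrightarrow> s < d2 \<Longrightarrow> \<psi> (p - s *\<^sub>R p) < 0"
    using DERIV_pos_inc_left[OF radial] \<psi>p by auto
  have "Min {d1, d2, 1, r / (2 * (norm p + 1))} > 0"
    using d1(1) d2(1) r(1) by (simp add: add_nonneg_pos)
  then obtain \<eta> where "0 < \<eta>" "\<eta> < Min {d1, d2, 1, r / (2 * (norm p + 1))}"
    using dense by blast
  then have \<eta>: "0 < \<eta>" "\<eta> < d1" "\<eta> < d2" "\<eta> < 1" "\<eta> < r / (2 * (norm p + 1))"
    by simp_all
  have "2 * (norm p + 1) > 0"
    by (simp add: add_nonneg_pos)
  then have "\<eta> * (2 * (norm p + 1)) < r"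
    using \<eta>(5) by (simp add: pos_less_divide_eq)
  then have \<eta>p: "\<eta> * norm p < r / 2"
    using \<eta>(1) by (simp add: algebra_simps)
  have inU: "(1 + \<sigma>) *\<^sub>R x \<in> U" if "dist p x < r / 4" "\<bar>\<sigma>\<bar> \<le> \<eta>" for x \<sigma>
  proof -
    have "norm ((1 + \<sigma>) *\<^sub>R (x - p) + \<sigma> *\<^sub>R p) \<le> \<bar>1 + \<sigma>\<bar> * norm (x - p) + \<bar>\<sigma>\<bar> * norm p"
      using norm_triangle_ineq[of "(1 + \<sigma>) *\<^sub>R (x - p)" "\<sigma> *\<^sub>R p"] by simp
    also have "\<dots> \<le> 2 * norm (x - p) + \<eta> * norm p"
      using that(2) \<eta>(4) by (intro add_mono mult_right_mono) auto
    also have "\<dots> < r"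
      using that(1) \<eta>p by (simp add: dist_norm norm_minus_commute)
    also have "(1 + \<sigma>) *\<^sub>R (x - p) + \<sigma> *\<^sub>R p = (1 + \<sigma>) *\<^sub>R x - p"
      by (simp add: algebra_simps)
    finally show ?thesis
      using r(2) by (auto simp: dist_norm norm_minus_commute)
  qed
  have tends: "((\<lambda>x. \<psi> ((1 + \<sigma>) *\<^sub>R x)) \<longlongrightarrow> \<psi> ((1 + \<sigma>) *\<^sub>R p)) (nhds p)" if "\<bar>\<sigma>\<bar> \<le> \<eta>" for \<sigma>
  proof -
    have "isCont \<phi> ((1 + \<sigma>) *\<^sub>R p)"
      using inU[of p \<sigma>] r(1) that cont U(1) by (simp add: continuous_on_eq_continuous_at)
    then have "((\<lambda>x. \<phi> ((1 + \<sigma>) *\<^sub>R x)) \<longlongrightarrow> \<phi> ((1 + \<sigma>) *\<^sub>R p)) (nhds p)"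
      by (rule isCont_tendsto_compose) (intro tendsto_scaleR tendsto_const filterlim_ident)
    then show ?thesis
      unfolding \<psi>_def using transversal by (intro tendsto_divide tendsto_const)
  qed
  have "\<psi> ((1 + \<eta>) *\<^sub>R p) > 0" "\<psi> ((1 + - \<eta>) *\<^sub>R p) < 0"
    using d1(2)[of \<eta>] d2(2)[of \<eta>] \<eta> by (simp_all add: scaleR_add_left scaleR_diff_left)
  then have "\<forall>\<^sub>F x in nhds p. \<psi> ((1 + \<eta>) *\<^sub>R x) > 0" "\<forall>\<^sub>F x in nhds p. \<psi> ((1 + - \<eta>) *\<^sub>R x) < 0"
    using order_tendstoD(1)[OF tends[of \<eta>]] order_tendstoD(2)[OF tends[of "- \<eta>"]] \<eta>(1) by auto
  then have "\<forall>\<^sub>F x in nhds p. \<psi> ((1 + \<eta>) *\<^sub>R x) > 0 \<and> \<psi> ((1 + - \<eta>) *\<^sub>R x) < 0"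
    by (rule eventually_conj)
  then obtain \<delta> where \<delta>: "\<delta> > 0"
    "\<And>x. dist x p < \<delta> \<Longrightarrow> \<psi> ((1 + \<eta>) *\<^sub>R x) > 0 \<and> \<psi> ((1 + - \<eta>) *\<^sub>R x) < 0"
    unfolding eventually_nhds_metric by blast
  have "x \<in> H" if x: "dist p x < min \<delta> (r / 4)" "cub x = 1" for x
  proof -
    have "continuous_on {-\<eta>..\<eta>} (\<lambda>\<sigma>. \<phi> ((1 + \<sigma>) *\<^sub>R x))"
      by (rule continuous_on_compose2[OF cont]) (use inU[of x] x in \<open>auto intro!: continuous_intros\<close>)
    then have "continuous_on {-\<eta>..\<eta>} (\<lambda>\<sigma>. \<psi> ((1 + \<sigma>) *\<^sub>R x))"
      unfolding \<psi>_def using transversal by (intro continuous_intros) auto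
    then obtain \<sigma> where \<sigma>: "-\<eta> \<le> \<sigma>" "\<sigma> \<le> \<eta>" "\<psi> ((1 + \<sigma>) *\<^sub>R x) = 0"
      using IVT'[of "\<lambda>\<sigma>. \<psi> ((1 + \<sigma>) *\<^sub>R x)" "-\<eta>" 0 \<eta>] \<delta>(2)[of x] x(1) \<eta>(1) by (force simp: dist_commute)
    have "(1 + \<sigma>) *\<^sub>R x \<in> U"
      using inU[of x \<sigma>] \<sigma> x(1) by auto
    with \<sigma>(3) have *: "(1 + \<sigma>) *\<^sub>R x \<in> H" "cub ((1 + \<sigma>) *\<^sub>R x) = 1"
      using level[of "(1 + \<sigma>) *\<^sub>R x"] transversal by (auto simp: \<psi>_def)
    then have "(1 + \<sigma>) ^ 3 = 1 ^ 3"
      using x(2) by (simp add: cub_scaleR)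
    moreover have "0 \<le> 1 + \<sigma>"
      using \<sigma>(1) \<eta>(4) by linarith
    ultimately have "1 + \<sigma> = 1"
      using power_eq_imp_eq_base[of "1 + \<sigma>" 3 1] by simp
    with * show ?thesis by simp
  qed
  then show "\<exists>e>0. ball p e \<inter> {x. cub x = 1} \<subseteq> H"
    using \<delta>(1) r(1) by (intro exI[of _ "min \<delta> (r / 4)"]) auto
qed

lemma tangent_vectors_imp_kernel:
  assumes "H \<subseteq> {x. cub x = 1}" "v \<in> tangent_vectors H p"
  shows "dcub p v = 0"
proof -
  obtain \<gamma> \<epsilon> where \<gamma>: "v = vector_derivative \<gamma> (at 0)" "\<gamma> 0 = p" "\<epsilon> > 0"
    "\<gamma> C1_differentiable_on {-\<epsilon><..<\<epsilon>}" "\<gamma> ` {-\<epsilon><..<\<epsilon>} \<subseteq> H"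
    using assms(2) unfolding tangent_vectors_def by blast
  have "(\<gamma> has_vector_derivative v) (at 0)"
    using \<gamma> by (auto simp: C1_differentiable_on_eq vector_derivative_works)
  then have "(\<gamma> has_derivative (\<lambda>s. s *\<^sub>R v)) (at 0)"
    by (simp add: has_vector_derivative_def)
  from has_derivative_compose[OF this cub_has_derivative]
  have "((\<lambda>t. cub (\<gamma> t)) has_real_derivative dcub p v) (at 0)"
    using \<gamma>(2) by (simp add: has_field_derivative_def linear_scale[OF dcub_linear] mult_commute_abs)
  moreover have "((\<lambda>t. cub (\<gamma> t)) has_real_derivative 0) (at 0)"
  proof (rule has_field_derivative_transform_within_open[of "\<lambda>_. 1" _ _ "{-\<epsilon><..<\<epsilon>}"])
    show "1 = cub (\<gamma> t)" if "t \<in> {-\<epsilon><..<\<epsilon>}" for t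
      using subsetD[OF assms(1) subsetD[OF \<gamma>(5) imageI[OF that]]] by simp
  qed (use \<gamma>(3) in auto)
  ultimately show ?thesis
    using DERIV_unique by blast
qed

text \<open>
  Every vector in the kernel is realised by the radial projection of a straight line, which stays in
  \<open>H\<close> for a short time because \<open>H\<close> is open in the level set.
\<close>

lemma tangent_vectors_eq:
  assumes "openin (top_of_set {x. cub x = 1}) H" "p \<in> H"
  shows "tangent_vectors H p = {v. dcub p v = 0}"
proof (intro equalityI subsetI)
  have H: "H \<subseteq> {x. cub x = 1}"
    using assms(1) by (simp add: openin_imp_subset)
  show "v \<in> {v. dcub p v = 0}" if "v \<in> tangent_vectors H p" for v
    using tangent_vectors_imp_kernel[OF H that] by simp
  fix v assume "v \<in> {v. dcub p v = 0}"
  then have v: "dcub p v = 0" and p: "cub p = 1"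
    using H assms(2) by auto
  obtain e where e: "e > 0" "ball p e \<inter> {x. cub x = 1} \<subseteq> H"
    using assms unfolding openin_contains_ball by blast
  define \<gamma> where "\<gamma> = (\<lambda>t. rescale (p + t *\<^sub>R v))"
  define A where "A = {t. cub (p + t *\<^sub>R v) > 0}"
  have "open A"
    unfolding A_def by (intro open_Collect_less continuous_intros)
  moreover have "continuous_on A \<gamma>"
    unfolding \<gamma>_def A_def by (intro continuous_intros) auto
  ultimately have "open (A \<inter> \<gamma> -` ball p e)"
    using continuous_open_preimage by blast
  moreover have "\<gamma> 0 = p"
    by (simp add: \<gamma>_def rescale_id p)
  moreover have "0 \<in> A \<inter> \<gamma> -` ball p e"
    using e(1) \<open>\<gamma> 0 = p\<close> by (simp add: A_def p)
  ultimately obtain \<epsilon> where "\<epsilon> > 0" "ball 0 \<epsilon> \<subseteq> A \<inter> \<gamma> -` ball p e"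
    using openE by blast
  moreover have "ball 0 \<epsilon> = {-\<epsilon><..<\<epsilon>}"
    by (auto simp: dist_real_def)
  ultimately have \<epsilon>: "\<epsilon> > 0" "\<And>t. t \<in> {-\<epsilon><..<\<epsilon>} \<Longrightarrow> cub (p + t *\<^sub>R v) > 0 \<and> \<gamma> t \<in> ball p e"
    by (auto simp: A_def)
  have "\<gamma> C1_differentiable_on {-\<epsilon><..<\<epsilon>}"
    unfolding \<gamma>_def by (rule rescale_line_C1) (use \<epsilon>(2) in blast)
  moreover have "\<gamma> ` {-\<epsilon><..<\<epsilon>} \<subseteq> H"
    using e(2) \<epsilon>(2) cub_rescale by (auto simp: \<gamma>_def)
  moreover have "vector_derivative \<gamma> (at 0) = v"
    using vector_derivative_at[OF rescale_line_has_vector_derivative[of p 0 v]]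
    by (simp add: \<gamma>_def p rescale_velocity_def v)
  ultimately show "v \<in> tangent_vectors H p"
    unfolding tangent_vectors_def using \<open>\<gamma> 0 = p\<close> \<epsilon>(1) by blast
qed

end

section \<open>Lengths and distances\<close>

context factored_cubic
begin

text \<open>
  A function whose differential is bounded by the length of tangent vectors is 1-Lipschitz for the
  Riemannian distance.  All lower bounds for distances below are instances, for different functions
  \<open>F\<close>.  The velocity of an admissible path may be unbounded near finitely many parameters; if its
  length is infinite there is nothing to show, and otherwise the Henstock--Kurzweil and the Lebesgue
  integral of the derivative of \<open>F\<close> along the path coincide.
\<close>

lemma psr_dist_ge_variation:
  assumes H: "H \<subseteq> {x. cub x = 1}"
    and F: "\<And>x. x \<in> H \<Longrightarrow> (F has_derivative F' x) (at x)"
    and F': "continuous_on (H \<times> UNIV) (\<lambda>(x, v). F' x v)"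
    and bound: "\<And>x v. x \<in> H \<Longrightarrow> dcub x v = 0 \<Longrightarrow> \<bar>F' x v\<bar> \<le> sqrt (psr_metric cub x v v)"
  shows "ennreal \<bar>F p - F q\<bar> \<le> psr_dist cub H p q"
  unfolding psr_dist_def
proof (rule INF_greatest, clarify)
  fix \<gamma> assume valid: "valid_path \<gamma>" and image: "path_image \<gamma> \<subseteq> H"
    and p: "p = pathstart \<gamma>" and q: "q = pathfinish \<gamma>"
  obtain S where cont: "continuous_on {0..1} \<gamma>" and S: "finite S" "\<gamma> C1_differentiable_on {0..1} - S"
    using valid unfolding valid_path_def piecewise_C1_differentiable_on_def by blast
  then obtain D where D: "\<And>t. t \<in> {0..1} - S \<Longrightarrow> (\<gamma> has_vector_derivative D t) (at t)"
    "continuous_on ({0..1} - S) D"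
    unfolding C1_differentiable_on_def by blast
  have inH: "\<gamma> t \<in> H" if "t \<in> {0..1}" for t
    using image that by (auto simp: path_image_def)
  \<comment> \<open>The endpoints are removed together with the exceptional parameters because the derivative
    of \<open>cub \<circ> \<gamma>\<close> is only known to vanish in the interior.\<close>
  define T where "T = {0<..<1} - S"
  define g where "g = (\<lambda>t. F' (\<gamma> t) (D t))"
  define G where "G = (\<lambda>t. indicator T t *\<^sub>R g t)"
  have T: "T \<subseteq> {0..1}" "T \<subseteq> {0..1} - S"
    by (auto simp: T_def)
  have derivF: "((\<lambda>t. F (\<gamma> t)) has_vector_derivative g t) (at t)" if "t \<in> T" for t
    using has_derivative_compose[OF D(1)[unfolded has_vector_derivative_def] F[OF inH], of t]
      that T linear_scale[OF has_derivative_linear[OF F[OF inH]], of t]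
    by (auto simp: has_vector_derivative_def g_def)
  have contF: "continuous_on {0..1} (\<lambda>t. F (\<gamma> t))"
  proof (rule continuous_on_compose2[of H F])
    show "continuous_on H F"
      using F by (auto intro!: continuous_at_imp_continuous_on has_derivative_continuous)
  qed (use inH cont in auto)
  have "(g has_integral F (\<gamma> 1) - F (\<gamma> 0)) {0..1}"
    by (rule fundamental_theorem_of_calculus_interior_strong[OF S(1)])
       (use derivF contF in \<open>auto simp: T_def\<close>)
  then have "((\<lambda>t. if t \<in> {0..1} then g t else 0) has_integral F (\<gamma> 1) - F (\<gamma> 0)) UNIV"
    by (simp only: has_integral_restrict_UNIV)
  then have G_int: "(G has_integral F (\<gamma> 1) - F (\<gamma> 0)) UNIV"
    by (rule has_integral_spike_finite[of "{0, 1} \<union> S", rotated 2])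
       (use S(1) in \<open>auto simp: G_def T_def indicator_def\<close>)
  have "continuous_on T g"
  proof -
    have "continuous_on T (\<lambda>t. (\<gamma> t, D t))"
      using cont D(2) T by (intro continuous_on_Pair) (auto intro: continuous_on_subset)
    moreover have "(\<lambda>t. (\<gamma> t, D t)) ` T \<subseteq> H \<times> UNIV"
      using inH T(1) by auto
    ultimately show ?thesis
      unfolding g_def using continuous_on_compose2[OF F', of T "\<lambda>t. (\<gamma> t, D t)"] by simp
  qed
  moreover have "T \<in> sets borel"
    using borel_closed[OF finite_imp_closed[OF S(1)]] unfolding T_def by (intro sets.Diff) auto
  ultimately have G_meas: "G \<in> borel_measurable borel"
    unfolding G_def by (intro borel_measurable_continuous_on_indicator)
  let ?D = "\<lambda>t. vector_derivative \<gamma> (at t within {0..1})"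
  have speed: "ennreal (norm (G t)) \<le>
      ennreal (sqrt (psr_metric cub (\<gamma> t) (?D t) (?D t))) * indicator {0..1} t" for t
  proof (cases "t \<in> T")
    case True
    have deriv: "(\<gamma> has_vector_derivative D t) (at t)"
      using True T D by blast
    have "((\<lambda>t. cub (\<gamma> t)) has_vector_derivative dcub (\<gamma> t) (D t)) (at t)"
      using has_derivative_compose[OF deriv[unfolded has_vector_derivative_def] cub_has_derivative]
      by (simp add: has_vector_derivative_def linear_scale[OF dcub_linear])
    moreover have "((\<lambda>t. cub (\<gamma> t)) has_vector_derivative 0) (at t)"
    proof (rule has_vector_derivative_transform_within_open[of "\<lambda>_. 1" _ _ "{0<..<1}"])
      show "1 = cub (\<gamma> t)" if "t \<in> {0<..<1}" for t
        using inH[of t] H that by auto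
    qed (use True in \<open>auto simp: T_def\<close>)
    ultimately have "dcub (\<gamma> t) (D t) = 0"
      using vector_derivative_unique_at by blast
    moreover have "?D t = D t"
      using vector_derivative_at_within_ivl[OF deriv] True T(1) by auto
    ultimately show ?thesis
      using bound[OF inH, of t "D t"] True T(1) by (auto simp: G_def g_def intro!: ennreal_leI)
  qed (simp add: G_def)
  have "ennreal \<bar>F p - F q\<bar> \<le> (\<integral>\<^sup>+t. ennreal (norm (G t)) \<partial>lborel)"
  proof (cases "(\<integral>\<^sup>+t. ennreal (norm (G t)) \<partial>lborel) < \<infinity>")
    case True
    then have int: "integrable lborel G"
      using G_meas by (intro integrableI_bounded) auto
    have "integral\<^sup>L lborel G = F q - F p"
      using has_integral_unique[OF has_integral_integral_lborel[OF int] G_int]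
      by (simp add: p q pathstart_def pathfinish_def)
    then show ?thesis
      using integral_norm_bound_ennreal[OF int] by (simp add: abs_minus_commute)
  next
    case False
    then have "(\<integral>\<^sup>+t. ennreal (norm (G t)) \<partial>lborel) = top"
      by (simp add: less_top[symmetric])
    then show ?thesis by (simp only: top_greatest)
  qed
  also have "\<dots> \<le> psr_length cub \<gamma>"
    unfolding psr_length_def by (rule nn_integral_mono) (rule speed)
  finally show "ennreal \<bar>F (pathstart \<gamma>) - F (pathfinish \<gamma>)\<bar> \<le> psr_length cub \<gamma>"
    by (simp only: p q)
qed

text \<open>
  Distances are bounded from above by projecting segments radially; on a compact convex set the
  speed of the projection is controlled uniformly.
\<close>

lemma psr_dist_rescale_le:
  assumes W: "compact W" "convex W" "W \<subseteq> {x. cub x > 0}"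
  obtains K where "K \<ge> 0"
    "\<And>a b. a \<in> W \<Longrightarrow> b \<in> W \<Longrightarrow> rescale ` closed_segment a b \<subseteq> H \<Longrightarrow>
      psr_dist cub H (rescale a) (rescale b) \<le> ennreal (K * norm (b - a))"
proof -
  define \<Phi> where "\<Phi> = (\<lambda>c v. 2 * (dcub c v / (3 * cub c))\<^sup>2 - ddcub c v v / (3 * cub c))"
  have "continuous_on (W \<times> sphere 0 1) (\<lambda>z. \<Phi> (fst z) (snd z))"
    unfolding \<Phi>_def using W(3) by (intro continuous_intros) auto
  then have "compact ((\<lambda>z. \<Phi> (fst z) (snd z)) ` (W \<times> sphere 0 1))"
    using W(1) by (intro compact_continuous_image compact_Times) auto
  then obtain M0 where M0: "\<And>c v. c \<in> W \<Longrightarrow> norm v = 1 \<Longrightarrow> \<bar>\<Phi> c v\<bar> \<le> M0"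
    by (fastforce dest!: compact_imp_bounded simp: bounded_iff)
  define M where "M = \<bar>M0\<bar>"
  have M: "\<Phi> c v \<le> M * (norm v)^2" if "c \<in> W" for c v
  proof (cases "v = 0")
    case True
    then show ?thesis by (simp add: \<Phi>_def dcub_def ddcub_def l_simps B_simps)
  next
    case False
    define u where "u = v /\<^sub>R norm v"
    have v: "v = norm v *\<^sub>R u" and "norm u = 1"
      using False by (simp_all add: u_def)
    have "\<Phi> c v = (norm v)^2 * \<Phi> c u"
      by (subst (1) v) (simp add: \<Phi>_def dcub_def ddcub_def l_simps B_simps power2_eq_square field_simps)
    also have "\<dots> \<le> (norm v)^2 * M"
      using M0[OF that \<open>norm u = 1\<close>] by (intro mult_left_mono) (auto simp: M_def)
    finally show ?thesis by (simp add: mult.commute)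
  qed
  show ?thesis
  proof
    show "sqrt M \<ge> 0" by (simp add: M_def)
    fix a b assume ab: "a \<in> W" "b \<in> W" "rescale ` closed_segment a b \<subseteq> H"
    define v where "v = b - a"
    define \<gamma> where "\<gamma> = (\<lambda>t. rescale (a + t *\<^sub>R v))"
    have line: "(\<lambda>t. a + t *\<^sub>R v) ` {0..1} = closed_segment a b"
      unfolding closed_segment_image_interval by (simp add: v_def algebra_simps)
    have inW: "a + t *\<^sub>R v \<in> W" if "t \<in> {0..1}" for t
      using closed_segment_subset[OF ab(1,2) W(2)] line that by blast
    then have pos: "cub (a + t *\<^sub>R v) > 0" if "t \<in> {0..1}" for t
      using W(3) that by blast
    have "valid_path \<gamma>"
      unfolding valid_path_def \<gamma>_def
      by (intro C1_differentiable_imp_piecewise rescale_line_C1 pos)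
    moreover have "path_image \<gamma> \<subseteq> H"
      using ab(3) unfolding path_image_def \<gamma>_def line[symmetric] by auto
    moreover have "pathstart \<gamma> = rescale a" "pathfinish \<gamma> = rescale b"
      by (simp_all add: pathstart_def pathfinish_def \<gamma>_def v_def)
    ultimately have "psr_dist cub H (rescale a) (rescale b) \<le> psr_length cub \<gamma>"
      unfolding psr_dist_def by (intro INF_lower) auto
    also have "\<dots> \<le> (\<integral>\<^sup>+(t::real). ennreal (sqrt M * norm v) * indicator {0..1} t \<partial>lborel)"
      unfolding psr_length_def
    proof (rule nn_integral_mono)
      fix t :: real
      let ?D = "vector_derivative \<gamma> (at t within {0..1})"
      show "ennreal (sqrt (psr_metric cub (\<gamma> t) ?D ?D)) * indicator {0..1} t
          \<le> ennreal (sqrt M * norm v) * indicator {0..1} t"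
      proof (cases "t \<in> {0..1}")
        case True
        have "?D = rescale_velocity (a + t *\<^sub>R v) v"
          using vector_derivative_at_within_ivl[OF rescale_line_has_vector_derivative[OF pos[OF True]], of 0 1] True
          by (simp add: \<gamma>_def)
        then have "psr_metric cub (\<gamma> t) ?D ?D = \<Phi> (a + t *\<^sub>R v) v"
          using psr_metric_rescale_velocity[OF pos[OF True]] by (simp add: \<gamma>_def \<Phi>_def)
        moreover have "sqrt (\<Phi> (a + t *\<^sub>R v) v) \<le> sqrt M * norm v"
          using M[OF inW[OF True], of v] real_sqrt_le_mono by (fastforce simp: real_sqrt_mult)
        ultimately show ?thesis
          using True by (auto intro!: ennreal_leI)
      qed simp
    qed
    also have "\<dots> = ennreal (sqrt M * norm (b - a))"
      by (simp add: nn_integral_cmult_indicator v_def)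
    finally show "psr_dist cub H (rescale a) (rescale b) \<le> ennreal (sqrt M * norm (b - a))" .
  qed
qed

end

section \<open>Complete manifolds are closed subsets\<close>

text \<open>
  Squaring makes the positive part continuously differentiable; composed with the squared
  distance to a point it gives a bump function.
\<close>

lemma max_0_squared_has_derivative:
  "((\<lambda>y :: real. (max 0 y)\<^sup>2) has_real_derivative 2 * max 0 y) (at y)"
proof (cases y "0 :: real" rule: linorder_cases)
  case less
  show ?thesis
    by (rule has_field_derivative_transform_within_open[of "\<lambda>_. 0" _ _ "{..<0}"]) (use less in auto)
next
  case greater
  have "((\<lambda>y. y\<^sup>2) has_real_derivative 2 * max 0 y) (at y)"
    using greater by (auto intro!: derivative_eq_intros)
  then show ?thesis
    by (rule has_field_derivative_transform_within_open[of _ _ _ "{0<..}"]) (use greater in auto)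
next
  case equal
  have "((\<lambda>h :: real. (max 0 h)\<^sup>2 / h) \<longlongrightarrow> 0) (at 0)"
  proof (rule Lim_null_comparison[of _ "\<lambda>h. \<bar>h\<bar>"])
    show "\<forall>\<^sub>F h in at (0 :: real). norm ((max 0 h)\<^sup>2 / h) \<le> \<bar>h\<bar>"
      by (rule always_eventually) (auto simp: max_def power2_eq_square)
    show "((\<lambda>h :: real. \<bar>h\<bar>) \<longlongrightarrow> 0) (at 0)"
      by (auto intro!: tendsto_eq_intros)
  qed
  then show ?thesis
    using equal by (simp add: has_field_derivative_iff)
qed

context factored_cubic
begin

lemma psr_manifold_openin:
  "psr_manifold cub H \<Longrightarrow> openin (top_of_set {x. cub x = 1}) H"
  by (rule hypersurface_openin) (auto simp: psr_manifold_def)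

lemma psr_metric_pos:
  assumes "psr_manifold cub H" "x \<in> H" "dcub x v = 0" "v \<noteq> 0"
  shows "psr_metric cub x v v > 0"
  using assms tangent_vectors_eq[OF psr_manifold_openin] by (auto simp: psr_manifold_def)

text \<open>
  The unit tangent vectors at the points of a small closed ball form a compact set, on which the
  metric attains a positive minimum.
\<close>

lemma psr_metric_locally_bounds_norm:
  assumes psr: "psr_manifold cub H" and p: "p \<in> H"
  obtains \<epsilon> K where "\<epsilon> > 0" "K > 0"
    "\<And>x v. x \<in> H \<Longrightarrow> dist p x \<le> \<epsilon> \<Longrightarrow> dcub x v = 0 \<Longrightarrow> norm v \<le> K * sqrt (psr_metric cub x v v)"
proof -
  obtain e where e: "e > 0" "ball p e \<inter> {x. cub x = 1} \<subseteq> H"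
    using psr_manifold_openin[OF psr] p unfolding openin_contains_ball by blast
  define Z where "Z = (cball p (e / 2) \<times> sphere 0 1) \<inter>
    ({z. cub (fst z) = 1} \<inter> {z. dcub (fst z) (snd z) = 0})"
  have "compact Z"
    unfolding Z_def
    by (intro compact_Int_closed compact_Times compact_cball compact_sphere closed_Int
        closed_Collect_eq continuous_intros)
  have Z_pos: "psr_metric cub (fst z) (snd z) (snd z) > 0" if "z \<in> Z" for z
  proof (rule psr_metric_pos[OF psr])
    show "fst z \<in> H"
      using that e by (auto simp: Z_def subset_iff)
  qed (use that in \<open>auto simp: Z_def\<close>)
  obtain m where m: "m > 0" "\<And>z. z \<in> Z \<Longrightarrow> psr_metric cub (fst z) (snd z) (snd z) \<ge> m"
  proof (cases "Z = {}")
    case True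
    then show ?thesis using that[of 1] by simp
  next
    case False
    have "continuous_on Z (\<lambda>z. psr_metric cub (fst z) (snd z) (snd z))"
      unfolding psr_metric_cub by (intro continuous_intros) auto
    from continuous_attains_inf[OF \<open>compact Z\<close> False this] show ?thesis
      using that Z_pos by blast
  qed
  show ?thesis
  proof
    show "e / 2 > 0" "1 / sqrt m > 0"
      using e m by auto
    fix x v assume x: "x \<in> H" "dist p x \<le> e / 2" "dcub x v = 0"
    show "norm v \<le> 1 / sqrt m * sqrt (psr_metric cub x v v)"
    proof (cases "v = 0")
      case True
      then show ?thesis
        by (simp add: psr_metric_cub ddcub_def l_simps B_simps)
    next
      case False
      define u where "u = v /\<^sub>R norm v"
      have v: "v = norm v *\<^sub>R u" and u: "norm u = 1"
        using False by (simp_all add: u_def)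
      have "dcub x u = 0"
        using x(3) by (simp add: u_def linear_scale[OF dcub_linear])
      moreover have "cub x = 1"
        using x(1) psr by (auto simp: psr_manifold_def)
      ultimately have "psr_metric cub x u u \<ge> m"
        using m(2)[of "(x, u)"] x(2) u by (simp add: Z_def)
      then have "m * (norm v)\<^sup>2 \<le> (norm v)\<^sup>2 * psr_metric cub x u u"
        by (simp add: mult.commute[of m] mult_left_mono)
      also have "\<dots> = psr_metric cub x v v"
        by (subst (2 3) v) (simp add: psr_metric_cub ddcub_def l_simps B_simps power2_eq_square algebra_simps)
      finally have "sqrt m * norm v \<le> sqrt (psr_metric cub x v v)"
        using real_sqrt_le_mono by (fastforce simp: real_sqrt_mult)
      then show ?thesis
        using m(1) by (simp add: field_simps)
    qed
  qed
qed

text \<open>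
  Convergence in the Riemannian distance implies convergence in the ambient space.  A bump function
  around the limit, scaled so that it is 1-Lipschitz, detects points that stay away from it.
\<close>

lemma psr_dist_tendsto_imp_tendsto:
  assumes psr: "psr_manifold cub H" and l: "p \<in> H" and s: "\<And>k. s k \<in> H"
    and lim: "(\<lambda>k. psr_dist cub H (s k) p) \<longlonglongrightarrow> 0"
  shows "s \<longlonglongrightarrow> p"
proof -
  obtain \<epsilon> K where \<epsilon>: "\<epsilon> > 0" and K: "K > 0"
    "\<And>x v. x \<in> H \<Longrightarrow> dist p x \<le> \<epsilon> \<Longrightarrow> dcub x v = 0 \<Longrightarrow> norm v \<le> K * sqrt (psr_metric cub x v v)"
    using psr_metric_locally_bounds_norm[OF psr l] by blast
  define \<rho> where "\<rho> = (\<lambda>x. max 0 (\<epsilon>\<^sup>2 - (x - p) \<bullet> (x - p)))"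
  \<comment> \<open>The differential of the squared \<open>\<rho>\<close> at a point of the ball is at most
    \<open>4 * \<epsilon> ^ 3\<close> times the norm, and the norm is at most \<open>K\<close>
    times the length.\<close>
  define c where "c = 1 / (4 * \<epsilon>^3 * K)"
  have c: "c > 0" "c * (4 * \<epsilon>^3 * K) = 1"
    using \<epsilon> K by (simp_all add: c_def)
  define F where "F = (\<lambda>x. c * (\<rho> x)\<^sup>2)"
  define F' where "F' = (\<lambda>x v. - 4 * c * \<rho> x * ((x - p) \<bullet> v))"
  have deriv: "(F has_derivative F' x) (at x)" for x
  proof -
    have "((\<lambda>x. \<epsilon>\<^sup>2 - (x - p) \<bullet> (x - p)) has_derivative (\<lambda>v. - 2 * ((x - p) \<bullet> v))) (at x)"
      by (auto intro!: derivative_eq_intros simp: inner_commute)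
    from has_derivative_compose[OF this max_0_squared_has_derivative[unfolded has_field_derivative_def]]
    have "((\<lambda>x. c * (\<rho> x)\<^sup>2) has_derivative (\<lambda>v. c * (2 * \<rho> x * (- 2 * ((x - p) \<bullet> v))))) (at x)"
      unfolding \<rho>_def by (rule has_derivative_mult_right)
    then show ?thesis
      unfolding F_def F'_def by (simp add: algebra_simps)
  qed
  have bound: "\<bar>F' x v\<bar> \<le> sqrt (psr_metric cub x v v)" if x: "x \<in> H" "dcub x v = 0" for x v
  proof (cases "dist p x \<le> \<epsilon>")
    case True
    have "\<bar>(x - p) \<bullet> v\<bar> \<le> \<epsilon> * norm v"
      using Cauchy_Schwarz_ineq2[of "x - p" v] True
      by (intro order_trans[OF Cauchy_Schwarz_ineq2] mult_right_mono) (auto simp: dist_norm norm_minus_commute)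
    also have "\<dots> \<le> \<epsilon> * (K * sqrt (psr_metric cub x v v))"
      using K(2)[OF x(1) True x(2)] \<epsilon> by (intro mult_left_mono) auto
    finally have 1: "\<bar>(x - p) \<bullet> v\<bar> \<le> \<epsilon> * (K * sqrt (psr_metric cub x v v))" .
    have 2: "0 \<le> \<rho> x" "\<rho> x \<le> \<epsilon>\<^sup>2"
      by (simp_all add: \<rho>_def)
    have "\<bar>F' x v\<bar> = 4 * c * (\<rho> x * \<bar>(x - p) \<bullet> v\<bar>)"
      using c(1) 2(1) by (simp add: F'_def abs_mult)
    also have "\<dots> \<le> 4 * c * (\<epsilon>\<^sup>2 * (\<epsilon> * (K * sqrt (psr_metric cub x v v))))"
      using c(1) 1 2 by (intro mult_left_mono mult_mono) auto
    also have "\<dots> = (c * (4 * \<epsilon>^3 * K)) * sqrt (psr_metric cub x v v)"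
      by (simp add: power2_eq_square power3_eq_cube)
    finally show ?thesis
      unfolding c(2) by simp
  next
    case False
    then have "\<epsilon>\<^sup>2 < (norm (x - p))\<^sup>2"
      using \<epsilon> by (intro power_strict_mono) (auto simp: dist_norm norm_minus_commute)
    then have "\<rho> x = 0"
      by (simp add: \<rho>_def power2_norm_eq_inner)
    moreover have "psr_metric cub x v v \<ge> 0"
      using psr_metric_pos[OF psr x] by (cases "v = 0") (auto simp: psr_metric_cub ddcub_def l_simps B_simps)
    ultimately show ?thesis
      by (simp add: F'_def)
  qed
  have contF': "continuous_on (H \<times> UNIV) (\<lambda>(x, v). F' x v)"
    unfolding F'_def \<rho>_def case_prod_beta by (intro continuous_intros)
  have variation: "ennreal \<bar>F (s k) - F p\<bar> \<le> psr_dist cub H (s k) p" for k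
    by (rule psr_dist_ge_variation[OF _ deriv contF' bound]) (use psr in \<open>auto simp: psr_manifold_def\<close>)
  show ?thesis
  proof (rule metric_LIMSEQ_I)
    fix r :: real assume "r > 0"
    define r' where "r' = min r \<epsilon>"
    have r': "0 < r'" "r' \<le> r" "r' \<le> \<epsilon>"
      using \<open>r > 0\<close> \<epsilon> by (auto simp: r'_def)
    define \<eta> where "\<eta> = c * (\<epsilon>\<^sup>2)\<^sup>2 - c * (\<epsilon>\<^sup>2 - r'\<^sup>2)\<^sup>2"
    have r2: "0 < r'\<^sup>2" "r'\<^sup>2 \<le> \<epsilon>\<^sup>2"
      using r' by (auto intro: power_mono)
    then have "(\<epsilon>\<^sup>2 - r'\<^sup>2)\<^sup>2 < (\<epsilon>\<^sup>2)\<^sup>2"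
      by (intro power_strict_mono) auto
    then have "\<eta> > 0"
      using c(1) by (simp add: \<eta>_def)
    then have "\<forall>\<^sub>F k in sequentially. psr_dist cub H (s k) p < ennreal \<eta>"
      using lim by (intro order_tendstoD(2)) auto
    then obtain N where N: "\<And>k. k \<ge> N \<Longrightarrow> psr_dist cub H (s k) p < ennreal \<eta>"
      unfolding eventually_sequentially by blast
    have "dist (s k) p < r" if "k \<ge> N" for k
    proof (rule ccontr)
      assume "\<not> dist (s k) p < r"
      then have "r'\<^sup>2 \<le> (norm (s k - p))\<^sup>2"
        using r' by (intro power_mono) (auto simp: dist_norm)
      then have "\<rho> (s k) \<le> \<epsilon>\<^sup>2 - r'\<^sup>2" "0 \<le> \<rho> (s k)"
        using r2 by (auto simp: \<rho>_def power2_norm_eq_inner)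
      then have "c * (\<rho> (s k))\<^sup>2 \<le> c * (\<epsilon>\<^sup>2 - r'\<^sup>2)\<^sup>2"
        using c(1) by (intro mult_left_mono power_mono) auto
      moreover have "F p = c * (\<epsilon>\<^sup>2)\<^sup>2"
        by (simp add: F_def \<rho>_def)
      ultimately have "\<eta> \<le> F p - F (s k)"
        unfolding \<eta>_def F_def by linarith
      then have "\<eta> \<le> \<bar>F (s k) - F p\<bar>"
        by linarith
      then have "ennreal \<eta> \<le> psr_dist cub H (s k) p"
        using variation[of k] ennreal_leI order_trans by blast
      with N[OF that] show False by simp
    qed
    then show "\<exists>N. \<forall>k\<ge>N. dist (s k) p < r" by blast
  qed
qed

text \<open>
  Near a boundary point \<open>p\<close> outside \<open>H\<close>, start at a point of \<open>H\<close> and follow the projection of the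
  segment towards \<open>p\<close>.  The part before the first exit from \<open>H\<close> has finite length, so it gives a
  Cauchy sequence.  Its limit in \<open>H\<close> would have to be the exit point, which is not in \<open>H\<close>.
\<close>

lemma complete_psr_manifold_closed:
  assumes complete: "complete_psr_manifold cub H"
  shows "closed H"
proof (rule ccontr)
  assume "\<not> closed H"
  have psr: "psr_manifold cub H"
    using complete by (simp add: complete_psr_manifold_def)
  then have H1: "H \<subseteq> {x. cub x = 1}"
    by (simp add: psr_manifold_def)
  obtain p where p: "p \<in> closure H" "p \<notin> H"
    using \<open>\<not> closed H\<close> closure_subset_eq by blast
  have "closed {x. cub x = 1}"
    by (intro closed_Collect_eq continuous_intros)
  then have cub_p: "cub p = 1"
    using closure_minimal[OF H1] p(1) by blast
  have "open {x. cub x > 0}"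
    by (intro open_Collect_less continuous_intros)
  then have "\<exists>r>0. cball p r \<subseteq> {x. cub x > 0}"
    by (rule open_contains_cball[THEN iffD1, rule_format]) (simp add: cub_p)
  then obtain r where r: "r > 0" "cball p r \<subseteq> {x. cub x > 0}"
    by blast
  obtain q where q: "q \<in> H" "dist q p < r"
    using p(1) r(1) closure_approachable by blast
  define c where "c = (\<lambda>t. q + t *\<^sub>R (p - q))"
  have inW: "c t \<in> cball p r" if "t \<in> {0..1}" for t
  proof -
    have "p - c t = (1 - t) *\<^sub>R (p - q)"
      by (simp add: c_def algebra_simps)
    then have "dist p (c t) = (1 - t) * dist q p"
      using that by (simp add: dist_norm norm_minus_commute)
    also have "\<dots> \<le> 1 * dist q p"
      using that by (intro mult_right_mono) auto
    finally show ?thesis using q(2) by simp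
  qed
  then have pos: "cub (c t) > 0" if "t \<in> {0..1}" for t
    using r(2) that by blast
  have contc: "continuous_on {0..1} (\<lambda>t. rescale (c t))"
    by (rule continuous_on_rescale[OF _ pos]) (auto simp: c_def intro!: continuous_intros)
  define A where "A = {t \<in> {0..1}. rescale (c t) \<notin> H}"
  have "closedin (top_of_set {x. cub x = 1}) ({x. cub x = 1} - H)"
    using closedin_diff[of "top_of_set {x. cub x = 1}" "{x. cub x = 1}" H] psr_manifold_openin[OF psr]
    by simp
  then have "closedin (top_of_set {0..1}) ({0..1} \<inter> (\<lambda>t. rescale (c t)) -` ({x. cub x = 1} - H))"
    by (intro continuous_closedin_preimage_gen[OF contc, of "{x. cub x = 1}"]) (auto simp: cub_rescale[OF pos])
  moreover have "{0..1} \<inter> (\<lambda>t. rescale (c t)) -` ({x. cub x = 1} - H) = A"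
    by (auto simp: A_def cub_rescale[OF pos])
  ultimately have "compact A"
    using closedin_compact[of "{0..1}" A] by simp
  moreover have "1 \<in> A"
    using p(2) cub_p by (simp add: A_def c_def rescale_id)
  ultimately obtain t0 where t0: "t0 \<in> A" "\<And>t. t \<in> A \<Longrightarrow> t0 \<le> t"
    using compact_attains_inf[of A] by blast
  have "rescale (c 0) = q"
    using q(1) H1 by (auto simp: c_def rescale_id)
  then have "t0 \<noteq> 0"
    using t0(1) q(1) by (auto simp: A_def)
  then have t0_pos: "0 < t0" "t0 \<le> 1"
    using t0(1) by (auto simp: A_def)
  have below: "rescale (c t) \<in> H" if "0 \<le> t" "t < t0" for t
    using t0(2)[of t] that t0_pos by (auto simp: A_def)
  \<comment> \<open>Projected subsegments before the exit time \<open>t0\<close> stay in \<open>H\<close>, so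
    parameters control distances.\<close>
  obtain K where K: "K \<ge> 0" "\<And>a b. a \<in> cball p r \<Longrightarrow> b \<in> cball p r \<Longrightarrow>
      rescale ` closed_segment a b \<subseteq> H \<Longrightarrow>
      psr_dist cub H (rescale a) (rescale b) \<le> ennreal (K * norm (b - a))"
    using psr_dist_rescale_le[OF compact_cball convex_cball r(2)] by blast
  have short: "psr_dist cub H (rescale (c a)) (rescale (c b)) \<le> ennreal (K * norm (p - q) * \<bar>b - a\<bar>)"
    if ab: "a \<in> {0..<t0}" "b \<in> {0..<t0}" for a b
  proof -
    have "rescale x \<in> H" if x: "x \<in> closed_segment (c a) (c b)" for x
    proof -
      obtain u where u: "0 \<le> u" "u \<le> 1" "x = (1 - u) *\<^sub>R c a + u *\<^sub>R c b"
        using x by (auto simp: in_segment)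
      have "x = c ((1 - u) * a + u * b)"
        unfolding u(3) c_def by (simp add: algebra_simps)
      moreover have "(1 - u) * a + u * b \<in> {0..<t0}"
        using convexD[of "{0..<t0}" a b "1 - u" u] ab u by simp
      ultimately show ?thesis
        using below by simp
    qed
    then have "psr_dist cub H (rescale (c a)) (rescale (c b)) \<le> ennreal (K * norm (c b - c a))"
      using ab t0_pos by (intro K(2) inW) auto
    also have "c b - c a = (b - a) *\<^sub>R (p - q)"
      by (simp add: c_def algebra_simps)
    finally show ?thesis by (simp add: mult_ac)
  qed
  define t where "t = (\<lambda>k::nat. t0 * (1 - inverse (real (Suc k))))"
  have "t \<longlonglongrightarrow> t0 * (1 - 0)"
    unfolding t_def by (intro tendsto_intros LIMSEQ_inverse_real_of_nat)
  then have t_lim: "t \<longlonglongrightarrow> t0"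
    by simp
  have t_range: "t k \<in> {0..<t0}" for k
    using t0_pos by (auto simp: t_def field_simps)
  define s where "s = (\<lambda>k. rescale (c (t k)))"
  have sH: "s k \<in> H" for k
    using below t_range[of k] by (simp add: s_def)
  have "\<exists>N. \<forall>j\<ge>N. \<forall>k\<ge>N. psr_dist cub H (s j) (s k) < ennreal \<epsilon>" if "\<epsilon> > 0" for \<epsilon>
  proof -
    define L where "L = K * norm (p - q) + 1"
    have "L > 0"
      using K(1) by (simp add: L_def add_nonneg_pos)
    then have "\<epsilon> / L > 0"
      using that by simp
    then obtain N where N: "\<And>j k. j \<ge> N \<Longrightarrow> k \<ge> N \<Longrightarrow> dist (t j) (t k) < \<epsilon> / L"
      using LIMSEQ_imp_Cauchy[OF t_lim] unfolding Cauchy_def by blast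
    have "psr_dist cub H (s j) (s k) < ennreal \<epsilon>" if "j \<ge> N" "k \<ge> N" for j k
    proof -
      have "K * norm (p - q) * \<bar>t k - t j\<bar> \<le> L * \<bar>t k - t j\<bar>"
        by (intro mult_right_mono) (auto simp: L_def)
      also have "L * \<bar>t k - t j\<bar> < \<epsilon>"
        using N[OF that] \<open>L > 0\<close> by (simp add: dist_real_def abs_minus_commute field_simps)
      finally have "ennreal (K * norm (p - q) * \<bar>t k - t j\<bar>) < ennreal \<epsilon>"
        using \<open>\<epsilon> > 0\<close> by (intro ennreal_lessI)
      then show ?thesis
        unfolding s_def using short[OF t_range t_range, of j k] by (rule le_less_trans[rotated])
    qed
    then show ?thesis by blast
  qed
  then obtain m where m: "m \<in> H" "(\<lambda>k. psr_dist cub H (s k) m) \<longlonglongrightarrow> 0"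
    using complete sH unfolding complete_psr_manifold_def by blast
  have "s \<longlonglongrightarrow> m"
    by (rule psr_dist_tendsto_imp_tendsto[OF psr m(1) sH m(2)])
  moreover have "s \<longlonglongrightarrow> rescale (c t0)"
  proof -
    have "t k \<in> {0..1}" for k
      using t_range[of k] t0_pos by auto
    then show ?thesis
      unfolding s_def using t0_pos by (intro continuous_on_tendsto_compose[OF contc t_lim]) auto
  qed
  ultimately have "rescale (c t0) \<in> H"
    using m(1) LIMSEQ_unique by blast
  then show False
    using t0(1) by (simp add: A_def)
qed

end

section \<open>A completeness criterion\<close>

context factored_cubic
begin

text \<open>
  Write \<open>a\<close>, \<open>b\<close>, \<open>c\<close>, \<open>L\<close> for the normalised values of \<open>f\<close>, \<open>B x\<close>, \<open>B v v\<close> and \<open>l\<close>.  Tangency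
  means \<open>L = - 2 * b\<close>, and three times the metric becomes \<open>8 * b\<^sup>2 - 2 * c\<close>.  The vector
  \<open>v - a *\<^sub>R x\<close> lies in the kernel of \<open>f\<close>, where the quadratic form is nonpositive; this bounds \<open>c\<close>
  from above by \<open>2 * a * b - a\<^sup>2\<close>, and both claims reduce to sums of squares.
\<close>

lemma log_derivative_bounds:
  assumes cub: "cub x = 1" and tangent: "dcub x v = 0" and q: "B x x > 0"
    and f: "linear f" "f x \<noteq> 0" and neg: "\<And>w. f w = 0 \<Longrightarrow> B w w \<le> 0"
  shows "(f v / f x)\<^sup>2 \<le> 3 * psr_metric cub x v v"
    and "(l v / l x)\<^sup>2 \<le> 3 * psr_metric cub x v v"
proof -
  define a b c L where "a = f v / f x" "b = B x v / B x x" "c = B v v / B x x" "L = l v / l x"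
  note defs = this
  have lx: "l x \<noteq> 0" "l x * B x x = 1"
    using cub by (auto simp: cub_def)
  have v: "l v = L * l x" "B x v = b * B x x" "B v v = c * B x x"
    using lx q by (simp_all add: defs)
  have "dcub x v = (L + 2 * b) * (l x * B x x)"
    by (simp add: dcub_def v algebra_simps)
  then have L: "L = - 2 * b"
    using tangent lx(2) by simp
  have "ddcub x v v = (4 * L * b + 2 * c) * (l x * B x x)"
    by (simp add: ddcub_def v algebra_simps)
  then have metric: "3 * psr_metric cub x v v = 8 * b\<^sup>2 - 2 * c"
    using lx(2) L by (simp add: psr_metric_cub power2_eq_square)
  have "f (v - a *\<^sub>R x) = 0"
    using f by (simp add: linear_diff linear_scale defs)
  then have "B (v - a *\<^sub>R x) (v - a *\<^sub>R x) \<le> 0"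
    by (rule neg)
  also have "B (v - a *\<^sub>R x) (v - a *\<^sub>R x) = (c - 2 * a * b + a\<^sup>2) * B x x"
    using B_sym[of v x] by (simp add: B_simps v power2_eq_square algebra_simps)
  finally have c: "c \<le> 2 * a * b - a\<^sup>2"
    using q by (simp add: mult_le_0_iff)
  have "(2 * b - a)\<^sup>2 = 4 * b\<^sup>2 - 4 * a * b + a\<^sup>2"
    by (simp add: power2_eq_square algebra_simps)
  then have "4 * b\<^sup>2 - 4 * a * b + a\<^sup>2 \<ge> 0"
    by (metis zero_le_power2)
  moreover have "L\<^sup>2 = 4 * b\<^sup>2"
    by (simp add: L power2_eq_square)
  ultimately have "a\<^sup>2 \<le> 8 * b\<^sup>2 - 2 * c" "L\<^sup>2 \<le> 8 * b\<^sup>2 - 2 * c"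
    using c zero_le_power2[of a] zero_le_power2[of b] by linarith+
  then show "(f v / f x)\<^sup>2 \<le> 3 * psr_metric cub x v v" "(l v / l x)\<^sup>2 \<le> 3 * psr_metric cub x v v"
    by (simp_all only: metric defs)
qed

text \<open>
  The bound on the linear forms \<open>f\<close> makes each \<open>ln f\<close> Lipschitz.  Along a Cauchy sequence every \<open>f\<close>
  therefore tends to a positive limit, and since the forms separate points the sequence converges to
  a point where all of them are positive.  Near this point radially projected segments show that
  convergence also holds in the Riemannian distance.
\<close>

lemma complete_psr_manifoldI:
  fixes \<F> :: "(real^'m \<Rightarrow> real) set"
  defines "H \<equiv> {x. cub x = 1 \<and> (\<forall>f\<in>\<F>. f x > 0)}"
  assumes fin: "finite \<F>" and lin: "\<And>f. f \<in> \<F> \<Longrightarrow> linear f"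
    and separating: "\<And>v. (\<And>f. f \<in> \<F> \<Longrightarrow> f v = 0) \<Longrightarrow> v = 0"
    and bound: "\<And>f x v. f \<in> \<F> \<Longrightarrow> x \<in> H \<Longrightarrow> dcub x v = 0 \<Longrightarrow> (f v / f x)\<^sup>2 \<le> 3 * psr_metric cub x v v"
    and nonempty: "H \<noteq> {}"
  shows "complete_psr_manifold cub H"
proof -
  define C where "C = {x. \<forall>f\<in>\<F>. f x > 0}"
  have C_eq: "C = (\<Inter>f\<in>\<F>. {x. f x > 0})"
    by (auto simp: C_def)
  have cont: "continuous_on A f" if "f \<in> \<F>" for A f
    using lin[OF that] by (simp add: linear_continuous_on linear_conv_bounded_linear)
  have "open C"
    unfolding C_eq using fin cont by (intro open_INT ballI open_Collect_less continuous_intros) auto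
  have H_subset: "H \<subseteq> {x. cub x = 1}"
    by (auto simp: H_def)
  have psr: "psr_manifold cub H"
    unfolding psr_manifold_def
  proof (intro conjI homogeneous_poly_cub H_subset ballI impI)
    show "hypersurface H"
      unfolding hypersurface_def
    proof (intro conjI nonempty ballI)
      fix p assume "p \<in> H"
      define \<phi> where "\<phi> = (\<lambda>x. cub x - 1)"
      have "(\<phi> has_derivative dcub x) (at x)" for x
        using has_derivative_diff[OF cub_has_derivative has_derivative_const] by (simp add: \<phi>_def)
      then have d: "frechet_derivative \<phi> (at x) = dcub x" for x
        using frechet_derivative_at by metis
      have "dcub x \<noteq> (\<lambda>v. 0)" if "x \<in> H" for x
        using that dcub_self[of x] by (auto simp: H_def dest!: fun_cong[of _ _ x])
      then have "\<forall>x\<in>H \<inter> C. frechet_derivative \<phi> (at x) \<noteq> (\<lambda>v. 0)"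
        by (simp add: d)
      moreover have "smooth_fun_on \<phi> C"
        unfolding \<phi>_def
        by (intro real_polynomial_function_smooth real_polynomial_function_diff
            real_polynomial_function_cub real_polynomial_function.intros(2))
      moreover have "H \<inter> C = {x \<in> C. \<phi> x = 0}" "p \<in> C"
        using \<open>p \<in> H\<close> by (auto simp: H_def C_def \<phi>_def)
      ultimately show "\<exists>U (\<phi> :: real^'m \<Rightarrow> real). open U \<and> p \<in> U \<and> smooth_fun_on \<phi> U \<and>
          H \<inter> U = {x \<in> U. \<phi> x = 0} \<and> (\<forall>x\<in>H \<inter> U. frechet_derivative \<phi> (at x) \<noteq> (\<lambda>v. 0))"
        using \<open>open C\<close> by blast
    qed
    fix p v assume p: "p \<in> H" and "v \<in> tangent_vectors H p" and v: "v \<noteq> 0"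
    then have t: "dcub p v = 0"
      using tangent_vectors_imp_kernel[OF H_subset] by blast
    show "psr_metric cub p v v > 0"
    proof (rule ccontr)
      assume "\<not> psr_metric cub p v v > 0"
      have "f v = 0" if "f \<in> \<F>" for f
      proof -
        have "f v / f p = 0"
          using bound[OF that p t] \<open>\<not> psr_metric cub p v v > 0\<close> zero_le_power2[of "f v / f p"]
          by (smt (verit) power2_eq_iff zero_power2)
        moreover have "f p > 0"
          using p that by (auto simp: H_def)
        ultimately show ?thesis by simp
      qed
      then show False
        using separating v by blast
    qed
  qed
  have variation: "ennreal (\<bar>ln (f x) - ln (f y)\<bar> / sqrt 3) \<le> psr_dist cub H x y"
    if f: "f \<in> \<F>" for f x y
  proof -
    \<comment> \<open>The derivative of \<open>ln f / sqrt 3\<close>.\<close>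
    define F' where "F' = (\<lambda>x v. f v / f x / sqrt 3)"
    have pos: "f x > 0" if "x \<in> H" for x
      using that f by (auto simp: H_def)
    have "((\<lambda>x. ln (f x) / sqrt 3) has_derivative F' x) (at x)" if "x \<in> H" for x
    proof -
      have "(f has_derivative f) (at x)"
        using lin[OF f] by (simp add: linear_imp_has_derivative)
      from has_derivative_mult_left[OF has_derivative_ln[OF pos[OF that] this]] show ?thesis
        unfolding F'_def divide_inverse .
    qed
    moreover have "continuous_on (H \<times> UNIV) (\<lambda>(x, v). F' x v)"
    proof -
      have "continuous_on (H \<times> UNIV) (\<lambda>z. f (fst z))" "continuous_on (H \<times> UNIV) (\<lambda>z. f (snd z))"
        by (auto intro!: continuous_on_compose2[OF cont[OF f, of UNIV]] continuous_intros)
      then show ?thesis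
        unfolding F'_def case_prod_beta using pos
        by (intro continuous_intros) (auto simp: less_imp_neq dest: pos)
    qed
    moreover have "\<bar>F' x v\<bar> \<le> sqrt (psr_metric cub x v v)" if "x \<in> H" "dcub x v = 0" for x v
    proof -
      have "(F' x v)\<^sup>2 = (f v / f x)\<^sup>2 / 3"
        by (simp add: F'_def power_divide power_mult_distrib)
      then have "(F' x v)\<^sup>2 \<le> psr_metric cub x v v"
        using bound[OF f that] by simp
      then show ?thesis
        using real_le_rsqrt real_sqrt_abs real_sqrt_le_mono by metis
    qed
    ultimately have "ennreal \<bar>ln (f x) / sqrt 3 - ln (f y) / sqrt 3\<bar> \<le> psr_dist cub H x y"
      by (intro psr_dist_ge_variation[OF H_subset])
    moreover have "\<bar>ln (f x) / sqrt 3 - ln (f y) / sqrt 3\<bar> = \<bar>ln (f x) - ln (f y)\<bar> / sqrt 3"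
      by (simp add: diff_divide_distrib[symmetric])
    ultimately show ?thesis by simp
  qed
  have "\<exists>p\<in>H. (\<lambda>k. psr_dist cub H (s k) p) \<longlonglongrightarrow> 0"
    if sH: "\<And>k. s k \<in> H"
      and cauchy: "\<And>\<epsilon>. \<epsilon> > 0 \<Longrightarrow> \<exists>N. \<forall>j\<ge>N. \<forall>k\<ge>N. psr_dist cub H (s j) (s k) < ennreal \<epsilon>" for s
  proof -
    have "\<exists>L. (\<lambda>k. f (s k)) \<longlonglongrightarrow> exp L" if f: "f \<in> \<F>" for f
    proof -
      have "Cauchy (\<lambda>k. ln (f (s k)))"
      proof (rule metric_CauchyI)
        fix \<epsilon> :: real assume "\<epsilon> > 0"
        then obtain N where N: "\<forall>j\<ge>N. \<forall>k\<ge>N. psr_dist cub H (s j) (s k) < ennreal (\<epsilon> / sqrt 3)"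
          using cauchy[of "\<epsilon> / sqrt 3"] by auto
        have "dist (ln (f (s j))) (ln (f (s k))) < \<epsilon>" if "j \<ge> N" "k \<ge> N" for j k
        proof -
          have "ennreal (\<bar>ln (f (s j)) - ln (f (s k))\<bar> / sqrt 3) < ennreal (\<epsilon> / sqrt 3)"
            using variation[OF f, of "s j" "s k"] N that by (meson le_less_trans)
          then have "\<bar>ln (f (s j)) - ln (f (s k))\<bar> / sqrt 3 < \<epsilon> / sqrt 3"
            using \<open>\<epsilon> > 0\<close> by (simp add: ennreal_less_iff)
          then show ?thesis
            by (simp add: dist_real_def divide_less_cancel)
        qed
        then show "\<exists>M. \<forall>m\<ge>M. \<forall>n\<ge>M. dist (ln (f (s m))) (ln (f (s n))) < \<epsilon>" by blast
      qed
      then obtain L where "(\<lambda>k. ln (f (s k))) \<longlonglongrightarrow> L"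
        using Cauchy_convergent_iff convergent_def by blast
      then have "(\<lambda>k. exp (ln (f (s k)))) \<longlonglongrightarrow> exp L"
        by (rule tendsto_exp)
      moreover have "f (s k) > 0" for k
        using sH[of k] f by (auto simp: H_def)
      ultimately show ?thesis by auto
    qed
    then obtain L where L: "\<And>f. f \<in> \<F> \<Longrightarrow> (\<lambda>k. f (s k)) \<longlonglongrightarrow> exp (L f)"
      by metis
    \<comment> \<open>As the forms separate points, \<open>N\<close> is a norm; on the unit sphere it has a
      positive minimum, which turns convergence of the forms into convergence of the sequence.\<close>
    define N where "N = (\<lambda>x. \<Sum>f\<in>\<F>. \<bar>f x\<bar>)"
    have N_pos: "N x > 0" if "norm x = 1" for x
    proof -
      have "x \<noteq> 0"
        using that by auto
      then have "\<exists>f\<in>\<F>. f x \<noteq> 0"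
        using separating by blast
      then have "N x \<noteq> 0"
        using fin by (simp add: N_def sum_nonneg_eq_0_iff)
      moreover have "N x \<ge> 0"
        by (simp add: N_def sum_nonneg)
      ultimately show ?thesis by simp
    qed
    have "continuous_on (sphere 0 1) N"
      unfolding N_def using cont by (intro continuous_intros) auto
    moreover have "sphere (0 :: real^'m) 1 \<noteq> {}"
      by simp
    ultimately obtain u where u: "norm u = 1" "\<And>x. norm x = 1 \<Longrightarrow> N u \<le> N x"
      using continuous_attains_inf[OF compact_sphere, of 0 1 N] by auto
    have N_norm: "N u * norm x \<le> N x" for x
    proof (cases "x = 0")
      case False
      have "N (x /\<^sub>R norm x) = N x / norm x"
        unfolding N_def sum_divide_distrib
        by (intro sum.cong) (simp_all add: lin linear_scale abs_mult divide_inverse)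
      moreover have "N u \<le> N (x /\<^sub>R norm x)"
        using False by (intro u(2)) simp
      ultimately have "N u \<le> N x / norm x"
        by simp
      then show ?thesis
        using False by (simp add: pos_le_divide_eq)
    qed (simp add: N_def sum_nonneg)
    have "Cauchy s"
    proof (rule metric_CauchyI)
      fix \<epsilon> :: real assume "\<epsilon> > 0"
      define \<epsilon>' where "\<epsilon>' = N u * \<epsilon> / (real (card \<F>) + 1)"
      have \<epsilon>': "\<epsilon>' > 0" "real (card \<F>) * \<epsilon>' < N u * \<epsilon>"
        using \<open>\<epsilon> > 0\<close> N_pos[OF u(1)] by (auto simp: \<epsilon>'_def field_simps)
      have "\<exists>M. \<forall>j\<ge>M. \<forall>k\<ge>M. \<bar>f (s j) - f (s k)\<bar> < \<epsilon>'" if "f \<in> \<F>" for f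
        using LIMSEQ_imp_Cauchy[OF L[OF that]] \<epsilon>'(1) unfolding Cauchy_def dist_real_def by blast
      then obtain M where M: "\<And>f j k. f \<in> \<F> \<Longrightarrow> j \<ge> M f \<Longrightarrow> k \<ge> M f \<Longrightarrow> \<bar>f (s j) - f (s k)\<bar> < \<epsilon>'"
        by metis
      define M' where "M' = Max (insert 0 (M ` \<F>))"
      have M': "M f \<le> M'" if "f \<in> \<F>" for f
        using that fin by (simp add: M'_def)
      have "dist (s j) (s k) < \<epsilon>" if "j \<ge> M'" "k \<ge> M'" for j k
      proof -
        have "N u * norm (s j - s k) \<le> N (s j - s k)"
          by (rule N_norm)
        also have "\<dots> = (\<Sum>f\<in>\<F>. \<bar>f (s j) - f (s k)\<bar>)"
          using lin by (simp add: N_def linear_diff)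
        also have "\<dots> \<le> (\<Sum>f\<in>\<F>. \<epsilon>')"
          using M M' that by (intro sum_mono less_imp_le) (meson order_trans)
        also have "\<dots> < N u * \<epsilon>"
          using \<epsilon>'(2) by simp
        finally show ?thesis
          using N_pos[OF u(1)] by (simp add: dist_norm)
      qed
      then show "\<exists>M. \<forall>m\<ge>M. \<forall>n\<ge>M. dist (s m) (s n) < \<epsilon>" by blast
    qed
    then obtain p where p: "s \<longlonglongrightarrow> p"
      using Cauchy_convergent_iff convergent_def by blast
    have lim: "(\<lambda>k. f (s k)) \<longlonglongrightarrow> f p" if "isCont f p" for f :: "real^'m \<Rightarrow> real"
      using isCont_tendsto_compose[OF that p] .
    have "f p > 0" if "f \<in> \<F>" for f
      using LIMSEQ_unique[OF L[OF that] lim] cont[OF that, of UNIV]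
      by (metis continuous_on_eq_continuous_at exp_gt_zero open_UNIV UNIV_I)
    moreover have "cub p = 1"
      using lim[OF isCont_cub] sH by (simp add: H_def LIMSEQ_const_iff)
    ultimately have pH: "p \<in> H" and pC: "p \<in> C"
      by (auto simp: H_def C_def)
    have "open (C \<inter> {x. cub x > 0})"
      using \<open>open C\<close> by (intro open_Int open_Collect_less continuous_intros)
    then have "\<exists>r>0. cball p r \<subseteq> C \<inter> {x. cub x > 0}"
      by (rule open_contains_cball[THEN iffD1, rule_format]) (simp add: pC \<open>cub p = 1\<close>)
    then obtain r where r: "r > 0" "cball p r \<subseteq> C" "cball p r \<subseteq> {x. cub x > 0}"
      by blast
    have into_H: "rescale x \<in> H" if "x \<in> cball p r" for x
    proof -
      have "cub x > 0" "x \<in> C"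
        using r that by blast+
      then show ?thesis
        using cub_rescale[of x] lin by (auto simp: H_def C_def rescale_def linear_scale)
    qed
    obtain K where K: "K \<ge> 0" "\<And>a b. a \<in> cball p r \<Longrightarrow> b \<in> cball p r \<Longrightarrow>
        rescale ` closed_segment a b \<subseteq> H \<Longrightarrow>
        psr_dist cub H (rescale a) (rescale b) \<le> ennreal (K * norm (b - a))"
      using psr_dist_rescale_le[OF compact_cball convex_cball r(3)] by blast
    have "\<forall>\<^sub>F k in sequentially. dist (s k) p < r"
      using tendstoD[OF p r(1)] .
    then have le: "\<forall>\<^sub>F k in sequentially. psr_dist cub H (s k) p \<le> ennreal (K * norm (p - s k))"
    proof eventually_elim
      case (elim k)
      then have k: "s k \<in> cball p r" "p \<in> cball p r"
        using r(1) by (auto simp: dist_commute)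
      have "rescale (s k) = s k" "rescale p = p"
        using sH[of k] pH by (auto simp: H_def rescale_id)
      moreover have "rescale ` closed_segment (s k) p \<subseteq> H"
        using closed_segment_subset[OF k convex_cball] into_H by blast
      ultimately show ?case
        using K(2)[OF k] by simp
    qed
    have "(\<lambda>k. K * norm (p - s k)) \<longlonglongrightarrow> K * norm (p - p)"
      by (intro tendsto_intros p)
    then have "(\<lambda>k. ennreal (K * norm (p - s k))) \<longlonglongrightarrow> 0"
      using tendsto_ennrealI by fastforce
    then have "(\<lambda>k. psr_dist cub H (s k) p) \<longlonglongrightarrow> 0"
      by (rule tendsto_sandwich[OF always_eventually le tendsto_const, rotated]) simp
    with pH show ?thesis by blast
  qed
  with psr show ?thesis
    unfolding complete_psr_manifold_def by blast
qed

end

section \<open>The four models\<close>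

definition lorentz_form :: "'m \<Rightarrow> 'm set \<Rightarrow> real^'m::finite \<Rightarrow> real^'m \<Rightarrow> real" where
  "lorentz_form \<tau> J x y = x $ \<tau> * y $ \<tau> - (\<Sum>j\<in>J. x $ j * y $ j)"

text \<open>
  The quadratic form has a single positive direction \<open>\<tau>\<close> and negative directions \<open>J\<close>.  It may be
  degenerate, as in model a, provided that \<open>l\<close> takes care of the remaining directions.
\<close>

locale lorentz_cubic =
  fixes l :: "real^'m::finite \<Rightarrow> real" and \<tau> :: 'm and J :: "'m set"
  assumes linear_factor: "linear l" and time_notin: "\<tau> \<notin> J"
    and separating: "\<And>v. l v = 0 \<Longrightarrow> v $ \<tau> = 0 \<Longrightarrow> (\<And>j. j \<in> J \<Longrightarrow> v $ j = 0) \<Longrightarrow> v = 0"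

sublocale lorentz_cubic \<subseteq> factored_cubic l "lorentz_form \<tau> J"
proof (rule factored_cubic.intro)
  show "bilinear (lorentz_form \<tau> J)"
    by (simp add: bilinear_def linear_iff lorentz_form_def sum.distrib sum_distrib_left algebra_simps)
  show "lorentz_form \<tau> J x y = lorentz_form \<tau> J y x" for x y
    by (simp add: lorentz_form_def mult.commute)
qed (rule linear_factor)

context lorentz_cubic
begin

text \<open>
  On the part of the level set where \<open>l\<close> is positive the quadratic form is positive too, so the time
  coordinate does not vanish; its sign distinguishes the two halves of the light cone.
\<close>

definition chamber :: "real \<Rightarrow> (real^'m) set" where
  "chamber \<sigma> = {x. cub x = 1 \<and> l x > 0 \<and> \<sigma> * x $ \<tau> > 0}"

lemma lorentz_form_pos_imp_timelike:
  assumes "lorentz_form \<tau> J x x > 0"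
  shows "x $ \<tau> \<noteq> 0" and "j \<in> J \<Longrightarrow> \<bar>x $ j\<bar> < \<bar>x $ \<tau>\<bar>"
proof -
  have sum: "(\<Sum>j\<in>J. (x $ j)\<^sup>2) < (x $ \<tau>)\<^sup>2"
    using assms by (simp add: lorentz_form_def power2_eq_square)
  moreover have "0 \<le> (\<Sum>j\<in>J. (x $ j)\<^sup>2)"
    by (simp add: sum_nonneg)
  ultimately show "x $ \<tau> \<noteq> 0" by auto
  assume "j \<in> J"
  then have "(x $ j)\<^sup>2 \<le> (\<Sum>j\<in>J. (x $ j)\<^sup>2)"
    by (intro member_le_sum) auto
  with sum show "\<bar>x $ j\<bar> < \<bar>x $ \<tau>\<bar>"
    by (intro power2_less_imp_less[of "\<bar>x $ j\<bar>"]) auto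
qed

lemma level_set_timelike:
  assumes "cub x = 1" "l x > 0"
  shows "lorentz_form \<tau> J x x > 0"
  using assms by (metis cub_def zero_less_mult_pos zero_less_one)

lemma chamber_clopen:
  assumes "\<sigma> \<noteq> 0"
  shows "openin (top_of_set {x. cub x = 1}) (chamber \<sigma>)"
    and "closedin (top_of_set {x. cub x = 1}) (chamber \<sigma>)"
proof -
  have "open ({x. l x > 0} \<inter> {x. \<sigma> * x $ \<tau> > 0})"
    by (intro open_Int open_Collect_less continuous_intros)
  moreover have "chamber \<sigma> = {x. cub x = 1} \<inter> ({x. l x > 0} \<inter> {x. \<sigma> * x $ \<tau> > 0})"
    by (auto simp: chamber_def)
  ultimately show "openin (top_of_set {x. cub x = 1}) (chamber \<sigma>)"
    unfolding openin_open by blast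
  have "closed ({x. l x \<ge> 0} \<inter> {x. \<sigma> * x $ \<tau> \<ge> 0})"
    by (intro closed_Int closed_Collect_le continuous_intros)
  moreover have "chamber \<sigma> = {x. cub x = 1} \<inter> ({x. l x \<ge> 0} \<inter> {x. \<sigma> * x $ \<tau> \<ge> 0})"
  proof -
    have "l x > 0 \<and> \<sigma> * x $ \<tau> > 0" if "cub x = 1" "l x \<ge> 0" "\<sigma> * x $ \<tau> \<ge> 0" for x
    proof -
      have "l x \<noteq> 0"
        using that(1) by (auto simp: cub_def)
      then have "l x > 0"
        using that(2) by simp
      then show ?thesis
        using lorentz_form_pos_imp_timelike(1)[OF level_set_timelike[OF that(1)]] that(3) assms
        by (simp add: less_le)
    qed
    then show ?thesis
      by (auto simp: chamber_def)
  qed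
  ultimately show "closedin (top_of_set {x. cub x = 1}) (chamber \<sigma>)"
    unfolding closedin_closed by blast
qed

lemma chamber_nonempty:
  assumes "l x > 0" "\<sigma> * x $ \<tau> > 0" "lorentz_form \<tau> J x x > 0"
  shows "chamber \<sigma> \<noteq> {}"
proof -
  have pos: "cub x > 0"
    using assms by (simp add: cub_def)
  then have "rescale x \<in> chamber \<sigma>"
    using cub_rescale[OF pos] assms pos by (auto simp: chamber_def rescale_def l_simps zero_less_mult_iff mult_less_0_iff)
  then show ?thesis by blast
qed

text \<open>
  The chamber is the radial projection of a convex cone: a half space intersected with a solid
  light cone.
\<close>

lemma chamber_connected:
  assumes \<sigma>: "\<bar>\<sigma>\<bar> = 1"
  shows "connected (chamber \<sigma>)"
proof -
  define C where "C = {x. l x > 0 \<and> L2_set (\<lambda>j. x $ j) J < \<sigma> * x $ \<tau>}"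
  have "convex C"
  proof (rule convexI)
    fix x y :: "real^'m" and u v :: real
    assume xy: "x \<in> C" "y \<in> C" and uv: "0 \<le> u" "0 \<le> v" "u + v = 1"
    have pos: "0 < u * s + v * t" if "0 < s" "0 < t" for s t :: real
      using uv that by (smt (verit) mult_nonneg_nonneg mult_pos_pos)
    have "L2_set (\<lambda>j. (u *\<^sub>R x + v *\<^sub>R y) $ j) J \<le> u * L2_set (\<lambda>j. x $ j) J + v * L2_set (\<lambda>j. y $ j) J"
      using L2_set_triangle_ineq[of "\<lambda>j. u * x $ j" "\<lambda>j. v * y $ j" J] uv
      by (simp add: L2_set_right_distrib)
    moreover have "0 < u * (\<sigma> * x $ \<tau> - L2_set (\<lambda>j. x $ j) J) + v * (\<sigma> * y $ \<tau> - L2_set (\<lambda>j. y $ j) J)"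
      using xy by (intro pos) (auto simp: C_def)
    ultimately have "L2_set (\<lambda>j. (u *\<^sub>R x + v *\<^sub>R y) $ j) J < \<sigma> * (u *\<^sub>R x + v *\<^sub>R y) $ \<tau>"
      by (simp add: algebra_simps)
    moreover have "l (u *\<^sub>R x + v *\<^sub>R y) > 0"
      using xy pos by (simp add: C_def l_simps)
    ultimately show "u *\<^sub>R x + v *\<^sub>R y \<in> C"
      unfolding C_def mem_Collect_eq by (intro conjI)
  qed
  have cone_iff: "L2_set (\<lambda>j. x $ j) J < \<sigma> * x $ \<tau> \<longleftrightarrow> \<sigma> * x $ \<tau> > 0 \<and> lorentz_form \<tau> J x x > 0" for x
  proof -
    have 1: "(\<sigma> * x $ \<tau>)\<^sup>2 = (x $ \<tau>)\<^sup>2"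
      using \<sigma> by (metis abs_mult mult_1 power2_abs)
    have 2: "(L2_set (\<lambda>j. x $ j) J)\<^sup>2 = (\<Sum>j\<in>J. (x $ j)\<^sup>2)"
      by (simp add: L2_set_def sum_nonneg)
    have "lorentz_form \<tau> J x x = (x $ \<tau>)\<^sup>2 - (\<Sum>j\<in>J. (x $ j)\<^sup>2)"
      by (simp add: lorentz_form_def power2_eq_square)
    then have "lorentz_form \<tau> J x x > 0 \<longleftrightarrow> (L2_set (\<lambda>j. x $ j) J)\<^sup>2 < (\<sigma> * x $ \<tau>)\<^sup>2"
      unfolding 1 2 by simp
    moreover have "(L2_set (\<lambda>j. x $ j) J)\<^sup>2 < (\<sigma> * x $ \<tau>)\<^sup>2" if "L2_set (\<lambda>j. x $ j) J < \<sigma> * x $ \<tau>"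
      by (rule power_strict_mono[OF that L2_set_nonneg]) simp
    moreover have "\<sigma> * x $ \<tau> > 0" if "L2_set (\<lambda>j. x $ j) J < \<sigma> * x $ \<tau>"
      using that L2_set_nonneg by (rule le_less_trans[rotated])
    ultimately show ?thesis
      using power2_less_imp_less[of "L2_set (\<lambda>j. x $ j) J" "\<sigma> * x $ \<tau>"] less_imp_le by blast
  qed
  have C_pos: "cub x > 0" if "x \<in> C" for x
    using that by (simp add: C_def cone_iff cub_def)
  have "chamber \<sigma> = rescale ` C"
  proof (intro equalityI subsetI)
    fix x assume x: "x \<in> chamber \<sigma>"
    then have "x \<in> C"
      by (simp add: C_def cone_iff chamber_def level_set_timelike)
    moreover have "rescale x = x"
      using x by (simp add: chamber_def rescale_id)
    ultimately show "x \<in> rescale ` C" by force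
  next
    fix y assume "y \<in> rescale ` C"
    then obtain x where x: "x \<in> C" "y = rescale x" by blast
    then show "y \<in> chamber \<sigma>"
      using cub_rescale[OF C_pos[OF x(1)]] C_pos[OF x(1)]
      by (auto simp: C_def cone_iff chamber_def rescale_def l_simps zero_less_mult_iff mult_less_0_iff)
  qed
  moreover have "connected (rescale ` C)"
    by (intro connected_continuous_image convex_connected \<open>convex C\<close> continuous_on_rescale
        continuous_on_id C_pos)
  ultimately show ?thesis by simp
qed

text \<open>
  The linear forms used for the completeness criterion are \<open>l\<close>, the time coordinate, and the lightlike
  forms \<open>\<sigma> * x $ \<tau> \<plusminus> x $ j\<close>.  On the kernel of each form of the last two kinds the quadratic form is
  nonpositive.
\<close>

theorem chamber_complete:
  assumes \<sigma>: "\<bar>\<sigma>\<bar> = 1" and nonempty: "chamber \<sigma> \<noteq> {}"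
  shows "complete_psr_manifold cub (chamber \<sigma>)"
proof -
  define ray where "ray = (\<lambda>j c (x :: real^'m). \<sigma> * x $ \<tau> + c * x $ j)"
  define \<F> where "\<F> = insert l (insert (\<lambda>x. \<sigma> * x $ \<tau>) ((\<lambda>(j, c). ray j c) ` (J \<times> {1, -1})))"
  have \<F>_cases: "f = l \<or> f = (\<lambda>x. \<sigma> * x $ \<tau>) \<or> (\<exists>j\<in>J. \<exists>c\<in>{1, -1}. f = ray j c)" if "f \<in> \<F>" for f
    using that by (auto simp: \<F>_def)
  have \<sigma>2: "\<sigma> * \<sigma> = 1"
    using \<sigma> by (metis abs_mult_self_eq mult_1)
  have time_kernel: "lorentz_form \<tau> J w w \<le> 0" if "\<sigma> * w $ \<tau> = 0" for w
    using that \<sigma> by (auto simp: lorentz_form_def sum_nonneg)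
  have ray_kernel: "lorentz_form \<tau> J w w \<le> 0" if "ray j c w = 0" "j \<in> J" "c \<in> {1, -1}" for w j c
  proof -
    have "\<sigma> * w $ \<tau> = - (c * w $ j)"
      using that(1) by (simp add: ray_def)
    then have "(\<sigma> * w $ \<tau>)\<^sup>2 = (c * w $ j)\<^sup>2"
      by simp
    moreover have "(\<sigma> * w $ \<tau>)\<^sup>2 = w $ \<tau> * w $ \<tau>" "(c * w $ j)\<^sup>2 = w $ j * w $ j"
      using \<sigma>2 that(3) by (auto simp: power_mult_distrib power2_eq_square[of \<sigma>] power2_eq_square)
    ultimately have "w $ \<tau> * w $ \<tau> = w $ j * w $ j"
      by simp
    moreover have "w $ j * w $ j \<le> (\<Sum>j\<in>J. w $ j * w $ j)"
      using that(2) by (intro member_le_sum) auto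
    ultimately show ?thesis
      by (simp add: lorentz_form_def)
  qed
  have lin: "linear f" if "f \<in> \<F>" for f
    using \<F>_cases[OF that] linear_factor by (auto simp: ray_def linear_iff algebra_simps)
  have pos: "f x > 0" if "f \<in> \<F>" "x \<in> chamber \<sigma>" for f x
  proof -
    have x: "l x > 0" "\<sigma> * x $ \<tau> > 0" "lorentz_form \<tau> J x x > 0"
      using that(2) level_set_timelike by (auto simp: chamber_def)
    have "ray j c x > 0" if "j \<in> J" "c \<in> {1, -1}" for j c
    proof -
      have "\<bar>x $ j\<bar> < \<bar>\<sigma> * x $ \<tau>\<bar>"
        using lorentz_form_pos_imp_timelike(2)[OF x(3) that(1)] \<sigma> by (simp add: abs_mult)
      then show ?thesis
        using x(2) that(2) by (auto simp: ray_def)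
    qed
    then show ?thesis
      using \<F>_cases[OF that(1)] x by auto
  qed
  have eq: "chamber \<sigma> = {x. cub x = 1 \<and> (\<forall>f\<in>\<F>. f x > 0)}"
    using pos by (auto simp: chamber_def) (auto simp: \<F>_def)
  show ?thesis
    unfolding eq
  proof (rule complete_psr_manifoldI)
    show "finite \<F>"
      by (auto simp: \<F>_def intro!: finite_imageI finite_cartesian_product finite)
    show "v = 0" if "\<And>f. f \<in> \<F> \<Longrightarrow> f v = 0" for v
    proof (rule separating)
      show "l v = 0" "v $ \<tau> = 0"
        using that[of l] that[of "\<lambda>x. \<sigma> * x $ \<tau>"] \<sigma> by (auto simp: \<F>_def)
      show "v $ j = 0" if "j \<in> J" for j
        using \<open>v $ \<tau> = 0\<close> \<open>\<And>f. f \<in> \<F> \<Longrightarrow> f v = 0\<close>[of "ray j 1"] that by (force simp: \<F>_def ray_def)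
    qed
    fix f x v assume f: "f \<in> \<F>" and "x \<in> {x. cub x = 1 \<and> (\<forall>f\<in>\<F>. f x > 0)}" and t: "dcub x v = 0"
    then have x: "x \<in> chamber \<sigma>"
      by (simp add: eq)
    then have q: "cub x = 1" "lorentz_form \<tau> J x x > 0"
      by (auto simp: chamber_def level_set_timelike)
    have time: "linear (\<lambda>x :: real^'m. \<sigma> * x $ \<tau>)" "\<sigma> * x $ \<tau> \<noteq> 0"
      using x by (auto simp: chamber_def linear_iff algebra_simps)
    show "(f v / f x)\<^sup>2 \<le> 3 * psr_metric cub x v v"
    proof (cases "f = l")
      case True
      then show ?thesis
        using log_derivative_bounds(2)[OF q(1) t q(2) time time_kernel] by simp
    next
      case False
      then have "lorentz_form \<tau> J w w \<le> 0" if "f w = 0" for w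
        using \<F>_cases[OF f] time_kernel ray_kernel that by blast
      then show ?thesis
        using log_derivative_bounds(1)[OF q(1) t q(2) lin[OF f]] pos[OF f x] by simp
    qed
  qed (use lin nonempty eq in auto)
qed

end

fun model_factor :: "(nat \<Rightarrow> 'm) \<Rightarrow> nat \<Rightarrow> model \<Rightarrow> real^'m::finite \<Rightarrow> real" where
  "model_factor e n Model_a x = - x $ e (n+1)"
| "model_factor e n Model_b x = - (x $ e 1 + x $ e (n+1))"
| "model_factor e n Model_c x = - x $ e 1"
| "model_factor e n Model_d x = x $ e 1"

fun model_time :: "(nat \<Rightarrow> 'm) \<Rightarrow> nat \<Rightarrow> model \<Rightarrow> 'm" where
  "model_time e n Model_a = e n"
| "model_time e n Model_b = e (n+1)"
| "model_time e n Model_c = e (n+1)"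
| "model_time e n Model_d = e 1"

fun model_space :: "(nat \<Rightarrow> 'm) \<Rightarrow> nat \<Rightarrow> model \<Rightarrow> 'm set" where
  "model_space e n Model_a = e ` {1..n-1}"
| "model_space e n Model_b = e ` {1..n}"
| "model_space e n Model_c = e ` {1..n}"
| "model_space e n Model_d = e ` {2..n+1}"

text \<open>
  In model b the linear factor is lightlike and the manifold lies in the past half of the light
  cone.
\<close>

definition model_sign :: "model \<Rightarrow> real" where
  "model_sign m = (if m = Model_b then -1 else 1)"

locale numbering =
  fixes n :: nat and e :: "nat \<Rightarrow> 'm::finite"
  assumes n: "n \<ge> 2" and bij: "bij_betw e {1..n+1} (UNIV :: 'm set)"
begin

lemma inj: "inj_on e {1..n+1}"
  using bij by (simp add: bij_betw_def)

lemma e_eq_iff [simp]: "i \<in> {1..n+1} \<Longrightarrow> j \<in> {1..n+1} \<Longrightarrow> e i = e j \<longleftrightarrow> i = j"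
  using inj by (auto simp: inj_on_def)

lemma index_cases: obtains i where "i \<in> {1..n+1}" "k = e i"
  using bij by (metis UNIV_I bij_betw_def imageE)

lemma vec_eqI: "(\<And>i. i \<in> {1..n+1} \<Longrightarrow> x $ e i = y $ e i) \<Longrightarrow> x = y"
  unfolding vec_eq_iff by (metis index_cases)

lemma sum_image: "A \<subseteq> {1..n+1} \<Longrightarrow> (\<Sum>j\<in>e ` A. f j) = (\<Sum>i\<in>A. f (e i))"
  by (simp add: sum.reindex[OF inj_on_subset[OF inj]])

lemma sum_image_pred: "(\<Sum>j\<in>e ` {Suc 0..n - Suc 0}. f j) = (\<Sum>i=Suc 0..n - Suc 0. f (e i))"
  by (rule sum_image) auto

lemma lorentz_cubic_model: "lorentz_cubic (model_factor e n m) (model_time e n m) (model_space e n m)"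
proof (rule lorentz_cubic.intro)
  show "linear (model_factor e n m)"
    by (cases m) (auto simp: linear_iff algebra_simps)
  show "model_time e n m \<notin> model_space e n m"
    using n by (cases m) auto
  show "v = 0" if "model_factor e n m v = 0" "v $ model_time e n m = 0"
      "\<And>j. j \<in> model_space e n m \<Longrightarrow> v $ j = 0" for v
  proof (rule vec_eqI)
    fix i assume i: "i \<in> {1..n+1}"
    have "v $ e i = 0"
    proof (cases m)
      case Model_a
      have "i \<in> {1..n-1} \<or> i = n \<or> i = n + 1" using i by auto
      then show ?thesis using that Model_a by auto
    next
      case Model_b
      have "i \<in> {1..n} \<or> i = n + 1" using i by auto
      then show ?thesis using that Model_b by auto
    next
      case Model_c
      have "i \<in> {1..n} \<or> i = n + 1" using i by auto
      then show ?thesis using that Model_c by auto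
    next
      case Model_d
      have "i \<in> {2..n+1} \<or> i = 1" using i by auto
      then show ?thesis using that Model_d by auto
    qed
    then show "v $ e i = 0 $ e i" by simp
  qed
qed

sublocale model: lorentz_cubic "model_factor e n m" "model_time e n m" "model_space e n m" for m
  by (rule lorentz_cubic_model)

abbreviation model_form :: "model \<Rightarrow> real^'m \<Rightarrow> real^'m \<Rightarrow> real" where
  "model_form m \<equiv> lorentz_form (model_time e n m) (model_space e n m)"

lemma model_poly_eq_cub: "model_poly e n m = model.cub m"
proof
  show "model_poly e n m x = model.cub m x" for x
    unfolding model.cub_def
    by (cases m) (simp_all add: lorentz_form_def sum_image sum_image_pred power2_eq_square algebra_simps)
qed

lemma model_set_eq_chamber: "model_set e n m = model.chamber m (model_sign m)"
proof -
  have chamber: "model.chamber m (model_sign m) =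
      {x. model_poly e n m x = 1 \<and> model_factor e n m x > 0 \<and> model_sign m * x $ model_time e n m > 0}" for m
    by (simp add: model.chamber_def model_poly_eq_cub)
  have time: "x $ e (n+1) < 0" if "model_poly e n Model_b x = 1" "x $ e 1 + x $ e (n+1) < 0" for x
  proof -
    have "model.cub Model_b x = 1"
      using that(1) by (simp only: model_poly_eq_cub)
    then have "model_form Model_b x x > 0"
      using model.level_set_timelike[of Model_b x] that(2) by simp
    then have "\<bar>x $ e 1\<bar> < \<bar>x $ e (n+1)\<bar>"
      using model.lorentz_form_pos_imp_timelike(2)[of Model_b x "e 1"] n by simp
    then show ?thesis using that(2) by linarith
  qed
  show ?thesis
    unfolding chamber using time
    by (cases m) (auto simp: model_sign_def simp del: model_poly.simps)
qed

lemma model_set_nonempty: "model_set e n m \<noteq> {}"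
proof -
  have "\<exists>x. model_factor e n m x > 0 \<and> model_sign m * x $ model_time e n m > 0 \<and>
      model_form m x x > 0"
  proof (cases m)
    case Model_a
    define x :: "real^'m" where "x = axis (e n) 1 - axis (e (n+1)) 1"
    have "x $ e i = 0" if "i \<in> {1..n-1}" for i
      using that n by (auto simp: x_def axis_def)
    then have "(\<Sum>j\<in>e ` {1..n-1}. x $ j * x $ j) = 0"
      by (intro sum.neutral) auto
    moreover have "x $ e n = 1" "x $ e (n+1) = - 1"
      using n by (auto simp: x_def axis_def)
    ultimately show ?thesis
      using Model_a by (intro exI[of _ x]) (simp add: model_sign_def lorentz_form_def)
  next
    case Model_b
    then show ?thesis
      using n by (intro exI[of _ "- axis (e (n+1)) 1"])
         (simp add: model_sign_def lorentz_form_def sum_image sum_image_pred axis_def)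
  next
    case Model_c
    have "(\<Sum>i = 1..n. (if i = 1 then 1 else 0) * (if i = 1 then 1 else 0)) = (1 :: real)"
      using n by (simp add: if_distrib[of "\<lambda>x. _ * x"] if_distrib[of "\<lambda>x. x * _"] cong: if_cong)
    with Model_c show ?thesis
      using n by (intro exI[of _ "2 *\<^sub>R axis (e (n+1)) 1 - axis (e 1) 1"])
         (simp add: model_sign_def lorentz_form_def sum_image sum_image_pred axis_def cong: if_cong)
  next
    case Model_d
    then show ?thesis
      using n by (intro exI[of _ "axis (e 1) 1"])
         (simp add: model_sign_def lorentz_form_def sum_image sum_image_pred axis_def)
  qed
  then show ?thesis
    using model.chamber_nonempty unfolding model_set_eq_chamber by blast
qed

lemma model_complete: "complete_psr_manifold (model_poly e n m) (model_set e n m)"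
  using model.chamber_complete[of "model_sign m" m] model_set_nonempty[of m]
  by (simp add: model_poly_eq_cub model_set_eq_chamber model_sign_def)

end

section \<open>Normal forms\<close>

lemma connected_subset_clopen:
  assumes "openin (top_of_set U) H" "closedin (top_of_set U) H"
    and "connected T" "T \<subseteq> U" "T \<inter> H \<noteq> {}"
  shows "T \<subseteq> H"
proof -
  have "openin (top_of_set T) (T \<inter> H)" "closedin (top_of_set T) (T \<inter> H)"
    using assms(1,2,4) unfolding openin_open closedin_closed by blast+
  then show ?thesis
    using assms(3,5) unfolding connected_clopen by blast
qed

lemma dim_kernel_functional:
  fixes f :: "'a::euclidean_space \<Rightarrow> real"
  assumes "subspace V" "linear f" "w \<in> V" "f w \<noteq> 0"
  shows "dim {v \<in> V. f v = 0} + 1 = dim V"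
proof -
  let ?K = "{v \<in> V. f v = 0}"
  have sub: "subspace ?K"
    using assms(1,2) by (auto simp: subspace_def linear_0 linear_add linear_scale)
  have "span (insert w ?K) = V"
  proof
    show "span (insert w ?K) \<subseteq> V"
      using assms(1,3) by (intro span_minimal) auto
    show "V \<subseteq> span (insert w ?K)"
    proof
      fix v assume v: "v \<in> V"
      have "v - (f v / f w) *\<^sub>R w \<in> ?K"
        using assms v by (auto simp: linear_diff linear_scale subspace_diff subspace_scale)
      then have "(v - (f v / f w) *\<^sub>R w) + (f v / f w) *\<^sub>R w \<in> span (insert w ?K)"
        by (intro span_add span_scale) (auto intro: span_base)
      then show "v \<in> span (insert w ?K)" by simp
    qed
  qed
  moreover have "w \<notin> span ?K"
    unfolding span_eq_iff[THEN iffD2, OF sub] using assms(4) by simp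
  ultimately show ?thesis
    using dim_insert[of w ?K] by (metis dim_span)
qed

context factored_cubic
begin

lemma linear_sum_B: "B x (\<Sum>b\<in>S. f b *\<^sub>R b) = (\<Sum>b\<in>S. f b * B x b)"
  by (simp add: linear_sum[OF linear_B] linear_scale[OF linear_B])

text \<open>
  A maximal orthonormal family in the subspace spans it; otherwise one Gram--Schmidt step
  enlarges it.
\<close>

lemma orthonormal_basis_of_negative_definite:
  assumes E: "subspace E" and neg: "\<And>x. x \<in> E \<Longrightarrow> x \<noteq> 0 \<Longrightarrow> B x x < 0"
  obtains S where "finite S" "card S = dim E" "S \<subseteq> E" "\<And>b c. b \<in> S \<Longrightarrow> c \<in> S \<Longrightarrow> B b c = (if b = c then -1 else 0)"
    "\<And>x. x \<in> E \<Longrightarrow> x = - (\<Sum>b\<in>S. B b x *\<^sub>R b)"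
proof -
  define P where "P = (\<lambda>S. finite S \<and> S \<subseteq> E \<and> (\<forall>b\<in>S. \<forall>c\<in>S. B b c = (if b = c then -1 else 0)))"
  have pair: "B c (\<Sum>b\<in>S. f b *\<^sub>R b) = - f c" if "P S" "c \<in> S" for S f c
  proof -
    have "(\<Sum>b\<in>S. f b * B c b) = (\<Sum>b\<in>S. if b = c then - f c else 0)"
      using that by (intro sum.cong) (auto simp: P_def)
    then show ?thesis
      using that by (simp add: linear_sum_B P_def)
  qed
  have indep: "independent S" if "P S" for S
  proof (rule independent_if_scalars_zero)
    show "finite S" using that by (simp add: P_def)
    fix f c assume "(\<Sum>b\<in>S. f b *\<^sub>R b) = 0" "c \<in> S"
    then show "f c = 0"
      using pair[OF that, of c f] by (simp add: B_simps)
  qed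
  have "P {}" by (simp add: P_def)
  moreover have "\<forall>S. P S \<longrightarrow> card S < Suc DIM(real^'m)"
    using independent_bound[OF indep] by (simp add: less_Suc_eq_le)
  ultimately have "\<exists>S. P S \<and> (\<forall>S'. P S' \<longrightarrow> card S' \<le> card S)"
    by (rule Lattices_Big.ex_has_greatest_nat)
  then obtain S where S: "P S" and max: "\<And>S'. P S' \<Longrightarrow> card S' \<le> card S"
    by blast
  have expand: "x = - (\<Sum>b\<in>S. B b x *\<^sub>R b)" if x: "x \<in> E" for x
  proof (rule ccontr)
    assume "x \<noteq> - (\<Sum>b\<in>S. B b x *\<^sub>R b)"
    define y where "y = x + (\<Sum>b\<in>S. B b x *\<^sub>R b)"
    have y: "y \<noteq> 0"
      using \<open>x \<noteq> - (\<Sum>b\<in>S. B b x *\<^sub>R b)\<close> unfolding y_def eq_neg_iff_add_eq_0 .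
    have "(\<Sum>b\<in>S. B b x *\<^sub>R b) \<in> E"
      using S by (intro subspace_sum[OF E] subspace_scale[OF E]) (auto simp: P_def)
    then have "y \<in> E"
      using x E by (simp add: y_def subspace_add)
    have orth: "B b y = 0" if "b \<in> S" for b
      using pair[OF S that, of "\<lambda>b. B b x"] by (simp add: y_def B_simps)
    define u where "u = (1 / sqrt (- B y y)) *\<^sub>R y"
    have "B y y < 0"
      using neg \<open>y \<in> E\<close> y by blast
    then have "B u u = -1"
      by (simp add: u_def B_simps)
    moreover have "B b u = 0" "B u b = 0" if "b \<in> S" for b
      using orth[OF that] B_sym[of b y] by (simp_all add: u_def B_simps)
    moreover have "u \<in> E"
      using \<open>y \<in> E\<close> E by (simp add: u_def subspace_scale)
    ultimately have "P (insert u S)" "u \<notin> S"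
      using S by (auto simp: P_def)
    then show False
      using max[of "insert u S"] S by (simp add: P_def)
  qed
  have "E \<subseteq> span S"
  proof
    fix x assume "x \<in> E"
    have "- (\<Sum>b\<in>S. B b x *\<^sub>R b) \<in> span S"
      by (intro span_neg span_sum span_scale span_base)
    then show "x \<in> span S"
      using expand[OF \<open>x \<in> E\<close>] by simp
  qed
  moreover have "S \<subseteq> E"
    using S by (simp add: P_def)
  ultimately have "card S = dim E"
    using basis_card_eq_dim[of S E] indep[OF S] by simp
  then show ?thesis
    using that[of S] S expand by (auto simp: P_def)
qed

lemma orthogonal_projection:
  assumes "finite S" "\<And>b c. b \<in> S \<Longrightarrow> c \<in> S \<Longrightarrow> B b c = (if b = c then -1 else 0)" and b: "b \<in> S"
  shows "B b (v + (\<Sum>c\<in>S. B c v *\<^sub>R c)) = 0"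
proof -
  have "(\<Sum>c\<in>S. B c v * B b c) = (\<Sum>c\<in>S. if c = b then - B b v else 0)"
    using assms(2)[OF b] by (intro sum.cong) auto
  then show ?thesis
    using b assms(1) by (simp add: B_simps linear_sum_B)
qed

lemma pythagoras:
  assumes x: "x = y - (\<Sum>b\<in>S. B b x *\<^sub>R b)" and orth: "\<And>b. b \<in> S \<Longrightarrow> B b y = 0"
  shows "B x x = B y y - (\<Sum>b\<in>S. (B b x)\<^sup>2)"
proof -
  have 1: "B z x = B z y - (\<Sum>b\<in>S. B b x * B z b)" for z
    by (subst x) (simp only: B_simps linear_sum_B)
  have "(\<Sum>b\<in>S. B b x * B y b) = 0"
  proof (intro sum.neutral ballI)
    show "B b x * B y b = 0" if "b \<in> S" for b
      using orth[OF that] B_sym[of y b] by simp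
  qed
  then have "B x y = B y y"
    using 1[of y] B_sym[of x y] by simp
  moreover have "(\<Sum>b\<in>S. B b x * B x b) = (\<Sum>b\<in>S. (B b x)\<^sup>2)"
    unfolding power2_eq_square by (intro sum.cong refl arg_cong2[of _ _ _ _ "(*)"] B_sym)
  ultimately show ?thesis
    using 1[of x] by simp
qed

abbreviation squares :: "(real^'m) set \<Rightarrow> real^'m \<Rightarrow> real" where
  "squares S x \<equiv> (\<Sum>b\<in>S. (B b x)\<^sup>2)"

text \<open>
  The three normal forms use the functionals \<open>B b\<close>, which are, up to sign, the coordinates with
  respect to an orthonormal family \<open>S\<close>.  The last conjunct of each says that the functionals involved form a coordinate system.
\<close>

definition definite_type :: bool where
  "definite_type \<longleftrightarrow> (\<exists>S c. finite S \<and> card S + 1 = CARD('m) \<and> c > 0 \<and>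
     (\<forall>x. B x x = c * (l x)\<^sup>2 - squares S x) \<and>
     (\<forall>x. l x = 0 \<longrightarrow> (\<forall>b\<in>S. B b x = 0) \<longrightarrow> x = 0))"

definition null_type :: bool where
  "null_type \<longleftrightarrow> (\<exists>S m. finite S \<and> card S + 2 = CARD('m) \<and> linear m \<and>
     (\<forall>x. B x x = l x * m x - squares S x) \<and>
     (\<forall>x. l x = 0 \<longrightarrow> m x = 0 \<longrightarrow> (\<forall>b\<in>S. B b x = 0) \<longrightarrow> x = 0))"

definition lorentz_type :: "real \<Rightarrow> real^'m \<Rightarrow> bool" where
  "lorentz_type c p \<longleftrightarrow> (\<exists>S t. finite S \<and> card S + 2 = CARD('m) \<and> linear t \<and> t p > 0 \<and>
     (\<forall>x. B x x = (t x)\<^sup>2 - c * (l x)\<^sup>2 - squares S x) \<and>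
     (\<forall>x. l x = 0 \<longrightarrow> t x = 0 \<longrightarrow> (\<forall>b\<in>S. B b x = 0) \<longrightarrow> x = 0))"

text \<open>
  Vectors annihilated by both \<open>l\<close> and \<open>B p\<close> are tangent at \<open>p\<close>, and on them the metric is a negative
  multiple of the quadratic form.
\<close>

lemma kernel_orthogonal_plane_negative:
  assumes psr: "psr_manifold cub H" and p: "p \<in> H" and lp: "l p > 0"
    and v: "l v = 0" "B p v = 0" "v \<noteq> 0"
  shows "B v v < 0"
proof -
  have "psr_metric cub p v v > 0"
    using v by (intro psr_metric_pos[OF psr p]) (simp_all add: dcub_def)
  moreover have "psr_metric cub p v v = - (2 * l p / 3) * B v v"
    using v by (simp add: psr_metric_cub ddcub_def)
  ultimately show ?thesis
    using lp by (simp add: mult_less_0_iff zero_less_mult_iff)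
qed

lemma definite_typeI:
  assumes p: "cub p = 1" "l p > 0" and neg: "\<And>v. l v = 0 \<Longrightarrow> v \<noteq> 0 \<Longrightarrow> B v v < 0"
  shows definite_type
proof -
  define V where "V = {v. l v = 0}"
  have V: "subspace V"
    by (auto simp: V_def subspace_def l_simps)
  obtain S where S: "finite S" "card S = dim V" "S \<subseteq> V"
    "\<And>b c. b \<in> S \<Longrightarrow> c \<in> S \<Longrightarrow> B b c = (if b = c then -1 else 0)"
    "\<And>x. x \<in> V \<Longrightarrow> x = - (\<Sum>b\<in>S. B b x *\<^sub>R b)"
    using orthonormal_basis_of_negative_definite[OF V] neg by (auto simp: V_def)
  have card: "card S + 1 = CARD('m)"
    using dim_kernel_functional[of UNIV l p] linear_l p(2) S(2) by (simp add: V_def)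
  define u where "u = p + (\<Sum>b\<in>S. B b p *\<^sub>R b)"
  have lu: "l u = l p"
    using S(3) by (auto simp: u_def l_simps linear_sum[OF linear_l] V_def intro!: sum.neutral)
  have Bu: "B b u = 0" if "b \<in> S" for b
    unfolding u_def by (rule orthogonal_projection[OF S(1,4) that])
  have expand: "x = (l x / l p) *\<^sub>R u - (\<Sum>b\<in>S. B b x *\<^sub>R b)" for x
  proof -
    have "x - (l x / l p) *\<^sub>R u \<in> V"
      using p(2) lu by (simp add: V_def l_simps)
    from S(5)[OF this] have "x - (l x / l p) *\<^sub>R u = - (\<Sum>b\<in>S. B b x *\<^sub>R b)"
      by (simp add: B_simps Bu cong: sum.cong)
    then show ?thesis by (simp add: algebra_simps)
  qed
  have form: "B x x = (l x / l p)\<^sup>2 * B u u - squares S x" for x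
    using pythagoras[OF expand[of x]] by (simp add: B_simps Bu power2_eq_square)
  have "B p p > 0"
    using p by (metis cub_def zero_less_mult_pos zero_less_one)
  then have "B u u > 0"
    using form[of p] p(2) sum_nonneg[of S "\<lambda>b. (B b p)\<^sup>2"] by simp
  then have "B u u / (l p)\<^sup>2 > 0"
    using p(2) by simp
  moreover have "B x x = B u u / (l p)\<^sup>2 * (l x)\<^sup>2 - squares S x" for x
    by (subst form) (simp add: power_divide)
  moreover have "x = 0" if "l x = 0" "\<forall>b\<in>S. B b x = 0" for x
    using expand[of x] that by simp
  ultimately show ?thesis
    unfolding definite_type_def using S(1) card by blast
qed

text \<open>
  If the form is not negative definite on the kernel of \<open>l\<close>, it is so on the subspace \<open>E\<close> of vectors
  annihilated by \<open>l\<close> and \<open>B p\<close>, and the orthogonal complement of \<open>E\<close> is a plane spanned by \<open>p\<close> and a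
  vector \<open>w\<close> with \<open>l w = 0\<close> and \<open>B w w \<ge> 0\<close>.  The form on this plane, expressed through \<open>l\<close> and
  either \<open>B p\<close> (if \<open>B w w = 0\<close>) or \<open>B w\<close> (if \<open>B w w > 0\<close>), decides the type.
\<close>

lemma normal_form_cases:
  assumes complete: "complete_psr_manifold cub H" and p: "p \<in> H" and lp: "l p > 0"
  shows "definite_type \<or> null_type \<or> (\<exists>c\<ge>0. lorentz_type c p)"
proof (cases "\<forall>v. l v = 0 \<longrightarrow> v \<noteq> 0 \<longrightarrow> B v v < 0")
  case True
  have "cub p = 1"
    using complete p by (auto simp: complete_psr_manifold_def psr_manifold_def)
  then have definite_type
    by (rule definite_typeI[OF _ lp]) (use True in blast)
  then show ?thesis ..
next
  case False
  have psr: "psr_manifold cub H"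
    using complete by (simp add: complete_psr_manifold_def)
  then have H: "H \<subseteq> {x. cub x = 1}" and cub_p: "cub p = 1"
    using p by (auto simp: psr_manifold_def)
  obtain v where v: "l v = 0" "v \<noteq> 0" "B v v \<ge> 0"
    using False not_less by blast
  have Bpv: "B p v \<noteq> 0"
    using kernel_orthogonal_plane_negative[OF psr p lp v(1) _ v(2)] v(3) not_less by blast
  define E where "E = {x \<in> {x. l x = 0}. B p x = 0}"
  have V: "subspace {x. l x = 0}"
    by (auto simp: subspace_def l_simps)
  have E: "subspace E"
    by (auto simp: E_def subspace_def l_simps B_simps)
  obtain S where S: "finite S" "card S = dim E" "S \<subseteq> E"
    "\<And>b c. b \<in> S \<Longrightarrow> c \<in> S \<Longrightarrow> B b c = (if b = c then -1 else 0)"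
    "\<And>x. x \<in> E \<Longrightarrow> x = - (\<Sum>b\<in>S. B b x *\<^sub>R b)"
    by (rule orthonormal_basis_of_negative_definite[OF E])
       (auto simp: E_def kernel_orthogonal_plane_negative[OF psr p lp])
  have "dim E + 1 = dim {x. l x = 0}"
    unfolding E_def using dim_kernel_functional[OF V linear_B[of p]] v(1) Bpv by blast
  moreover have "dim {x. l x = 0} + 1 = CARD('m)"
    using dim_kernel_functional[of UNIV l p] linear_l lp by simp
  ultimately have card: "card S + 2 = CARD('m)"
    using S(2) by simp
  have SE: "l b = 0" "B p b = 0" "B b p = 0" if "b \<in> S" for b
    using that S(3) B_sym[of b p] by (auto simp: E_def)
  \<comment> \<open>Remove the \<open>E\<close>-component of \<open>v\<close>; the sign is opposite to the
    Euclidean one because \<open>B b b = -1\<close>.\<close>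
  define w where "w = v + (\<Sum>b\<in>S. B b v *\<^sub>R b)"
  have lw: "l w = 0"
    using SE(1) v(1) by (simp add: w_def l_simps linear_sum[OF linear_l])
  have Bpw: "B p w = B p v"
    using SE(2) by (simp add: w_def B_simps linear_sum_B)
  have Bw: "B b w = 0" if "b \<in> S" for b
    unfolding w_def by (rule orthogonal_projection[OF S(1,4) that])
  have "B v v = B w w - (\<Sum>b\<in>S. (B b v)\<^sup>2)"
    by (rule pythagoras[OF _ Bw]) (simp add: w_def)
  then have C_nonneg: "B w w \<ge> 0"
    using v(3) sum_nonneg[of S "\<lambda>b. (B b v)\<^sup>2"] by simp
  define A \<beta> C where "A = B p p" "\<beta> = B p w" "C = B w w"
  note defs = this
  have \<beta>: "\<beta> \<noteq> 0"
    using Bpv Bpw by (simp add: defs)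
  \<comment> \<open>The coordinates of the component of \<open>x\<close> in the plane spanned by
    \<open>p\<close> and \<open>w\<close>.\<close>
  define \<alpha> where "\<alpha> = (\<lambda>x. l x / l p)"
  define \<sigma> where "\<sigma> = (\<lambda>x. (B p x - \<alpha> x * A) / \<beta>)"
  define y where "y = (\<lambda>x. \<alpha> x *\<^sub>R p + \<sigma> x *\<^sub>R w)"
  have By: "B b (y x) = 0" if "b \<in> S" for b x
    using SE(3)[OF that] Bw[OF that] by (simp add: y_def B_simps)
  have expand: "x = y x - (\<Sum>b\<in>S. B b x *\<^sub>R b)" for x
  proof -
    have "x - y x \<in> E"
    proof -
      have "l (y x) = l x"
        using lp lw by (simp add: y_def l_simps \<alpha>_def)
      moreover have "B p (y x) = \<alpha> x * A + \<sigma> x * \<beta>"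
        by (simp add: y_def B_simps defs)
      moreover have "\<sigma> x * \<beta> = B p x - \<alpha> x * A"
        using \<beta> by (simp add: \<sigma>_def)
      ultimately show ?thesis
        by (simp add: E_def l_simps B_simps)
    qed
    from S(5)[OF this] have "x - y x = - (\<Sum>b\<in>S. B b x *\<^sub>R b)"
      by (simp add: B_simps By cong: sum.cong)
    then show ?thesis by (simp add: algebra_simps)
  qed
  have form: "B x x = (\<alpha> x)\<^sup>2 * A + 2 * \<alpha> x * \<sigma> x * \<beta> + (\<sigma> x)\<^sup>2 * C - squares S x" for x
  proof -
    have "B (y x) (y x) = (\<alpha> x)\<^sup>2 * B p p + 2 * \<alpha> x * \<sigma> x * B p w + (\<sigma> x)\<^sup>2 * B w w"
      using B_sym[of w p] unfolding y_def by (simp add: B_simps power2_eq_square algebra_simps)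
    then show ?thesis
      using pythagoras[OF expand[of x] By] by (simp only: defs)
  qed
  have Bpx: "B p x = \<sigma> x * \<beta> + \<alpha> x * A" for x
    using \<beta> by (simp add: \<sigma>_def)
  show ?thesis
  proof (cases "C = 0")
    case True
    define m where "m = (\<lambda>x. (2 * B p x - \<alpha> x * A) / l p)"
    have "linear m"
      using lp by (simp add: m_def \<alpha>_def linear_iff l_simps B_simps field_simps)
    moreover have "B x x = l x * m x - squares S x" for x
    proof -
      have "l x * m x = \<alpha> x * (2 * B p x - \<alpha> x * A)"
        by (simp add: m_def \<alpha>_def)
      then show ?thesis
        using form[of x] True by (simp add: Bpx power2_eq_square algebra_simps)
    qed
    moreover have "x = 0" if "l x = 0" "m x = 0" "\<forall>b\<in>S. B b x = 0" for x
    proof -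
      have "\<alpha> x = 0"
        using that(1) by (simp add: \<alpha>_def)
      then have "\<sigma> x = 0"
        using that(2) lp by (simp add: m_def \<sigma>_def)
      then show ?thesis
        using expand[of x] that(3) \<open>\<alpha> x = 0\<close> by (simp add: y_def)
    qed
    ultimately have null_type
      unfolding null_type_def using S(1) card by blast
    then show ?thesis by blast
  next
    case False
    then have C: "C > 0"
      using C_nonneg by (simp add: defs)
    then have "w \<noteq> 0"
      by (auto simp: defs B_simps)
    define D where "D = A - \<beta>\<^sup>2 / C"
    \<comment> \<open>\<open>D\<close> is the value of the quadratic form at the vector \<open>u\<close>
      orthogonal to the kernel of \<open>l\<close> with \<open>l u = l p\<close>.\<close>
    have D: "D \<le> 0"
    proof (rule ccontr)
      assume "\<not> D \<le> 0"
      define u where "u = p - (\<beta> / C) *\<^sub>R w"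
      have lu: "l u = l p"
        by (simp add: u_def l_simps lw)
      have Buw: "B u w = 0" "B w u = 0"
        using C B_sym[of w u] by (simp_all add: u_def B_simps defs[symmetric])
      have Buu: "B u u = D"
      proof -
        have "B u u = B p u - (\<beta> / C) * B w u"
          by (subst (1) u_def) (simp add: B_simps)
        also have "B p u = A - (\<beta> / C) * \<beta>"
          by (simp add: u_def B_simps defs)
        finally show ?thesis
          by (simp add: Buw D_def power2_eq_square)
      qed
      \<comment> \<open>On the segment \<open>l\<close> is constant and the form is \<open>D\<close> plus a
        nonnegative term, so the segment projects into the component of \<open>p\<close>.\<close>
      have pos: "cub x > 0" if "x \<in> closed_segment u p" for x
      proof -
        obtain s where "x = (1 - s) *\<^sub>R u + s *\<^sub>R p"
          using \<open>x \<in> _\<close> by (auto simp: in_segment)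
        moreover have "p = u + (\<beta> / C) *\<^sub>R w"
          by (simp add: u_def)
        ultimately have "x = (1 - s) *\<^sub>R u + s *\<^sub>R (u + (\<beta> / C) *\<^sub>R w)"
          by simp
        then have x: "x = u + (s * \<beta> / C) *\<^sub>R w"
          by (simp add: algebra_simps)
        have "B x x = D + (s * \<beta> / C)\<^sup>2 * C"
          by (simp add: x B_simps Buu Buw defs power2_eq_square)
        moreover have "(s * \<beta> / C)\<^sup>2 * C \<ge> 0"
          using C by simp
        ultimately have "B x x > 0"
          using \<open>\<not> D \<le> 0\<close> by linarith
        moreover have "l x = l p"
          by (simp add: x l_simps lw lu)
        ultimately show ?thesis
          using lp by (simp add: cub_def)
      qed
      have "rescale ` closed_segment u p \<subseteq> H"
      proof (rule connected_subset_clopen[OF psr_manifold_openin[OF psr]])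
        show "closedin (top_of_set {x. cub x = 1}) H"
          using complete_psr_manifold_closed[OF complete] H by (simp add: closed_subset)
        show "connected (rescale ` closed_segment u p)"
          by (intro connected_continuous_image connected_segment continuous_on_rescale continuous_on_id pos)
        show "rescale ` closed_segment u p \<subseteq> {x. cub x = 1}"
          using pos cub_rescale by blast
        have "rescale p = p" "p \<in> closed_segment u p"
          using cub_p rescale_id by auto
        then show "rescale ` closed_segment u p \<inter> H \<noteq> {}"
          using p by force
      qed
      then have uH: "rescale u \<in> H" by auto
      define k where "k = inverse (root 3 (cub u))"
      have "k > 0"
        using pos[of u] by (simp add: k_def)
      have ru: "rescale u = k *\<^sub>R u"
        by (simp add: rescale_def k_def)
      have "dcub (rescale u) w = 0"
        by (simp add: ru dcub_def lw Buw B_simps)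
      then have "psr_metric cub (rescale u) w w > 0"
        by (intro psr_metric_pos[OF psr uH]) (use \<open>w \<noteq> 0\<close> in auto)
      moreover have "psr_metric cub (rescale u) w w = - (2 * k * l p * C / 3)"
        by (simp add: psr_metric_cub ddcub_def ru lw l_simps lu defs)
      moreover have "k * l p * C > 0"
        using \<open>k > 0\<close> lp C by simp
      ultimately show False by linarith
    qed
    \<comment> \<open>The factor \<open>sgn \<beta>\<close> orients the time coordinate so that \<open>p\<close>
      lies in the future.\<close>
    define t where "t = (\<lambda>x. sgn \<beta> * B w x / sqrt C)"
    have "linear t"
      by (simp add: t_def linear_iff B_simps algebra_simps add_divide_distrib)
    moreover have "t p > 0"
    proof -
      have "sgn \<beta> * \<beta> > 0"
        using \<beta> by (simp add: sgn_real_def)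
      then show ?thesis
        using C B_sym[of w p] by (simp add: t_def defs)
    qed
    moreover have Bwx: "B w x = \<alpha> x * \<beta> + \<sigma> x * C" for x
    proof -
      have "B w x = B w (y x) - (\<Sum>b\<in>S. B b x * B w b)"
        using arg_cong[OF expand[of x], of "B w"] by (simp only: B_simps linear_sum_B)
      moreover have "(\<Sum>b\<in>S. B b x * B w b) = 0"
      proof (intro sum.neutral ballI)
        show "B b x * B w b = 0" if "b \<in> S" for b
          using Bw[OF that] B_sym[of w b] by simp
      qed
      ultimately show ?thesis
        using B_sym[of w p] by (simp add: y_def B_simps defs)
    qed
    moreover have "B x x = (t x)\<^sup>2 - (- D / (l p)\<^sup>2) * (l x)\<^sup>2 - squares S x" for x
    proof -
      have "(sgn \<beta>)\<^sup>2 = 1"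
        using \<beta> by (simp add: sgn_real_def)
      then have "(t x)\<^sup>2 = (\<alpha> x * \<beta> + \<sigma> x * C)\<^sup>2 / C"
        using C by (simp add: t_def Bwx power_divide power_mult_distrib)
      also have "\<dots> = (\<alpha> x)\<^sup>2 * \<beta>\<^sup>2 / C + 2 * \<alpha> x * \<sigma> x * \<beta> + (\<sigma> x)\<^sup>2 * C"
        using C by (simp add: power2_eq_square field_simps)
      finally have "(t x)\<^sup>2 + D * (\<alpha> x)\<^sup>2 = (\<alpha> x)\<^sup>2 * A + 2 * \<alpha> x * \<sigma> x * \<beta> + (\<sigma> x)\<^sup>2 * C"
        by (simp add: D_def algebra_simps)
      then show ?thesis
        using form[of x] by (simp add: \<alpha>_def power_divide)
    qed
    moreover have "x = 0" if "l x = 0" "t x = 0" "\<forall>b\<in>S. B b x = 0" for x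
    proof -
      have "\<alpha> x = 0"
        using that(1) by (simp add: \<alpha>_def)
      then have "\<sigma> x = 0"
        using that(2) \<beta> C Bwx[of x] by (auto simp: t_def sgn_real_def split: if_splits)
      then show ?thesis
        using expand[of x] that(3) \<open>\<alpha> x = 0\<close> by (simp add: y_def)
    qed
    ultimately have "lorentz_type (- D / (l p)\<^sup>2) p"
      unfolding lorentz_type_def using S(1) card by blast
    moreover have "- D / (l p)\<^sup>2 \<ge> 0"
      using D by (simp add: divide_le_0_iff)
    ultimately show ?thesis by blast
  qed
qed

end

section \<open>The critical set as a linear invariant\<close>

lemma axis_component: "axis k (1 :: real) $ i = (if i = k then 1 else 0)"
  by (simp add: axis_def)

text \<open>
  The critical points of \<open>h\<close> form a cone whose span has a dimension invariant under invertible linear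
  substitutions.
\<close>

definition critical_set :: "(real^'m::finite \<Rightarrow> real) \<Rightarrow> (real^'m) set" where
  "critical_set h = {x. frechet_derivative h (at x) = (\<lambda>v. 0)}"

lemma dim_critical_set_comp:
  fixes L :: "real^'m::finite \<Rightarrow> real^'m"
  assumes L: "linear L" "inj L" and diff: "\<And>x. k differentiable (at x)" and h: "\<And>x. h x = k (L x)"
  shows "dim (critical_set h) = dim (critical_set k)"
proof -
  have surj: "surj L"
    using L by (simp add: linear_injective_imp_surjective)
  have "frechet_derivative h (at x) = (\<lambda>v. frechet_derivative k (at (L x)) (L v))" for x
  proof -
    have "(L has_derivative L) (at x)"
      using L(1) by (rule linear_imp_has_derivative)
    moreover have "(k has_derivative frechet_derivative k (at (L x))) (at (L x))"
      using diff by (simp add: frechet_derivative_works)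
    ultimately have "((\<lambda>x. k (L x)) has_derivative (\<lambda>v. frechet_derivative k (at (L x)) (L v))) (at x)"
      by (rule has_derivative_compose)
    moreover have "h = (\<lambda>x. k (L x))"
      using h by (simp add: fun_eq_iff)
    ultimately have "(h has_derivative (\<lambda>v. frechet_derivative k (at (L x)) (L v))) (at x)"
      by simp
    then show ?thesis
      by (rule frechet_derivative_at[symmetric])
  qed
  then have "x \<in> critical_set h \<longleftrightarrow> L x \<in> critical_set k" for x
    using surj by (auto simp: critical_set_def fun_eq_iff) (metis surjD)
  then have "critical_set k = L ` critical_set h"
    using surj by (auto simp: image_iff) (metis surjD)
  moreover have "dim (L ` critical_set h) = dim (critical_set h)"
    using L by (intro dim_image_eq) (auto intro: inj_on_subset)
  ultimately show ?thesis by simp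
qed

lemma cubic_coeffs_zero:
  fixes a b c d s :: real
  assumes "s \<noteq> 0" and "\<And>t. t \<in> {0, s, -s, 2 * s} \<Longrightarrow> a + b * t + c * t^2 + d * t^3 = 0"
  shows "a + b + c + d = 0"
proof -
  have a: "a = 0"
    using assms(2)[of 0] by simp
  have 1: "b * s + c * s^2 + d * s^3 = 0" "- b * s + c * s^2 - d * s^3 = 0"
    "2 * (b * s) + 4 * (c * s^2) + 8 * (d * s^3) = 0"
    using assms(2)[of s] assms(2)[of "-s"] assms(2)[of "2 * s"] a
    by (simp_all add: power2_eq_square power3_eq_cube algebra_simps)
  then have "b * s = 0" "c * s^2 = 0" "d * s^3 = 0"
    by linarith+
  then show ?thesis
    using a assms(1) by simp
qed

context factored_cubic
begin

lemma critical_set_iff: "x \<in> critical_set cub \<longleftrightarrow> (\<forall>v. dcub x v = 0)"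
  by (auto simp: critical_set_def frechet_derivative_cub fun_eq_iff)

text \<open>
  Two cubic forms with value \<open>1\<close> on (the image of) \<open>H\<close> agree on the cone over \<open>H\<close> by homogeneity.
  This cone contains a ball, and a cubic polynomial on a line through its centre is determined by
  four values near the centre.
\<close>

lemma cubic_determined_by_psr_manifold:
  assumes K: "factored_cubic l' B'" and psr: "psr_manifold cub H" and L: "linear L"
    and level: "\<And>x. x \<in> H \<Longrightarrow> factored_cubic.cub l' B' (L x) = 1"
  shows "factored_cubic.cub l' B' (L x) = cub x"
proof -
  interpret K: factored_cubic l' B' by (rule K)
  obtain p where p: "p \<in> H"
    using psr by (auto simp: psr_manifold_def hypersurface_def)
  then have cub_p: "cub p = 1"
    using psr by (auto simp: psr_manifold_def)
  obtain e where e: "e > 0" "ball p e \<inter> {x. cub x = 1} \<subseteq> H"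
    using psr_manifold_openin[OF psr] p unfolding openin_contains_ball by blast
  have "open {x. cub x > 0}"
    by (intro open_Collect_less continuous_intros)
  moreover have "continuous_on {x. cub x > 0} rescale"
    by (rule continuous_on_rescale) auto
  ultimately have "open ({x. cub x > 0} \<inter> rescale -` ball p e)"
    using continuous_open_preimage by blast
  moreover have "p \<in> {x. cub x > 0} \<inter> rescale -` ball p e"
    using e(1) by (simp add: cub_p rescale_id)
  ultimately obtain \<delta> where \<delta>: "\<delta> > 0" "ball p \<delta> \<subseteq> {x. cub x > 0} \<inter> rescale -` ball p e"
    using openE by blast
  have near: "K.cub (L y) = cub y" if "y \<in> ball p \<delta>" for y
  proof -
    have pos: "cub y > 0" and "rescale y \<in> ball p e"
      using \<delta>(2) that by blast+
    then have "rescale y \<in> H"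
      using e(2) cub_rescale by blast
    then have "K.cub (L (rescale y)) = 1"
      by (rule level)
    then have "inverse (root 3 (cub y)) ^ 3 * K.cub (L y) = 1"
      by (simp add: rescale_def linear_scale[OF L] K.cub_scaleR)
    then show ?thesis
      using pos root3_cubed[of "cub y"] by (simp add: power_inverse field_simps)
  qed
  define v where "v = x - p"
  define N where "N = norm v + 1"
  \<comment> \<open>The four parameters \<open>0\<close>, \<open>s\<close>, \<open>-s\<close>, \<open>2 *
    s\<close> keep the point on the line within the ball of radius \<open>\<delta>\<close>.\<close>
  define s where "s = \<delta> / (3 * N)"
  have N: "N > 0" "norm v < N"
    by (simp_all add: N_def add_nonneg_pos)
  then have s: "s > 0" "3 * s * N = \<delta>"
    using \<delta>(1) by (simp_all add: s_def)
  have "s * norm v \<le> s * N" "0 < s * N"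
    using s(1) N by (auto intro: mult_left_mono)
  then have small: "2 * s * norm v < \<delta>"
    using s(2) by linarith
  have "(K.cub (L p) - cub p) + (K.dcub (L p) (L v) - dcub p v)
      + (K.ddcub (L p) (L v) (L v) / 2 - ddcub p v v / 2) + (K.cub (L v) - cub v) = 0"
  proof (rule cubic_coeffs_zero)
    show "s \<noteq> 0" using s(1) by simp
    fix t assume t: "t \<in> {0, s, -s, 2 * s}"
    have "\<bar>t\<bar> * norm v \<le> 2 * s * norm v"
      using t s(1) by (intro mult_right_mono) auto
    then have "p + t *\<^sub>R v \<in> ball p \<delta>"
      using small by (simp add: dist_norm)
    then have "K.cub (L p + t *\<^sub>R L v) = cub (p + t *\<^sub>R v)"
      using near[of "p + t *\<^sub>R v"] by (simp add: linear_add[OF L] linear_scale[OF L])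
    then show "K.cub (L p) - cub p + (K.dcub (L p) (L v) - dcub p v) * t
        + (K.ddcub (L p) (L v) (L v) / 2 - ddcub p v v / 2) * t\<^sup>2 + (K.cub (L v) - cub v) * t ^ 3 = 0"
      unfolding K.cub_expand cub_expand by (simp add: algebra_simps)
  qed
  moreover have "K.cub (L p + 1 *\<^sub>R L v) = K.cub (L x)" "cub (p + 1 *\<^sub>R v) = cub x"
    by (simp_all add: v_def linear_diff[OF L])
  ultimately show ?thesis
    unfolding K.cub_expand cub_expand by simp
qed

text \<open>
  A vector in the kernel of \<open>L\<close> would be a direction in which \<open>cub\<close> is constant, hence a tangent
  vector of length zero.
\<close>

lemma psr_manifold_injective:
  assumes psr: "psr_manifold cub H" and L: "linear L" and h: "\<And>x. k (L x) = cub x"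
  shows "inj L"
proof -
  obtain p where p: "p \<in> H"
    using psr by (auto simp: psr_manifold_def hypersurface_def)
  have "v = 0" if "L v = 0" for v
  proof (rule ccontr)
    assume "v \<noteq> 0"
    have shift: "cub (x + t *\<^sub>R v) = cub x" for x t
      using h[of "x + t *\<^sub>R v"] h[of x] that by (simp add: linear_add[OF L] linear_scale[OF L])
    have "cub v = cub 0"
      using shift[of 0 1] by simp
    also have "cub 0 = 0"
      by (simp add: cub_def l_simps)
    finally have "dcub p v + ddcub p v v / 2 = 0" "- dcub p v + ddcub p v v / 2 = 0"
      using shift[of p 1] shift[of p "-1"] cub_expand[of p 1 v] cub_expand[of p "-1" v] by simp_all
    then have "dcub p v = 0" "ddcub p v v = 0"
      by linarith+
    with psr_metric_pos[OF psr p _ \<open>v \<noteq> 0\<close>] show False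
      by (simp add: psr_metric_cub)
  qed
  then show ?thesis
    using linear_injective_0[OF L] by blast
qed

end

context lorentz_cubic
begin

lemma lorentz_form_axis:
  "lorentz_form \<tau> J x (axis k 1) = (if k = \<tau> then x $ \<tau> else if k \<in> J then - x $ k else 0)"
proof -
  have "(\<Sum>j\<in>J. x $ j * axis k 1 $ j) = (\<Sum>j\<in>J. if j = k then x $ k else 0)"
    by (intro sum.cong) (auto simp: axis_component)
  then show ?thesis
    using time_notin by (auto simp: lorentz_form_def axis_component)
qed

lemma critical_setI: "l x = 0 \<Longrightarrow> lorentz_form \<tau> J x x = 0 \<Longrightarrow> x \<in> critical_set cub"
  by (simp add: critical_set_iff dcub_def)

text \<open>
  The two lightlike vectors \<open>axis \<tau> 1 \<plusminus> axis j 1\<close> are common zeros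
  of both factors, hence critical.
\<close>

lemma axis_in_span_critical_set:
  assumes "j \<in> J" "l (axis \<tau> 1) = 0" "l (axis j 1) = 0"
  shows "axis \<tau> 1 \<in> span (critical_set cub)" "axis j 1 \<in> span (critical_set cub)"
proof -
  define u w :: "real^'m" where "u = axis \<tau> 1 + axis j 1" and "w = axis \<tau> 1 - axis j 1"
  have "u \<in> critical_set cub" "w \<in> critical_set cub"
    using assms time_notin
    by (auto simp: u_def w_def l_simps B_simps lorentz_form_axis axis_component intro!: critical_setI)
  then have "(1 / 2) *\<^sub>R (u + w) \<in> span (critical_set cub)" "(1 / 2) *\<^sub>R (u - w) \<in> span (critical_set cub)"
    by (auto intro!: span_scale span_add span_diff intro: span_base)
  moreover have "(1 / 2) *\<^sub>R (u + w) = axis \<tau> 1" "(1 / 2) *\<^sub>R (u - w) = axis j 1"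
    by (simp_all add: u_def w_def vec_eq_iff)
  ultimately show "axis \<tau> 1 \<in> span (critical_set cub)" "axis j 1 \<in> span (critical_set cub)"
    by simp_all
qed

end

fun critical_dimension :: "nat \<Rightarrow> model \<Rightarrow> nat" where
  "critical_dimension n Model_a = n + 1"
| "critical_dimension n Model_b = 1"
| "critical_dimension n Model_c = n"
| "critical_dimension n Model_d = 0"

context numbering
begin

lemma card_index: "CARD('m) = n + 1"
  using bij_betw_same_card[OF bij] by simp

lemma sum_from_1: "(\<Sum>i=1..n. f i) = f 1 + (\<Sum>i=2..n. f i)" for f :: "nat \<Rightarrow> real"
  using n sum.atLeast_Suc_atMost[of 1 n f] by (simp add: numeral_2_eq_2)

lemma mem_span_if_axes:
  fixes x :: "real^'m"
  assumes "\<And>i. i \<in> {1..n+1} \<Longrightarrow> x $ e i = 0 \<or> axis (e i) 1 \<in> span S"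
  shows "x \<in> span S"
proof -
  have "(\<Sum>k\<in>UNIV. x $ k *\<^sub>R axis k 1) \<in> span S"
  proof (rule span_sum)
    fix k :: 'm
    obtain i where "i \<in> {1..n+1}" "k = e i"
      by (rule index_cases)
    then show "x $ k *\<^sub>R axis k 1 \<in> span S"
      using assms[of i] by (auto intro: span_scale span_zero)
  qed
  then show ?thesis
    using basis_expansion[of x] by (simp add: scalar_mult_eq_scaleR)
qed

lemma critical_setD:
  "x \<in> critical_set (model.cub m) \<Longrightarrow>
    model_factor e n m v * model_form m x x + 2 * model_factor e n m x * model_form m x v = 0"
  by (simp add: model.critical_set_iff model.dcub_def)

text \<open>
  Common zeros of both factors are critical, and so is the radical of the quadratic form if it is
  nontrivial.  In model a the light cone spans the hyperplane \<open>x $ e (n+1) = 0\<close> and the radical is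
  transversal to it.  In model b the kernel of the linear form touches the light cone along a single line.
  In model c the linear form cuts out a Lorentzian hyperplane, which is spanned by its light cone.
  In model d the linear form has no lightlike zeros besides the origin.
\<close>

lemma dim_critical_set_model: "dim (critical_set (model.cub m)) = critical_dimension n m"
  (is "dim ?C = _")
proof (cases m)
  case Model_a
  have "x \<in> span ?C" for x
  proof (rule mem_span_if_axes)
    fix i assume i: "i \<in> {1..n+1}"
    have 1: "axis (e n) 1 \<in> span ?C"
        "axis (e j) 1 \<in> span ?C" if "j \<in> {1..n-1}" for j
      using model.axis_in_span_critical_set[of "e j" m] that n Model_a by (auto simp: axis_component)
    have "axis (e (n+1)) 1 \<in> ?C"
    proof -
      have "model_form m (axis (e (n+1)) 1) v = 0" for v
      proof -
        have "e (n+1) \<noteq> model_time e n m" "e (n+1) \<notin> model_space e n m"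
          using n Model_a by auto
        then show ?thesis
          using model.lorentz_form_axis[of m v "e (n+1)"] model.B_sym by metis
      qed
      then show ?thesis
        by (simp add: model.critical_set_iff model.dcub_def)
    qed
    then have 2: "axis (e (n+1)) 1 \<in> span ?C"
      by (rule span_base)
    have "1 \<in> {1..n-1}"
      using n by auto
    have "i \<in> {1..n-1} \<or> i = n \<or> i = n + 1"
      using i by auto
    then show "x $ e i = 0 \<or> axis (e i) 1 \<in> span ?C"
      using 1(1)[of 1] 1(2)[of i] 2 \<open>1 \<in> {1..n-1}\<close> by blast
  qed
  then have "span ?C = UNIV"
    by blast
  then show ?thesis
    using dim_span[of "?C"] card_index Model_a by simp
next
  case Model_b
  define w :: "real^'m" where "w = axis (e 1) 1 - axis (e (n+1)) 1"
  have w1: "w $ e 1 = 1"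
    using n by (simp add: w_def axis_component)
  have "?C \<subseteq> span {w}"
  proof
    fix x assume "x \<in> ?C"
    note crit = critical_setD[OF this]
    let ?q = "lorentz_form (e (n+1)) (e ` {1..n}) x x"
    have form1: "lorentz_form (e (n+1)) (e ` {1..n}) x (axis (e 1) 1) = - x $ e 1"
      "lorentz_form (e (n+1)) (e ` {1..n}) x (axis (e (n+1)) 1) = x $ e (n+1)"
      using model.lorentz_form_axis[of m x] n Model_b by simp_all
    have "- ?q + 2 * (x $ e 1 + x $ e (n+1)) * x $ e 1 = 0"
      using crit[of "axis (e 1) 1"] form1 n Model_b
      by (simp add: axis_component algebra_simps)
    moreover have "- ?q - 2 * (x $ e 1 + x $ e (n+1)) * x $ e (n+1) = 0"
      using crit[of "axis (e (n+1)) 1"] form1 n Model_b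
      by (simp add: axis_component algebra_simps)
    ultimately have "(x $ e 1 + x $ e (n+1))\<^sup>2 = 0" "?q = 2 * (x $ e 1 + x $ e (n+1)) * x $ e 1"
      by (simp_all add: power2_eq_square algebra_simps)
    then have sum: "x $ e (n+1) = - x $ e 1" and q: "?q = 0"
      by simp_all
    have "(\<Sum>i=1..n. (x $ e i)\<^sup>2) = (x $ e 1)\<^sup>2"
      using q sum by (simp add: lorentz_form_def sum_image power2_eq_square)
    then have "(\<Sum>i=2..n. (x $ e i)\<^sup>2) = 0"
      using sum_from_1[of "\<lambda>i. (x $ e i)\<^sup>2"] by simp
    then have zero: "x $ e i = 0" if "i \<in> {2..n}" for i
      using that by (simp add: sum_nonneg_eq_0_iff)
    have "x = x $ e 1 *\<^sub>R w"
    proof (rule vec_eqI)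
      fix i assume i: "i \<in> {1..n+1}"
      then consider "i = 1" | "i \<in> {2..n}" | "i = n + 1" by force
      then show "x $ e i = (x $ e 1 *\<^sub>R w) $ e i"
        using i n sum zero by cases (auto simp: w_def axis_component)
    qed
    then show "x \<in> span {w}"
      by (metis span_base span_scale insertI1)
  qed
  then have le: "dim ?C \<le> dim {w}"
    by (metis dim_span dim_subset)
  have "w \<in> ?C"
  proof (rule model.critical_setI)
    show "model_factor e n m w = 0"
      using n Model_b by (simp add: w_def axis_component)
    show "model_form m w w = 0"
    proof -
      have e1: "e 1 \<in> model_space e n m" "e 1 \<noteq> model_time e n m" "model_time e n m \<noteq> e 1"
        using n Model_b by auto
      have "w = axis (e 1) 1 - axis (model_time e n m) 1"
        using Model_b by (simp add: w_def)
      then show ?thesis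
        using e1 model.time_notin[of m]
        by (simp add: model.B_simps model.lorentz_form_axis axis_component)
    qed
  qed
  then have "dim {w} \<le> dim ?C"
    by (intro dim_subset) simp
  with le have "dim ?C = dim {w}"
    by (rule antisym)
  moreover have "w \<noteq> 0"
    using w1 by auto
  ultimately show ?thesis
    using Model_b by simp
next
  case Model_c
  have "?C \<subseteq> {x. x $ e 1 = 0}"
  proof
    fix x assume "x \<in> ?C"
    note crit = critical_setD[OF this]
    have "x $ e 1 = 0"
    proof (rule ccontr)
      assume x1: "x $ e 1 \<noteq> 0"
      have "x $ e i = 0" if i: "i \<in> {2..n+1}" for i
      proof -
        have "e i = model_time e n m \<or> e i \<in> model_space e n m" "e i \<noteq> e 1"
          using i n Model_c by (auto simp: image_iff)
        then have "x $ e 1 * x $ e i = 0"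
          using crit[of "axis (e i) 1"] Model_c model.lorentz_form_axis[of m x "e i"]
          by (auto simp: axis_component)
        then show ?thesis using x1 by simp
      qed
      then have "(\<Sum>i=2..n. x $ e i * x $ e i) = 0" "x $ e (n+1) = 0"
        using n by simp_all
      then have "lorentz_form (e (n+1)) (e ` {1..n}) x x = - (x $ e 1 * x $ e 1)"
        using sum_from_1[of "\<lambda>i. x $ e i * x $ e i"] by (simp add: lorentz_form_def sum_image)
      moreover have "lorentz_form (e (n+1)) (e ` {1..n}) x (axis (e 1) 1) = - x $ e 1"
        using model.lorentz_form_axis[of m x "e 1"] n Model_c by simp
      ultimately have "3 * (x $ e 1 * x $ e 1) = 0"
        using crit[of "axis (e 1) 1"] Model_c by (simp add: axis_component)
      then show False using x1 by simp
    qed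
    then show "x \<in> {x. x $ e 1 = 0}" by simp
  qed
  moreover have hyperplane: "subspace {x :: real^'m. x $ e 1 = 0}"
    by (auto simp: subspace_def)
  ultimately have "span ?C \<subseteq> {x. x $ e 1 = 0}"
    by (rule span_minimal)
  moreover have "x \<in> span ?C" if "x $ e 1 = 0" for x
  proof (rule mem_span_if_axes)
    fix i assume i: "i \<in> {1..n+1}"
    have 1: "axis (e (n+1)) 1 \<in> span ?C"
        "axis (e j) 1 \<in> span ?C" if "j \<in> {2..n}" for j
      using model.axis_in_span_critical_set[of "e j" m] that n Model_c by (auto simp: axis_component)
    have "i = 1 \<or> i \<in> {2..n} \<or> i = n + 1"
      using i by auto
    then show "x $ e i = 0 \<or> axis (e i) 1 \<in> span ?C"
      using 1(1)[of 2] 1(2)[of i] that n by auto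
  qed
  ultimately have "span ?C = {x. x $ e 1 = 0}"
    by blast
  then have "dim ?C = dim {x :: real^'m. x $ e 1 = 0}"
    by (metis dim_span)
  moreover have "linear (\<lambda>x :: real^'m. x $ e 1)"
    by (simp add: linear_iff)
  then have "dim {x :: real^'m. x $ e 1 = 0} + 1 = CARD('m)"
    using dim_kernel_functional[of UNIV "\<lambda>x :: real^'m. x $ e 1" "axis (e 1) 1"]
    by (simp add: axis_component)
  ultimately show ?thesis
    using card_index Model_c by simp
next
  case Model_d
  have "x = 0" if "x \<in> ?C" for x
  proof -
    note crit = critical_setD[OF that]
    have form: "lorentz_form (e 1) (e ` {2..n+1}) x x = x $ e 1 * x $ e 1 - (\<Sum>i=2..n+1. x $ e i * x $ e i)"
      using sum_image[of "{2..n+1}" "\<lambda>k. x $ k * x $ k"] by (simp add: lorentz_form_def)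
    have "lorentz_form (e 1) (e ` {2..n+1}) x (axis (e 1) 1) = x $ e 1"
      using model.lorentz_form_axis[of m x "e 1"] Model_d by simp
    then have 1: "(\<Sum>i=2..n+1. x $ e i * x $ e i) = 3 * (x $ e 1 * x $ e 1)"
      using crit[of "axis (e 1) 1"] Model_d form by (simp add: axis_component)
    have 2: "x $ e 1 * x $ e i = 0" if i: "i \<in> {2..n+1}" for i
    proof -
      have "e i \<in> model_space e n m" "e i \<noteq> e 1"
        using i n Model_d by auto
      then show ?thesis
        using crit[of "axis (e i) 1"] Model_d model.lorentz_form_axis[of m x "e i"]
        by (auto simp: axis_component)
    qed
    have x1: "x $ e 1 = 0"
    proof (rule ccontr)
      assume "x $ e 1 \<noteq> 0"
      then have "(\<Sum>i=2..n+1. x $ e i * x $ e i) = 0"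
        using 2 by (intro sum.neutral) auto
      then show False
        using 1 \<open>x $ e 1 \<noteq> 0\<close> by simp
    qed
    then have "\<forall>i\<in>{2..n+1}. x $ e i * x $ e i = 0"
      using 1 by (subst sum_nonneg_eq_0_iff[symmetric]) auto
    then show ?thesis
      using x1 by (intro vec_eqI) (metis One_nat_def Suc_1 atLeastAtMost_iff le_antisym
          mult_eq_0_iff not_less_eq_eq zero_index)
  qed
  then show ?thesis
    using Model_d by (auto simp: dim_eq_0)
qed

end

section \<open>The classification\<close>

context numbering
begin

lemma coordinate_map:
  assumes "\<And>i. i \<in> {1..n+1} \<Longrightarrow> linear (g i :: real^'m \<Rightarrow> real)"
  obtains L :: "real^'m \<Rightarrow> real^'m" where "linear L" "\<And>x i. i \<in> {1..n+1} \<Longrightarrow> L x $ e i = g i x"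
proof
  define L where "L = (\<lambda>x. \<chi> k. g (inv_into {1..n+1} e k) x)"
  have "inv_into {1..n+1} e k \<in> {1..n+1}" for k
    using bij by (intro inv_into_into) (auto simp: bij_betw_def)
  then show "linear L"
    using assms by (auto simp: L_def linear_iff vec_eq_iff)
  show "L x $ e i = g i x" if "i \<in> {1..n+1}" for x i
    using that inj by (simp add: L_def)
qed

lemma model_set_connected: "connected (model_set e n m)"
  unfolding model_set_eq_chamber by (rule model.chamber_connected) (simp add: model_sign_def)

lemma model_set_clopen:
  "openin (top_of_set {x. model_poly e n m x = 1}) (model_set e n m)"
  "closedin (top_of_set {x. model_poly e n m x = 1}) (model_set e n m)"
  unfolding model_set_eq_chamber model_poly_eq_cub
  by (rule model.chamber_clopen, simp add: model_sign_def)+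

lemma equivalent_model_unique:
  assumes fc: "factored_cubic l B" and psr: "psr_manifold (factored_cubic.cub l B) H"
    and equiv: "linearly_equivalent H (model_set e n m)"
  shows "dim (critical_set (factored_cubic.cub l B)) = critical_dimension n m"
proof -
  interpret factored_cubic l B by (rule fc)
  obtain L where L: "linear L" "bij_betw L H (model_set e n m)"
    using equiv unfolding linearly_equivalent_def by blast
  have level: "model.cub m (L x) = 1" if "x \<in> H" for x
  proof -
    have "L x \<in> model.chamber m (model_sign m)"
      using L(2) that by (auto simp: bij_betw_def model_set_eq_chamber)
    then show ?thesis by (simp add: model.chamber_def)
  qed
  have pull: "model.cub m (L x) = cub x" for x
    using cubic_determined_by_psr_manifold[OF model.factored_cubic_axioms psr L(1) level] .
  have "dim (critical_set cub) = dim (critical_set (model.cub m))"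
  proof (rule dim_critical_set_comp[OF L(1)])
    show "inj L"
      by (rule psr_manifold_injective[OF psr L(1) pull])
    show "model.cub m differentiable at x" for x
      using model.cub_has_derivative differentiableI by blast
  qed (simp add: pull)
  then show ?thesis
    by (simp add: dim_critical_set_model)
qed

lemma critical_dimension_inj: "critical_dimension n m = critical_dimension n m' \<Longrightarrow> m = m'"
  using n by (cases m; cases m') auto

lemma enumerate_basis:
  assumes "finite S" "card S + k = CARD('m)" "n + 1 = j + k"
  obtains b where "bij_betw b {i..<i + j} S"
proof -
  have "card {i..<i + j} = card S"
    using assms card_index by simp
  then show ?thesis
    using that finite_same_card_bij[of "{i..<i + j}" S] assms(1) by auto
qed

lemma enumerated_coordinates:
  fixes L :: "real^'m \<Rightarrow> real^'m" and \<beta> :: "'b \<Rightarrow> real^'m \<Rightarrow> real"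
  assumes b: "bij_betw b I S" and "\<mu> \<noteq> 0"
    and L: "\<And>x i. i \<in> I \<Longrightarrow> L x $ e i = \<mu> * \<beta> (b i) x"
  shows "(\<Sum>i\<in>I. (L x $ e i)\<^sup>2) = \<mu>\<^sup>2 * (\<Sum>b\<in>S. (\<beta> b x)\<^sup>2)"
    and "L x = 0 \<Longrightarrow> \<forall>b\<in>S. \<beta> b x = 0"
proof -
  have "(\<Sum>i\<in>I. (L x $ e i)\<^sup>2) = (\<Sum>i\<in>I. \<mu>\<^sup>2 * (\<beta> (b i) x)\<^sup>2)"
    by (intro sum.cong) (simp_all add: L power_mult_distrib)
  then show "(\<Sum>i\<in>I. (L x $ e i)\<^sup>2) = \<mu>\<^sup>2 * (\<Sum>b\<in>S. (\<beta> b x)\<^sup>2)"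
    using sum.reindex_bij_betw[OF b, of "\<lambda>b. \<mu>\<^sup>2 * (\<beta> b x)\<^sup>2"] by (simp add: sum_distrib_left)
  have S: "S = b ` I"
    using b by (simp add: bij_betw_def)
  show "\<forall>b\<in>S. \<beta> b x = 0" if "L x = 0"
    unfolding S using L[of _ x] that \<open>\<mu> \<noteq> 0\<close> by simp
qed

end

text \<open>
  A connected complete manifold of a factored cubic, with a base point at which the linear factor is
  positive.
\<close>

locale complete_reducible = numbering n e + factored_cubic l B
  for n and e :: "nat \<Rightarrow> 'm::finite" and l :: "real^'m \<Rightarrow> real" and B +
  fixes H :: "(real^'m) set" and p :: "real^'m"
  assumes complete: "complete_psr_manifold cub H" and connected_H: "connected H"
    and base_point: "p \<in> H" "l p > 0"
begin

lemma psr: "psr_manifold cub H"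
  using complete by (simp add: complete_psr_manifold_def)

lemma cub_p: "cub p = 1"
  using psr base_point(1) by (auto simp: psr_manifold_def)

text \<open>
  Both \<open>H\<close> and the preimage of the model are connected, open and closed in the level set, and they
  share the point \<open>p\<close>; so they coincide.
\<close>

lemma linearly_equivalent_model:
  assumes L: "linear L" "\<And>x. L x = 0 \<Longrightarrow> x = 0"
    and pull: "\<And>x. model_poly e n m (L x) = cub x"
    and p: "L p \<in> model_set e n m"
  shows "linearly_equivalent H (model_set e n m)"
proof -
  have inj: "inj L"
    using L linear_injective_0 by blast
  then have surj: "surj L"
    using L(1) by (simp add: linear_injective_imp_surjective)
  define M where "M = L -` model_set e n m"
  have cont: "continuous_on UNIV L"
    using L(1) by (simp add: linear_continuous_on linear_conv_bounded_linear)
  have M_sub: "M \<subseteq> {x. cub x = 1}"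
    using model_set_clopen(1)[of m] pull unfolding M_def openin_open by auto
  have M_eq: "M = {x. cub x = 1} \<inter> L -` model_set e n m"
    using M_sub by (auto simp: M_def)
  have contM: "continuous_on {x. cub x = 1} L" and L_level: "L \<in> {x. cub x = 1} \<rightarrow> {x. model_poly e n m x = 1}"
    using continuous_on_subset[OF cont] pull by auto
  have M_open: "openin (top_of_set {x. cub x = 1}) M"
    unfolding M_eq by (rule continuous_openin_preimage[OF contM L_level model_set_clopen(1)])
  have M_closed: "closedin (top_of_set {x. cub x = 1}) M"
    unfolding M_eq by (rule continuous_closedin_preimage_gen[OF contM L_level model_set_clopen(2)])
  have "H \<subseteq> M"
  proof (rule connected_subset_clopen[OF M_open M_closed connected_H])
    show "H \<subseteq> {x. cub x = 1}"
      using psr by (simp add: psr_manifold_def)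
    show "H \<inter> M \<noteq> {}"
      using base_point(1) p by (auto simp: M_def)
  qed
  moreover have "M \<subseteq> H"
  proof (rule connected_subset_clopen[OF psr_manifold_openin[OF psr] _ _ M_sub])
    show "closedin (top_of_set {x. cub x = 1}) H"
      using complete_psr_manifold_closed[OF complete] psr by (simp add: closed_subset psr_manifold_def)
    have "linear (inv L)"
      using L(1) inj surj by (simp add: inj_linear_imp_inv_linear)
    moreover have "M = inv L ` model_set e n m"
      unfolding M_def using inj surj by (simp add: bij_def bij_vimage_eq_inv_image)
    ultimately show "connected M"
      using model_set_connected[of m] connected_continuous_image[of "model_set e n m" "inv L"]
      by (simp add: linear_continuous_on linear_conv_bounded_linear)
    show "M \<inter> H \<noteq> {}"
      using base_point(1) p by (auto simp: M_def)
  qed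
  ultimately have "H = L -` model_set e n m"
    by (simp add: M_def)
  then have "L ` H = model_set e n m"
    using surj_image_vimage_eq[OF surj] by simp
  then have "bij_betw L H (model_set e n m)"
    using inj by (auto simp: bij_betw_def intro: inj_on_subset)
  then show ?thesis
    unfolding linearly_equivalent_def using L(1) by blast
qed

text \<open>
  The scaling factors solve \<open>\<kappa> ^ 3 = c\<close> and \<open>\<kappa> * \<mu>\<^sup>2 = 1\<close>, which normalises the coefficients of
  \<open>(l x) ^ 3\<close> and of the mixed terms separately.
\<close>

lemma definite_type_equivalent:
  assumes ty: "definite_type"
  shows "linearly_equivalent H (model_set e n Model_d)"
proof -
  obtain S c where S: "finite S" "card S + 1 = CARD('m)" and c: "c > 0"
    and form: "\<And>x. B x x = c * (l x)\<^sup>2 - squares S x"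
    and inj: "\<And>x. l x = 0 \<Longrightarrow> (\<forall>b\<in>S. B b x = 0) \<Longrightarrow> x = 0"
    using ty unfolding definite_type_def by blast
  obtain b where "bij_betw b {2..<2 + n} S"
    using enumerate_basis[OF S, of n 2] by auto
  moreover have "{2..<2 + n} = {2..n+1}"
    by auto
  ultimately have b: "bij_betw b {2..n+1} S"
    by simp
  define \<kappa> \<mu> where "\<kappa> = root 3 c" and "\<mu> = 1 / sqrt \<kappa>"
  have \<kappa>: "\<kappa> > 0" "\<kappa>^3 = c"
    using c by (simp_all add: \<kappa>_def)
  then have \<mu>: "\<mu> > 0" "\<kappa> * \<mu>\<^sup>2 = 1"
    by (simp_all add: \<mu>_def power_divide)
  define g where "g = (\<lambda>i x. if i = 1 then \<kappa> * l x else \<mu> * B (b i) x)"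
  have "linear (g i)" for i
    by (simp add: g_def linear_iff l_simps B_simps algebra_simps)
  then obtain L :: "real^'m \<Rightarrow> real^'m" where L: "linear L" "\<And>x i. i \<in> {1..n+1} \<Longrightarrow> L x $ e i = g i x"
    using coordinate_map[of g] by blast
  have L1: "L x $ e 1 = \<kappa> * l x" for x
    using L(2)[of 1 x] n by (simp add: g_def)
  have Lb: "L x $ e i = \<mu> * B (b i) x" if "i \<in> {2..n+1}" for x i
    using L(2)[of i x] that by (simp add: g_def)
  note coords = enumerated_coordinates[where L = L and \<beta> = B, OF b less_imp_neq[OF \<mu>(1), symmetric] Lb]
  have sum: "(\<Sum>i=2..n+1. (L x $ e i)\<^sup>2) = \<mu>\<^sup>2 * squares S x" for x
    by (rule coords(1))
  have pull: "model_poly e n Model_d (L x) = cub x" for x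
  proof -
    have "model_poly e n Model_d (L x) = \<kappa>^3 * (l x)^3 - \<kappa> * \<mu>\<^sup>2 * (l x * squares S x)"
      unfolding model_poly.simps sum L1 by (simp add: power2_eq_square power3_eq_cube algebra_simps)
    also have "\<dots> = cub x"
      unfolding \<kappa>(2) \<mu>(2) cub_def form by (simp add: power2_eq_square power3_eq_cube algebra_simps)
    finally show ?thesis .
  qed
  show ?thesis
  proof (rule linearly_equivalent_model[OF L(1) _ pull])
    show "L p \<in> model_set e n Model_d"
      using pull[of p] L1[of p] \<kappa>(1) cub_p base_point(2) by (simp del: model_poly.simps One_nat_def)
    show "x = 0" if "L x = 0" for x
    proof (rule inj)
      show "l x = 0"
        using L1[of x] that \<kappa>(1) by simp
      show "\<forall>b\<in>S. B b x = 0"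
        using coords(2) that by blast
    qed
  qed
qed

text \<open>
  The product \<open>l x * m x\<close> of the two lightlike coordinates becomes the difference
  of two squares.
\<close>

lemma null_type_equivalent:
  assumes ty: "null_type"
  shows "linearly_equivalent H (model_set e n Model_b)"
proof -
  obtain S m where S: "finite S" "card S + 2 = CARD('m)" and m: "linear m"
    and form: "\<And>x. B x x = l x * m x - squares S x"
    and inj: "\<And>x. l x = 0 \<Longrightarrow> m x = 0 \<Longrightarrow> (\<forall>b\<in>S. B b x = 0) \<Longrightarrow> x = 0"
    using ty unfolding null_type_def by blast
  obtain b where "bij_betw b {2..<2 + (n - 1)} S"
    using enumerate_basis[OF S, of "n - 1" 2] n by auto
  moreover have "{2..<2 + (n - 1)} = {2..n}"
    using n by auto
  ultimately have b: "bij_betw b {2..n} S"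
    by simp
  define g where "g = (\<lambda>i x. if i = 1 then (m x - l x) / 2 else if i = n + 1 then - (l x + m x) / 2
    else B (b i) x)"
  have "linear (g i)" for i
    using m by (simp add: g_def linear_iff l_simps B_simps field_simps)
  then obtain L :: "real^'m \<Rightarrow> real^'m" where L: "linear L" "\<And>x i. i \<in> {1..n+1} \<Longrightarrow> L x $ e i = g i x"
    using coordinate_map[of g] by blast
  have L1: "L x $ e 1 = (m x - l x) / 2" and LN: "L x $ e (n+1) = - (l x + m x) / 2" for x
    using L(2)[of 1 x] L(2)[of "n+1" x] n by (simp_all add: g_def)
  have Lb: "L x $ e i = 1 * B (b i) x" if "i \<in> {2..n}" for x i
    using L(2)[of i x] that by (simp add: g_def)
  note coords = enumerated_coordinates[where L = L and \<beta> = B, OF b one_neq_zero Lb]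
  have sum: "(\<Sum>i=1..n. (L x $ e i)\<^sup>2) = (L x $ e 1)\<^sup>2 + squares S x" for x
    using sum_from_1[of "\<lambda>i. (L x $ e i)\<^sup>2"] coords(1)[of x] by simp
  have pull: "model_poly e n Model_b (L x) = cub x" for x
  proof -
    have "model_poly e n Model_b (L x) =
        (L x $ e 1 + L x $ e (n+1)) * (((L x $ e 1)\<^sup>2 - (L x $ e (n+1))\<^sup>2) + squares S x)"
      unfolding model_poly.simps sum by (simp only: add_diff_eq diff_add_eq)
    also have "L x $ e 1 + L x $ e (n+1) = - l x"
      unfolding L1 LN by (simp add: field_simps)
    also have "(L x $ e 1)\<^sup>2 - (L x $ e (n+1))\<^sup>2 = - (l x * m x)"
      unfolding L1 LN by (simp add: power2_eq_square field_simps)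
    finally show ?thesis
      unfolding cub_def form by (simp add: algebra_simps)
  qed
  show ?thesis
  proof (rule linearly_equivalent_model[OF L(1) _ pull])
    have "L p $ e 1 + L p $ e (n+1) = - l p"
      unfolding L1 LN by (simp add: field_simps)
    then show "L p \<in> model_set e n Model_b"
      unfolding model_set.simps mem_Collect_eq pull using cub_p base_point(2) by simp
    show "x = 0" if "L x = 0" for x
    proof (rule inj)
      have "m x - l x = 0" "l x + m x = 0"
        using L1[of x] LN[of x] that by simp_all
      then show "l x = 0" "m x = 0" by linarith+
      show "\<forall>b\<in>S. B b x = 0"
        using coords(2) that by blast
    qed
  qed
qed

lemma product_type_equivalent:
  assumes ty: "lorentz_type 0 p"
  shows "linearly_equivalent H (model_set e n Model_a)"
proof -
  obtain S t where S: "finite S" "card S + 2 = CARD('m)" and t: "linear t" "t p > 0"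
    and form0: "\<forall>x. B x x = (t x)\<^sup>2 - 0 * (l x)\<^sup>2 - squares S x"
    and inj: "\<forall>x. l x = 0 \<longrightarrow> t x = 0 \<longrightarrow> (\<forall>b\<in>S. B b x = 0) \<longrightarrow> x = 0"
    using ty unfolding lorentz_type_def by (elim exE conjE) (rule that)
  have form: "B x x = (t x)\<^sup>2 - squares S x" for x
    using form0[rule_format, of x] by simp
  obtain b where "bij_betw b {1..<1 + (n - 1)} S"
    using enumerate_basis[OF S, of "n - 1" 1] n by auto
  moreover have "{1..<1 + (n - 1)} = {1..n-1}"
    by auto
  ultimately have b: "bij_betw b {1..n-1} S"
    by simp
  define g where "g = (\<lambda>i x. if i = n then t x else if i = n + 1 then - l x else B (b i) x)"
  have "linear (g i)" for i
    using t by (simp add: g_def linear_iff l_simps B_simps field_simps)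
  then obtain L :: "real^'m \<Rightarrow> real^'m" where L: "linear L" "\<And>x i. i \<in> {1..n+1} \<Longrightarrow> L x $ e i = g i x"
    using coordinate_map[of g] by blast
  have Lt: "L x $ e n = t x" and LN: "L x $ e (n+1) = - l x" for x
    using L(2)[of n x] L(2)[of "n+1" x] n by (simp_all add: g_def)
  have Lb: "L x $ e i = 1 * B (b i) x" if "i \<in> {1..n-1}" for x i
  proof -
    have "i \<in> {1..n+1}" "i \<noteq> n" "i \<noteq> n + 1"
      using that by auto
    then show ?thesis
      using L(2)[of i x] by (simp add: g_def)
  qed
  note coords = enumerated_coordinates[where L = L and \<beta> = B, OF b one_neq_zero Lb]
  have sum: "(\<Sum>i=1..n-1. (L x $ e i)\<^sup>2) = squares S x" for x
    using coords(1)[of x] by simp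
  have pull: "model_poly e n Model_a (L x) = cub x" for x
    unfolding model_poly.simps sum Lt LN cub_def form by (simp add: algebra_simps)
  show ?thesis
  proof (rule linearly_equivalent_model[OF L(1) _ pull])
    show "L p \<in> model_set e n Model_a"
      unfolding model_set.simps mem_Collect_eq pull Lt LN using cub_p base_point(2) t(2) by simp
    show "x = 0" if "L x = 0" for x
    proof (rule inj[THEN spec, THEN mp, THEN mp, THEN mp])
      show "l x = 0"
        using LN[of x] that by simp
      show "t x = 0"
        unfolding Lt[of x, symmetric] that by simp
      show "\<forall>b\<in>S. B b x = 0"
        using coords(2) that by blast
    qed
  qed
qed

lemma spacelike_type_equivalent:
  assumes ty: "lorentz_type c p"
    and c: "c > 0"
  shows "linearly_equivalent H (model_set e n Model_c)"
proof -
  obtain S t where S: "finite S" "card S + 2 = CARD('m)" and t: "linear t" "t p > 0"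
    and form: "\<forall>x. B x x = (t x)\<^sup>2 - c * (l x)\<^sup>2 - squares S x"
    and inj: "\<forall>x. l x = 0 \<longrightarrow> t x = 0 \<longrightarrow> (\<forall>b\<in>S. B b x = 0) \<longrightarrow> x = 0"
    using ty unfolding lorentz_type_def by (elim exE conjE) (rule that)
  obtain b where "bij_betw b {2..<2 + (n - 1)} S"
    using enumerate_basis[OF S, of "n - 1" 2] n by auto
  moreover have "{2..<2 + (n - 1)} = {2..n}"
    using n by auto
  ultimately have b: "bij_betw b {2..n} S"
    by simp
  define \<kappa> \<mu> where "\<kappa> = root 3 c" and "\<mu> = 1 / sqrt \<kappa>"
  have \<kappa>: "\<kappa> > 0" "\<kappa>^3 = c"
    using c by (simp_all add: \<kappa>_def)
  then have \<mu>: "\<mu> > 0" "\<kappa> * \<mu>\<^sup>2 = 1"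
    by (simp_all add: \<mu>_def power_divide)
  define g where "g = (\<lambda>i x. if i = 1 then - \<kappa> * l x else if i = n + 1 then \<mu> * t x else \<mu> * B (b i) x)"
  have "linear (g i)" for i
    using t by (simp add: g_def linear_iff l_simps B_simps field_simps)
  then obtain L :: "real^'m \<Rightarrow> real^'m" where L: "linear L" "\<And>x i. i \<in> {1..n+1} \<Longrightarrow> L x $ e i = g i x"
    using coordinate_map[of g] by blast
  have L1: "L x $ e 1 = - \<kappa> * l x" and LN: "L x $ e (n+1) = \<mu> * t x" for x
    using L(2)[of 1 x] L(2)[of "n+1" x] n by (simp_all add: g_def)
  have Lb: "L x $ e i = \<mu> * B (b i) x" if "i \<in> {2..n}" for x i
    using L(2)[of i x] that by (simp add: g_def)
  note coords = enumerated_coordinates[where L = L and \<beta> = B, OF b less_imp_neq[OF \<mu>(1), symmetric] Lb]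
  have sum: "(\<Sum>i=1..n. (L x $ e i)\<^sup>2) = (L x $ e 1)\<^sup>2 + \<mu>\<^sup>2 * squares S x" for x
    using sum_from_1[of "\<lambda>i. (L x $ e i)\<^sup>2"] coords(1)[of x] by simp
  have pull: "model_poly e n Model_c (L x) = cub x" for x
  proof -
    have "model_poly e n Model_c (L x) =
        \<kappa> * \<mu>\<^sup>2 * (l x * ((t x)\<^sup>2 - squares S x)) - \<kappa>^3 * (l x)^3"
      unfolding model_poly.simps sum L1 LN by (simp add: power2_eq_square power3_eq_cube algebra_simps)
    also have "\<dots> = cub x"
      unfolding \<kappa>(2) \<mu>(2) cub_def form[rule_format] by (simp add: power2_eq_square power3_eq_cube algebra_simps)
    finally show ?thesis .
  qed
  show ?thesis
  proof (rule linearly_equivalent_model[OF L(1) _ pull])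
    show "L p \<in> model_set e n Model_c"
      unfolding model_set.simps mem_Collect_eq pull L1 LN using cub_p base_point(2) t(2) \<kappa>(1) \<mu>(1) by simp
    show "x = 0" if "L x = 0" for x
    proof (rule inj[THEN spec, THEN mp, THEN mp, THEN mp])
      show "l x = 0" "t x = 0"
        using L1[of x] LN[of x] that \<kappa>(1) \<mu>(1) by simp_all
      show "\<forall>b\<in>S. B b x = 0"
        using coords(2) that by blast
    qed
  qed
qed

lemma exists_equivalent_model: "\<exists>m. linearly_equivalent H (model_set e n m)"
  using normal_form_cases[OF complete base_point]
proof (elim disjE exE conjE)
  assume definite_type
  then show ?thesis
    using definite_type_equivalent by blast
next
  assume null_type
  then show ?thesis
    using null_type_equivalent by blast
next
  fix c :: real assume c: "c \<ge> 0" "lorentz_type c p"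
  show ?thesis
  proof (cases "c = 0")
    case True
    then show ?thesis
      using product_type_equivalent c(2) by blast
  next
    case False
    then have "c > 0"
      using c(1) by simp
    then show ?thesis
      using spacelike_type_equivalent[OF c(2)] by blast
  qed
qed

end

context numbering
begin

text \<open>
  Replacing \<open>l\<close> and \<open>B\<close> by their negatives does not change the cubic, so \<open>l\<close> may be taken to be
  positive at a chosen point of \<open>H\<close>.
\<close>

theorem exists_unique_equivalent_model:
  assumes complete: "complete_psr_manifold h H" and H: "connected H" and red: "reducible_poly h"
  shows "\<exists>!m. linearly_equivalent H (model_set e n m)"
proof -
  have psr_h: "psr_manifold h H"
    using complete by (simp add: complete_psr_manifold_def)
  then obtain p where "p \<in> H"
    unfolding psr_manifold_def hypersurface_def by blast
  then have p: "p \<in> H" "h p = 1"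
    using psr_h by (auto simp: psr_manifold_def)
  have "homogeneous_poly 3 h"
    using psr_h by (simp add: psr_manifold_def)
  then obtain l0 B0 where lB0: "linear l0" "bilinear B0" "\<And>x y. B0 x y = B0 y x" "\<And>x. h x = l0 x * B0 x x"
    using reducible_cubic_factors[OF _ red] by blast
  define \<sigma> where "\<sigma> = sgn (l0 p)"
  define l B where "l = (\<lambda>x. \<sigma> * l0 x)" and "B = (\<lambda>x y. \<sigma> * B0 x y)"
  have "l0 p \<noteq> 0"
    using p(2) lB0(4) by auto
  then have \<sigma>: "\<sigma> * \<sigma> = 1" "l p > 0"
    by (auto simp: \<sigma>_def l_def sgn_real_def)
  have fc: "factored_cubic l B"
  proof (rule factored_cubic.intro)
    show "linear l"
      using lB0(1) by (simp add: l_def linear_iff algebra_simps)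
    show "bilinear B"
      using lB0(2) by (simp add: B_def bilinear_def linear_iff algebra_simps)
    show "B x y = B y x" for x y
      by (simp add: B_def lB0(3)[of x y])
  qed
  interpret F: factored_cubic l B by (rule fc)
  have h: "h = F.cub"
  proof
    fix x
    have "F.cub x = l x * B x x"
      by (rule F.cub_def)
    also have "\<dots> = (\<sigma> * \<sigma>) * (l0 x * B0 x x)"
      unfolding l_def B_def by (simp only: mult.assoc mult.left_commute)
    finally have "F.cub x = (\<sigma> * \<sigma>) * (l0 x * B0 x x)" .
    then show "h x = F.cub x"
      using \<sigma>(1) lB0(4)[of x] by simp
  qed
  interpret complete_reducible n e l B H p
    using complete H p(1) \<sigma>(2) unfolding h by unfold_locales
  have "m = m'"
    if "linearly_equivalent H (model_set e n m)" "linearly_equivalent H (model_set e n m')" for m m'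
    using equivalent_model_unique[OF fc psr] that critical_dimension_inj by metis
  then show ?thesis
    using exists_equivalent_model by blast
qed

end

theorem theorem2:
  fixes n :: nat and e :: "nat \<Rightarrow> 'm::finite"
  assumes "n \<ge> 2" and "bij_betw e {1..n+1} (UNIV :: 'm set)"
  shows "(\<forall>m. complete_psr_manifold (model_poly e n m) (model_set e n m)) \<and>
         (\<forall>(h :: real ^ 'm \<Rightarrow> real) H.
            complete_psr_manifold h H \<and> connected H \<and> reducible_poly h \<longrightarrow>
            (\<exists>!m. linearly_equivalent H (model_set e n m)))"
proof -
  interpret numbering n e
    using assms by (rule numbering.intro)
  show ?thesis
    using model_complete exists_unique_equivalent_model by blast
qed

end
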